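(* Fix constants $\gamma > 0$ and $\beta > -1$, let $N = \lceil n/\gamma \rceil$, and for a normalized spike prior $\mathcal{X}$ let $L_n = \frac{d\mathbb{P}_n}{d\mathbb{Q}_n}$ be the likelihood ratio of the spiked Wishart model $\mathsf{Wishart}(n,\gamma,\beta,\mathcal{X})$ (defined in the context). \begin{enumerate} \item Suppose $\beta^2 < \gamma$. Let $\mathcal{X} = \mathrm{trunc}_\beta(\mathsf{iid}(\pi/\sqrt{n}))$, where $\pi$ is a subgaussian distribution on $\mathbb{R}$ with $\mathbb{E}[\pi]=0$ and $\mathbb{E}[\pi^2]=1$. Then for any $D = D(n) = o(n/\log n)$, we have $\|L_n^{\le D}\|_{L^2(\mathbb{Q}_n)} = O(1)$ as $n \to \infty$. \item Suppose $\beta^2 > \gamma$. Let $\mathcal{X} = \mathsf{iid}(\pi/\sqrt{n})$ be $\beta$-good, where $\pi$ is symmetric about zero with $\mathbb{E}[\pi]=0$ and $\mathbb{E}[\pi^2]=1$. Then for any $D = D(n) = \omega(1)$, we have $\|L_n^{\le D}\|_{L^2(\mathbb{Q}_n)} = \omega(1)$ as $n\to\infty$. \end{enumerate}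
   Context: Asymptotic notation refers to $n\to\infty$ with $\gamma,\beta,\pi$ fixed. A real random variable $\pi$ with $\mathbb{E}[\pi]=0$ is subgaussian if there is $\sigma^2$ with $\mathbb{E}[e^{t\pi}] \le e^{\sigma^2t^2/2}$ for all $t\in\mathbb{R}$. A normalized spike prior is a sequence $\mathcal{X}=(\mathcal{X}_n)$ of probability distributions on $\mathbb{R}^n$ such that $\|\bm x\|\to 1$ in probability when $\bm x\sim\mathcal{X}_n$. $\mathcal{X}$ is $\beta$-good if $\beta\|\bm x\|^2 > -1$ almost surely for $\bm x\sim\mathcal{X}_n$, for every $n$. For a distribution $\pi$ on $\mathbb{R}$ (not depending on $n$) with mean $0$ and variance $1$, $\mathsf{iid}(\pi/\sqrt n)$ is the prior under which the entries of $\bm x\in\mathbb{R}^n$ are i.i.d.\ copies of $\pi/\sqrt n$. For a normalized spike prior $\mathcal{X}$, $\mathrm{trunc}_\beta(\mathcal{X})$ samples $\bm x'\sim\mathcal{X}_n$ and outputs $\bm x=\bm x'$ if $\beta\|\bm x'\|^2>-1$ and $\|\bm x'\|^2\le 2$, and $\bm x=\bm 0$ otherwise. Spiked Wishart model $\mathsf{Wishart}(n,\gamma,\beta,\mathcal{X})$, with $N=\lceil n/\gamma\rceil$: under the null $\mathbb{Q}_n$, $\bm y_1,\dots,\bm y_N \sim \mathcal{N}(\bm 0,\bm I_n)$ i.i.d.; under the planted $\mathbb{P}_n$, draw $\bm x\sim\mathcal{X}_n$, and if $\beta\|\bm x\|^2\ge -1$ draw $\bm y_1,\dots,\bm y_N\sim\mathcal{N}(\bm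 0,\bm I_n+\beta\bm x\bm x^\top)$ i.i.d., otherwise draw them i.i.d.\ $\mathcal{N}(\bm 0,\bm I_n)$. For $D\in\mathbb{N}$, $L_n^{\le D}$ denotes the orthogonal projection of $L_n$, in the Hilbert space $L^2(\mathbb{Q}_n)$ with inner product $\langle f,g\rangle = \mathbb{E}_{\mathbb{Q}_n}[fg]$, onto the subspace of polynomials of degree at most $D$ in the $nN$ coordinates of $(\bm y_1,\dots,\bm y_N)$; $\|\cdot\|_{L^2(\mathbb{Q}_n)}$ is the corresponding norm. *)

theory Defs
  imports "HOL-Probability.Probability" "HOL-Library.Landau_Symbols"
begin

text \<open>
  Since the dimension \<open>n\<close> tends to infinity, \<open>\<real>\<^sup>n\<close> is the product space over the index set
  \<open>{..<n}\<close> (functions \<open>nat \<Rightarrow> real\<close>, extensional outside the index set).  A prior is a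
  sequence of measures, the \<open>n\<close>-th one living on \<open>\<real>\<^sup>n\<close>.
\<close>

abbreviation Rn :: "nat \<Rightarrow> (nat \<Rightarrow> real) measure" where
  "Rn n \<equiv> Pi\<^sub>M {..<n} (\<lambda>_. borel)"

definition sqnorm :: "nat \<Rightarrow> (nat \<Rightarrow> real) \<Rightarrow> real" where
  "sqnorm n x = (\<Sum>i<n. (x i)\<^sup>2)"

definition standardized :: "real measure \<Rightarrow> bool" where
  "standardized \<pi> \<longleftrightarrow> real_distribution \<pi> \<and>
     has_bochner_integral \<pi> (\<lambda>x. x) 0 \<and> has_bochner_integral \<pi> (\<lambda>x. x\<^sup>2) 1"

definition subgaussian :: "real measure \<Rightarrow> bool" where
  "subgaussian \<pi> \<longleftrightarrow> real_distribution \<pi> \<and> has_bochner_integral \<pi> (\<lambda>x. x) 0 \<and>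
     (\<exists>\<sigma>::real. \<forall>t::real. integrable \<pi> (\<lambda>x. exp (t * x)) \<and>
        (\<integral>x. exp (t * x) \<partial>\<pi>) \<le> exp (\<sigma>\<^sup>2 * t\<^sup>2 / 2))"

definition symmetric_about_zero :: "real measure \<Rightarrow> bool" where
  "symmetric_about_zero \<pi> \<longleftrightarrow> distr \<pi> borel uminus = \<pi>"

definition iid_prior :: "real measure \<Rightarrow> nat \<Rightarrow> (nat \<Rightarrow> real) measure" where
  "iid_prior \<pi> n = Pi\<^sub>M {..<n} (\<lambda>_. distr \<pi> borel (\<lambda>t. t / sqrt (real n)))"

definition beta_good :: "real \<Rightarrow> (nat \<Rightarrow> (nat \<Rightarrow> real) measure) \<Rightarrow> bool" where
  "beta_good \<beta> X \<longleftrightarrow> (\<forall>n. AE x in X n. \<beta> * sqnorm n x > -1)"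

definition trunc_prior ::
  "real \<Rightarrow> (nat \<Rightarrow> (nat \<Rightarrow> real) measure) \<Rightarrow> nat \<Rightarrow> (nat \<Rightarrow> real) measure" where
  "trunc_prior \<beta> X n = distr (X n) (Rn n)
     (\<lambda>x. if \<beta> * sqnorm n x > -1 \<and> sqnorm n x \<le> 2 then x else (\<lambda>i\<in>{..<n}. 0))"

definition std_gaussian :: "nat \<Rightarrow> (nat \<Rightarrow> real) measure" where
  "std_gaussian n = Pi\<^sub>M {..<n} (\<lambda>_. std_normal_distribution)"

text \<open>
  An \<open>n \<times> n\<close> matrix is a function \<open>nat \<Rightarrow> nat \<Rightarrow> real\<close> of which only the entries with indices
  below \<open>n\<close> matter.  For positive semidefinite \<open>S\<close> the symmetric positive semidefinite square
  root has uniquely determined entries in that range.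
\<close>

definition is_psd_sqrt :: "nat \<Rightarrow> (nat \<Rightarrow> nat \<Rightarrow> real) \<Rightarrow> (nat \<Rightarrow> nat \<Rightarrow> real) \<Rightarrow> bool" where
  "is_psd_sqrt n S A \<longleftrightarrow>
     (\<forall>i<n. \<forall>j<n. A i j = A j i) \<and>
     (\<forall>v. (\<Sum>i<n. \<Sum>j<n. v i * A i j * v j) \<ge> 0) \<and>
     (\<forall>i<n. \<forall>j<n. (\<Sum>k<n. A i k * A k j) = S i j)"

definition psd_sqrt :: "nat \<Rightarrow> (nat \<Rightarrow> nat \<Rightarrow> real) \<Rightarrow> nat \<Rightarrow> nat \<Rightarrow> real" where
  "psd_sqrt n S = (SOME A. is_psd_sqrt n S A)"

text \<open>
  \<open>N(0, S)\<close>, possibly degenerate, as the law of \<open>S\<^bsup>1/2\<^esup> g\<close> with \<open>g\<close> standard Gaussian;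
  meaningful only for positive semidefinite \<open>S\<close>.
\<close>

definition gaussian :: "nat \<Rightarrow> (nat \<Rightarrow> nat \<Rightarrow> real) \<Rightarrow> (nat \<Rightarrow> real) measure" where
  "gaussian n S = distr (std_gaussian n) (Rn n)
     (\<lambda>g. \<lambda>i\<in>{..<n}. \<Sum>j<n. psd_sqrt n S i j * g j)"

definition num_samples :: "real \<Rightarrow> nat \<Rightarrow> nat" where
  "num_samples \<gamma> n = nat \<lceil>real n / \<gamma>\<rceil>"

text \<open>A data point \<open>y\<close> has \<open>y i j\<close> as the \<open>j\<close>-th coordinate of the \<open>i\<close>-th sample.\<close>

definition wishart_null :: "real \<Rightarrow> nat \<Rightarrow> (nat \<Rightarrow> nat \<Rightarrow> real) measure" where
  "wishart_null \<gamma> n = Pi\<^sub>M {..<num_samples \<gamma> n} (\<lambda>_. std_gaussian n)"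

definition spiked_cov :: "real \<Rightarrow> (nat \<Rightarrow> real) \<Rightarrow> nat \<Rightarrow> nat \<Rightarrow> real" where
  "spiked_cov \<beta> x i j = (if i = j then 1 else 0) + \<beta> * x i * x j"

definition wishart_planted ::
  "real \<Rightarrow> real \<Rightarrow> (nat \<Rightarrow> (nat \<Rightarrow> real) measure) \<Rightarrow> nat \<Rightarrow> (nat \<Rightarrow> nat \<Rightarrow> real) measure" where
  "wishart_planted \<gamma> \<beta> X n = X n \<bind> (\<lambda>x.
     if \<beta> * sqnorm n x \<ge> -1
     then Pi\<^sub>M {..<num_samples \<gamma> n} (\<lambda>_. gaussian n (spiked_cov \<beta> x))
     else wishart_null \<gamma> n)"

definition likelihood_ratio ::
  "real \<Rightarrow> real \<Rightarrow> (nat \<Rightarrow> (nat \<Rightarrow> real) measure) \<Rightarrow> nat \<Rightarrow> (nat \<Rightarrow> nat \<Rightarrow> real) \<Rightarrow> real" where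
  "likelihood_ratio \<gamma> \<beta> X n y =
     enn2real (RN_deriv (wishart_null \<gamma> n) (wishart_planted \<gamma> \<beta> X n) y)"

definition polys_upto :: "nat \<Rightarrow> nat \<Rightarrow> nat \<Rightarrow> ((nat \<Rightarrow> nat \<Rightarrow> real) \<Rightarrow> real) set" where
  "polys_upto N n D = {p. \<exists>(A :: (nat \<Rightarrow> nat \<Rightarrow> nat) set) (c :: (nat \<Rightarrow> nat \<Rightarrow> nat) \<Rightarrow> real).
     finite A \<and> (\<forall>\<alpha>\<in>A. (\<Sum>i<N. \<Sum>j<n. \<alpha> i j) \<le> D) \<and>
     p = (\<lambda>y. \<Sum>\<alpha>\<in>A. c \<alpha> * (\<Prod>i<N. \<Prod>j<n. y i j ^ \<alpha> i j))}"

text \<open>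
  \<open>p\<close> is the orthogonal projection of \<open>L\<close> onto the subspace \<open>V\<close>.  Only integrability of
  \<open>(L - p) q\<close> for \<open>q \<in> V\<close> is required, not square integrability of \<open>L\<close>: likelihood ratios
  of the spiked Wishart model need not be in \<open>L\<^sup>2\<close> of the null distribution.
\<close>

definition is_orth_proj :: "'a measure \<Rightarrow> ('a \<Rightarrow> real) set \<Rightarrow> ('a \<Rightarrow> real) \<Rightarrow> ('a \<Rightarrow> real) \<Rightarrow> bool" where
  "is_orth_proj Q V L p \<longleftrightarrow>
     p \<in> V \<and> (\<forall>q\<in>V. has_bochner_integral Q (\<lambda>y. (L y - p y) * q y) 0)"

definition L2_norm :: "'a measure \<Rightarrow> ('a \<Rightarrow> real) \<Rightarrow> real" where
  "L2_norm Q f = sqrt (\<integral>y. (f y)\<^sup>2 \<partial>Q)"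

text \<open>
  The norm of the projection.  It is infinite if there is no projection, which happens only if
  some polynomial in \<open>V\<close> has no finite expectation under the planted distribution.
\<close>

definition proj_norm :: "'a measure \<Rightarrow> ('a \<Rightarrow> real) set \<Rightarrow> ('a \<Rightarrow> real) \<Rightarrow> ennreal" where
  "proj_norm Q V L =
     (if \<exists>p. is_orth_proj Q V L p then ennreal (L2_norm Q (SOME p. is_orth_proj Q V L p)) else \<infinity>)"

definition low_degree_norm ::
  "real \<Rightarrow> real \<Rightarrow> (nat \<Rightarrow> (nat \<Rightarrow> real) measure) \<Rightarrow> nat \<Rightarrow> nat \<Rightarrow> ennreal" where
  "low_degree_norm \<gamma> \<beta> X D n =
     proj_norm (wishart_null \<gamma> n) (polys_upto (num_samples \<gamma> n) n D) (likelihood_ratio \<gamma> \<beta> X n)"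

end

theory Submission
  imports Defs "HOL-Computational_Algebra.Polynomial"
begin

text \<open>
  Given \<open>x\<close>, a sample is \<open>g + c (x \<bullet> g) x\<close> with \<open>g\<close> standard Gaussian and
  \<open>c = \<beta> / (1 + sqrt (1 + \<beta> |x|\<^sup>2))\<close>; Gaussian integration by parts shows that the
  Hermite moment of order \<open>a\<close> of such a sample vanishes for odd \<open>|a|\<close> and is
  \<open>\<beta>\<^bsup>|a|/2\<^esup> (|a| - 1)!! x\<^sup>a\<close> for even \<open>|a|\<close>.  Expanding the projection in Hermite polynomials and
  summing with the multinomial theorem, its squared norm is \<open>\<Sum>\<^sub>d (\<Prod>\<^sub>i w(d\<^sub>i)) E[R\<^bsup>|d|\<^esup>]\<close>, where \<open>d\<close> ranges
  over the degrees in the \<open>N\<close> samples with \<open>|d| \<le> D\<close>, \<open>w(2k) = \<beta>\<^bsup>2k\<^esup> binom(2k,k) / 4\<^sup>k\<close>, and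
  \<open>R = x \<bullet> x'\<close> is the overlap of two independent draws from the prior.

  For \<open>\<beta>\<^sup>2 < \<gamma>\<close>, the terms with \<open>|d| = 2k\<close> have total weight at most
  \<open>(B / w)\<^sup>k exp (N w / (2 (1 - w)))\<close> for \<open>B \<ge> \<beta>\<^sup>2\<close> and every \<open>w\<close> in \<open>(0, 1)\<close>, and a Chernoff bound
  controls \<open>E[R\<^bsup>2k\<^esup>]\<close>, since the product of two independent copies of \<open>\<pi>\<close> has moment generating
  function at most \<open>exp ((1 + \<delta>) t\<^sup>2 / 2)\<close> near 0.  Taking \<open>w = 2k / N\<close> and \<open>t\<^sup>2 = 2k / n\<close>
  bounds the contribution by \<open>O(k \<rho>\<^sup>k)\<close> with \<open>\<rho> < 1\<close>, as long as \<open>k\<close> is at most a small multiple of \<open>n\<close>.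

  For \<open>\<beta>\<^sup>2 > \<gamma>\<close>, one fixed \<open>k\<close> suffices: keeping only the exponents 0 and 2, both for the
  samples and for the coordinates of \<open>x\<close>, the contribution converges to
  \<open>(\<beta>\<^sup>2 / \<gamma>)\<^sup>k binom(2k,k) / 4\<^sup>k\<close>, which is unbounded in \<open>k\<close>.
\<close>

section \<open>Random variables with moments of all orders\<close>

text \<open>Integrability is part of the problem. For the untruncated prior only second moments of
  \<pi> are given: if some Hermite product is not integrable under the planted law, the norm is
  infinite and the lower bound is trivial; otherwise the integrability of monomials in the spike has
  to be recovered from that of the Hermite products. For the truncated prior the spike is bounded
  and all moments exist.

  The likelihood ratio is a Radon-Nikodym derivative, so it yields planted expectations only once
  absolute continuity is known. The covariance root in the model is chosen by \<open>SOME\<close>,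
  so its uniqueness, also for singular covariance, has to be proved.

  The overlap enters because the square of an expectation is one expectation over two independent
  draws. The values w = 2k/N and t^2 = 2k/n minimise w^(-k) exp(N w / 2) and t^(-2k) exp(n t^2 / 2).
  Each minimum contributes e^k, and the resulting e^(2k) cancels against (2k)!/(2k)^(2k) by
  Stirling. Up to arbitrarily small slack (\<beta>^2 N / n)^k remains, so no exponential factor is
  lost and the argument reaches the threshold \<beta>^2 = \<gamma>.\<close>

definition all_moments :: "'a measure \<Rightarrow> ('a \<Rightarrow> real) \<Rightarrow> bool" where
  "all_moments M f \<longleftrightarrow> f \<in> borel_measurable M \<and> (\<forall>p::nat. integrable M (\<lambda>x. \<bar>f x\<bar> ^ p))"

lemma all_moments_measurable: "all_moments M f \<Longrightarrow> f \<in> borel_measurable M"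
  by (simp add: all_moments_def)

lemma all_moments_integrable:
  assumes "all_moments M f" shows "integrable M f"
proof -
  have "integrable M (\<lambda>x. \<bar>f x\<bar> ^ 1)" using assms unfolding all_moments_def by blast
  hence "integrable M (\<lambda>x. \<bar>f x\<bar>)" by (simp only: power_one_right)
  thus ?thesis by (rule integrable_abs_cancel) (use assms in \<open>simp add: all_moments_def\<close>)
qed

lemma all_moments_bounded:
  assumes "finite_measure M" "f \<in> borel_measurable M" "AE x in M. \<bar>f x\<bar> \<le> B"
  shows "all_moments M f"
proof -
  interpret finite_measure M by fact
  have "integrable M (\<lambda>x. \<bar>f x\<bar> ^ p)" for p
  proof (rule integrable_const_bound[where B="\<bar>B\<bar>^p"])
    show "AE x in M. norm (\<bar>f x\<bar> ^ p) \<le> \<bar>B\<bar> ^ p"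
      using assms(3) by eventually_elim (auto intro!: power_mono)
    show "(\<lambda>x. \<bar>f x\<bar> ^ p) \<in> borel_measurable M" using assms(2) by measurable
  qed
  thus ?thesis using assms by (simp add: all_moments_def)
qed

lemma all_moments_const: "finite_measure M \<Longrightarrow> all_moments M (\<lambda>_. c)"
  by (rule all_moments_bounded[where B="\<bar>c\<bar>"]) auto

lemma power_add_le_max_power:
  fixes a b :: real assumes "a \<ge> 0" "b \<ge> 0"
  shows "(a + b) ^ p \<le> 2 ^ p * (a ^ p + b ^ p)"
proof -
  have "(a + b) ^ p \<le> (2 * max a b) ^ p" using assms by (intro power_mono) auto
  also have "\<dots> = 2 ^ p * max a b ^ p" by (simp add: power_mult_distrib)
  also have "max a b ^ p \<le> a ^ p + b ^ p" using assms by (auto simp: max_def)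
  finally show ?thesis by simp
qed

lemma all_moments_add:
  assumes "all_moments M f" "all_moments M g"
  shows "all_moments M (\<lambda>x. f x + g x)"
proof -
  have [measurable]: "f \<in> borel_measurable M" "g \<in> borel_measurable M"
    using assms by (auto simp: all_moments_def)
  have "integrable M (\<lambda>x. \<bar>f x + g x\<bar> ^ p)" for p
  proof (rule Bochner_Integration.integrable_bound)
    show "integrable M (\<lambda>x. 2 ^ p * (\<bar>f x\<bar> ^ p + \<bar>g x\<bar> ^ p))"
      using assms by (simp add: all_moments_def)
    have "\<bar>f x + g x\<bar> ^ p \<le> 2 ^ p * (\<bar>f x\<bar> ^ p + \<bar>g x\<bar> ^ p)" for x
      by (rule order_trans[OF power_mono power_add_le_max_power]) auto
    thus "AE x in M. norm (\<bar>f x + g x\<bar> ^ p) \<le> norm (2 ^ p * (\<bar>f x\<bar> ^ p + \<bar>g x\<bar> ^ p))"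
      by (intro AE_I2) (auto intro: order_trans)
  qed measurable
  thus ?thesis by (simp add: all_moments_def)
qed

text \<open>A product costs a doubling of the exponent, by ab <= a^2 + b^2; asking for all powers at
  once is what closes the class under products, so that integrability of any polynomial expression
  follows structurally.\<close>

lemma all_moments_mult:
  assumes "all_moments M f" "all_moments M g"
  shows "all_moments M (\<lambda>x. f x * g x)"
proof -
  have [measurable]: "f \<in> borel_measurable M" "g \<in> borel_measurable M"
    using assms by (auto simp: all_moments_def)
  have "integrable M (\<lambda>x. \<bar>f x * g x\<bar> ^ p)" for p
  proof (rule Bochner_Integration.integrable_bound)
    show "integrable M (\<lambda>x. \<bar>f x\<bar> ^ (2 * p) + \<bar>g x\<bar> ^ (2 * p))"
      using assms by (simp add: all_moments_def)
    have "\<bar>f x * g x\<bar> ^ p \<le> \<bar>f x\<bar> ^ (2 * p) + \<bar>g x\<bar> ^ (2 * p)" for x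
    proof -
      have *: "a * b \<le> a\<^sup>2 + b\<^sup>2" if "a \<ge> 0" "b \<ge> 0" for a b :: real
      proof -
        have "0 \<le> (a - b)\<^sup>2" "0 \<le> a * b" using that by auto
        thus ?thesis by (simp add: power2_diff)
      qed
      show ?thesis
        using *[of "\<bar>f x\<bar> ^ p" "\<bar>g x\<bar> ^ p"]
        by (simp add: abs_mult power_mult_distrib mult.commute[of 2] power_mult del: power_abs)
    qed
    thus "AE x in M. norm (\<bar>f x * g x\<bar> ^ p) \<le> norm (\<bar>f x\<bar> ^ (2 * p) + \<bar>g x\<bar> ^ (2 * p))"
      by (intro AE_I2) (auto intro: order_trans)
  qed measurable
  thus ?thesis by (simp add: all_moments_def)
qed

lemma all_moments_sum:
  assumes "finite_measure M" "\<And>i. i \<in> I \<Longrightarrow> all_moments M (f i)"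
  shows "all_moments M (\<lambda>x. \<Sum>i\<in>I. f i x)"
  using assms(2)
  by (induction I rule: infinite_finite_induct)
     (auto intro: all_moments_const all_moments_add assms(1))

lemma all_moments_prod:
  assumes "finite_measure M" "\<And>i. i \<in> I \<Longrightarrow> all_moments M (f i)"
  shows "all_moments M (\<lambda>x. \<Prod>i\<in>I. f i x)"
  using assms(2)
  by (induction I rule: infinite_finite_induct)
     (auto intro: all_moments_const all_moments_mult assms(1))

lemma all_moments_poly:
  assumes "finite_measure M" "all_moments M f"
  shows "all_moments M (\<lambda>x. poly p (f x))"
  by (induction p) (auto intro!: all_moments_add all_moments_mult all_moments_const assms)

lemma all_moments_distr:
  assumes "T \<in> measurable M N" "all_moments (distr M N T) f"
  shows "all_moments M (\<lambda>x. f (T x))"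
  using assms by (auto simp: all_moments_def integrable_distr_eq)

section \<open>Hermite polynomials and Gaussian integration by parts\<close>

abbreviation gauss :: "real measure" where
  "gauss \<equiv> std_normal_distribution"

lemma prob_space_gauss: "prob_space gauss"
  using real_dist_normal_dist by (simp add: real_distribution_def)

lemma finite_measure_gauss: "finite_measure gauss"
  using prob_space_gauss by (simp add: prob_space_def)

lemma all_moments_gauss: "all_moments gauss (\<lambda>x. x)"
proof -
  have "integrable gauss (\<lambda>x. \<bar>x\<bar> ^ p)" for p
    using integrable_abs[OF integrable_std_normal_distribution_moment[of p]] by (simp add: power_abs)
  thus ?thesis by (simp add: all_moments_def)
qed

lemma integrable_gauss_poly: "integrable gauss (poly p)"
  using all_moments_integrable[OF all_moments_poly[OF finite_measure_gauss all_moments_gauss]] .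

lemma integrable_gauss_times_poly: "integrable gauss (\<lambda>x. x * poly p x)"
proof -
  have "(\<lambda>x. x * poly p x) = poly ([:0, 1:] * p)" by (rule ext) simp
  thus ?thesis by (simp only: integrable_gauss_poly)
qed

lemma gauss_stein_power:
  "(\<integral>x. x * x ^ m \<partial>gauss) = real m * (\<integral>x. x ^ (m - 1) \<partial>gauss)"
proof (cases "odd m")
  case True
  then obtain k where m: "m = 2 * k + 1" by (auto elim: oddE)
  have "(\<integral>x. x * x ^ m \<partial>gauss) = (\<integral>x. x ^ (2 * (k + 1)) \<partial>gauss)"
    by (simp add: m)
  also have "\<dots> = fact (2 * (k + 1)) / (2^(k + 1) * fact (k + 1))"
    by (rule std_normal_distribution_even_moments)
  also have "\<dots> = real m * (fact (2 * k) / (2^k * fact k))"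
    by (simp add: m divide_simps)
  also have "fact (2 * k) / (2^k * fact k) = (\<integral>x. x ^ (m - 1) \<partial>gauss)"
    using std_normal_distribution_even_moments(1)[of k] by (simp add: m)
  finally show ?thesis .
next
  case False
  have "(\<integral>x. x * x ^ m \<partial>gauss) = 0"
    using integral_std_normal_distribution_moment_odd[of "Suc m"] False by simp
  moreover have "real m * (\<integral>x. x ^ (m - 1) \<partial>gauss) = 0"
    using integral_std_normal_distribution_moment_odd[of "m - 1"] False by (cases m) auto
  ultimately show ?thesis by simp
qed

text \<open>Both sides are linear in \<open>p\<close>. The induction on a degree bound splits off
  the leading monomial, for which the identity is a relation between consecutive even Gaussian
  moments.\<close>

lemma gauss_stein_poly:
  "(\<integral>x. x * poly p x \<partial>gauss) = (\<integral>x. poly (pderiv p) x \<partial>gauss)"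
proof -
  have "\<forall>p. degree p \<le> n \<longrightarrow> (\<integral>x. x * poly p x \<partial>gauss) = (\<integral>x. poly (pderiv p) x \<partial>gauss)" for n
  proof (induction n)
    case 0
    have "(\<integral>x. x * c \<partial>gauss) = 0" for c
      using gauss_stein_power[of 0] by simp
    thus ?case by (auto dest!: degree_0_id[symmetric] simp: pderiv_eq_0_iff elim!: degree_eq_zeroE)
  next
    case (Suc n)
    show ?case
    proof (intro allI impI)
      fix p :: "real poly" assume deg: "degree p \<le> Suc n"
      define a where "a = coeff p (Suc n)"
      define q where "q = p - monom a (Suc n)"
      have "degree q \<le> n"
      proof (rule degree_le, intro allI impI)
        fix i assume "i > n"
        show "coeff q i = 0"
          using deg \<open>i > n\<close> by (cases "i = Suc n") (auto simp: q_def a_def coeff_eq_0)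
      qed
      hence IH: "(\<integral>x. x * poly q x \<partial>gauss) = (\<integral>x. poly (pderiv q) x \<partial>gauss)" using Suc by blast
      have p: "p = q + monom a (Suc n)" by (simp add: q_def)
      have i1: "integrable gauss (\<lambda>x. x * (a * x ^ Suc n))" 
        using integrable_gauss_times_poly[of "monom a (Suc n)"] by (simp add: poly_monom)
      have i2: "integrable gauss (\<lambda>x. a * (real (Suc n) * x ^ n))" 
        by (intro integrable_mult_right integrable_std_normal_distribution_moment)
      have "(\<integral>x. x * poly p x \<partial>gauss) = (\<integral>x. x * poly q x + x * (a * x ^ Suc n) \<partial>gauss)"
        by (intro Bochner_Integration.integral_cong) (auto simp: p poly_monom algebra_simps)
      also have "\<dots> = (\<integral>x. x * poly q x \<partial>gauss) + (\<integral>x. x * (a * x ^ Suc n) \<partial>gauss)"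
        by (intro Bochner_Integration.integral_add integrable_gauss_times_poly i1)
      also have "(\<integral>x. x * (a * x ^ Suc n) \<partial>gauss) = (\<integral>x. a * (x * x ^ Suc n) \<partial>gauss)"
        by (intro Bochner_Integration.integral_cong) auto
      also have "\<dots> = a * (real (Suc n) * (\<integral>x. x ^ n \<partial>gauss))"
        using gauss_stein_power[of "Suc n"] by (simp del: power_Suc)
      also have "\<dots> = (\<integral>x. a * (real (Suc n) * x ^ n) \<partial>gauss)" by simp
      also have "(\<integral>x. x * poly q x \<partial>gauss) + \<dots> = (\<integral>x. poly (pderiv q) x + a * (real (Suc n) * x ^ n) \<partial>gauss)"
        unfolding IH by (intro Bochner_Integration.integral_add[symmetric] integrable_gauss_poly i2)
      also have "\<dots> = (\<integral>x. poly (pderiv p) x \<partial>gauss)"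
        by (intro Bochner_Integration.integral_cong)
           (auto simp: p poly_monom pderiv_add pderiv_monom algebra_simps)
      finally show "(\<integral>x. x * poly p x \<partial>gauss) = (\<integral>x. poly (pderiv p) x \<partial>gauss)" .
    qed
  qed
  thus ?thesis by blast
qed

text \<open>These are the monic (probabilists') Hermite polynomials. The recursion applies x - d/dx,
  the adjoint of d/dx in the L^2 space of the Gaussian, which makes orthogonality and integration by
  parts immediate.\<close>

fun hermite :: "nat \<Rightarrow> real poly" where
  "hermite 0 = 1"
| "hermite (Suc m) = [:0, 1:] * hermite m - pderiv (hermite m)"

lemma pderiv_hermite: "pderiv (hermite m) = smult (real m) (hermite (m - 1))"
proof (induction m)
  case (Suc m)
  show ?case
  proof (cases m)
    case (Suc k)
    have "pderiv (hermite (Suc m)) = hermite m + [:0, 1:] * pderiv (hermite m) - pderiv (pderiv (hermite m))"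
      by (simp add: pderiv_mult pderiv_diff pderiv_pCons)
    also have "\<dots> = hermite m + smult (real m) ([:0, 1:] * hermite k - pderiv (hermite k))"
      using Suc.IH by (simp add: Suc pderiv_smult smult_diff_right)
    also have "[:0, 1:] * hermite k - pderiv (hermite k) = hermite m" by (simp add: Suc)
    finally show ?thesis by (simp add: algebra_simps smult_add_left)
  qed (simp add: pderiv_mult pderiv_pCons)
qed simp

lemma hermite_times_x:
  "[:0, 1:] * hermite m = hermite (Suc m) + smult (real m) (hermite (m - 1))"
  by (simp add: pderiv_hermite)

lemma degree_hermite: "degree (hermite m) \<le> m"
proof (induction m)
  case (Suc m)
  have "degree ([:0, 1:] * hermite m) \<le> Suc m"
    using Suc by (intro order_trans[OF degree_mult_le]) auto
  moreover have "degree (pderiv (hermite m)) \<le> Suc m"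
    using Suc by (simp add: degree_pderiv)
  ultimately show ?case by (simp add: degree_diff_le del: mult_pCons_left)
qed simp

lemma power_eq_hermite_sum: "\<exists>c. \<forall>y. y ^ m = (\<Sum>k\<le>m. c k * poly (hermite k) y)"
proof (induction m)
  case 0
  show ?case by (intro exI[of _ "\<lambda>_. 1"]) simp
next
  case (Suc m)
  then obtain c where c: "\<And>y. y ^ m = (\<Sum>k\<le>m. c k * poly (hermite k) y)" by blast
  \<comment> \<open>Multiplication by y sends the k-th Hermite polynomial to the (k+1)-st plus k
    times the (k-1)-st. Coefficient k thus collects c (k - 1) from below and (k + 1) c (k + 1) from
    above, the latter only while k + 1 does not exceed m.\<close>
  define d where "d k = (if k = 0 then 0 else c (k - 1)) + (if Suc k \<le> m then real (Suc k) * c (Suc k) else 0)" for k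
  have x: "y * poly (hermite k) y = poly (hermite (Suc k)) y + real k * poly (hermite (k - 1)) y" for y k
    using arg_cong[OF hermite_times_x[of k], of "\<lambda>p. poly p y"] by simp
  have "y ^ Suc m = (\<Sum>k\<le>Suc m. d k * poly (hermite k) y)" for y
  proof -
    let ?h = "\<lambda>k. poly (hermite k) y"
    have "y ^ Suc m = (\<Sum>k\<le>m. c k * (y * ?h k))" by (simp add: c sum_distrib_left mult_ac)
    also have "\<dots> = (\<Sum>k\<le>m. c k * ?h (Suc k)) + (\<Sum>k\<le>m. c k * real k * ?h (k - 1))"
      by (simp add: x sum.distrib algebra_simps del: hermite.simps)
    also have "(\<Sum>k\<le>m. c k * ?h (Suc k)) = (\<Sum>k\<le>Suc m. (if k = 0 then 0 else c (k - 1)) * ?h k)"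
      by (subst sum.atMost_Suc_shift) (simp del: hermite.simps)
    also have "(\<Sum>k\<le>m. c k * real k * ?h (k - 1)) = (\<Sum>k\<le>Suc m. (if Suc k \<le> m then real (Suc k) * c (Suc k) else 0) * ?h k)"
    proof -
      have "(\<Sum>k\<le>m. c k * real k * ?h (k - 1)) = (\<Sum>k<m. real (Suc k) * c (Suc k) * ?h k)"
        by (cases m) (simp_all only: sum.atMost_Suc_shift lessThan_Suc_atMost, simp_all add: mult_ac)
      also have "\<dots> = (\<Sum>k\<in>{..<m}. (if Suc k \<le> m then real (Suc k) * c (Suc k) else 0) * ?h k)"
        by (intro sum.cong) auto
      also have "\<dots> = (\<Sum>k\<in>{..Suc m}. (if Suc k \<le> m then real (Suc k) * c (Suc k) else 0) * ?h k)"
        by (intro sum.mono_neutral_left) auto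
      finally show ?thesis .
    qed
    finally show ?thesis by (simp add: d_def sum.distrib[symmetric] algebra_simps del: hermite.simps sum.atMost_Suc)
  qed
  thus ?case by blast
qed

lemma hermite_sum_power: "\<exists>c. \<forall>y. poly (hermite m) y = (\<Sum>k\<le>m. c k * y ^ k)"
proof (intro exI allI)
  fix y
  show "poly (hermite m) y = (\<Sum>k\<le>m. coeff (hermite m) k * y ^ k)"
    unfolding poly_altdef using degree_hermite[of m]
    by (intro sum.mono_neutral_left) (auto simp: coeff_eq_0)
qed

text \<open>Integration by parts applied to \<open>hermite m * q\<close>: of the two terms of the
  product rule, the one differentiating the Hermite factor cancels against the recursion.\<close>

lemma gauss_hermite_Suc_mult:
  "(\<integral>x. poly (hermite (Suc m)) x * poly q x \<partial>gauss) = (\<integral>x. poly (hermite m) x * poly (pderiv q) x \<partial>gauss)"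
proof -
  have "(\<integral>x. poly (hermite (Suc m)) x * poly q x \<partial>gauss)
      = (\<integral>x. x * poly (hermite m * q) x - poly (pderiv (hermite m) * q) x \<partial>gauss)"
    by (intro Bochner_Integration.integral_cong) (auto simp: algebra_simps)
  also have "\<dots> = (\<integral>x. x * poly (hermite m * q) x \<partial>gauss) - (\<integral>x. poly (pderiv (hermite m) * q) x \<partial>gauss)"
    by (intro Bochner_Integration.integral_diff integrable_gauss_poly integrable_gauss_times_poly)
  also have "\<dots> = (\<integral>x. poly (pderiv (hermite m * q)) x - poly (pderiv (hermite m) * q) x \<partial>gauss)"
    unfolding gauss_stein_poly by (intro Bochner_Integration.integral_diff[symmetric] integrable_gauss_poly)
  also have "\<dots> = (\<integral>x. poly (hermite m) x * poly (pderiv q) x \<partial>gauss)"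
    by (intro Bochner_Integration.integral_cong) (auto simp: pderiv_mult algebra_simps)
  finally show ?thesis .
qed

lemma gauss_hermite_orthogonal:
  "(\<integral>x. poly (hermite m) x * poly (hermite k) x \<partial>gauss) = (if m = k then fact m else 0)"
proof (induction m arbitrary: k)
  case 0
  interpret prob_space gauss by (rule prob_space_gauss)
  show ?case
  proof (cases k)
    case (Suc j)
    have "(\<integral>x. poly (hermite (Suc j)) x * poly 1 x \<partial>gauss) = 0"
      by (subst gauss_hermite_Suc_mult) simp
    thus ?thesis using Suc by (simp del: hermite.simps(2))
  qed (use prob_space in simp)
next
  case (Suc m)
  have "(\<integral>x. poly (hermite (Suc m)) x * poly (hermite k) x \<partial>gauss)
     = real k * (\<integral>x. poly (hermite m) x * poly (hermite (k - 1)) x \<partial>gauss)"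
    unfolding gauss_hermite_Suc_mult pderiv_hermite by (simp add: mult_ac flip: integral_mult_right_zero)
  thus ?case using Suc by (cases k) auto
qed

section \<open>Standard Gaussian vectors and integration by parts in one coordinate\<close>

lemma prob_space_std_gaussian: "prob_space (std_gaussian n)"
  unfolding std_gaussian_def by (intro prob_space_PiM prob_space_gauss)

lemma finite_measure_std_gaussian: "finite_measure (std_gaussian n)"
  using prob_space_std_gaussian by (simp add: prob_space_def)

lemma sets_std_gaussian [measurable_cong]: "sets (std_gaussian n) = sets (Rn n)"
  unfolding std_gaussian_def by (intro sets_PiM_cong) auto

lemma space_std_gaussian: "space (std_gaussian n) = space (Rn n)"
  by (rule sets_eq_imp_space_eq[OF sets_std_gaussian])

lemma all_moments_std_gaussian_component:
  assumes "j < n" shows "all_moments (std_gaussian n) (\<lambda>g. g j)"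
proof (rule all_moments_distr[where f="\<lambda>x. x"])
  show "(\<lambda>g. g j) \<in> std_gaussian n \<rightarrow>\<^sub>M gauss"
    unfolding std_gaussian_def using assms by (intro measurable_component_singleton) auto
  have "distr (std_gaussian n) gauss (\<lambda>g. g j) = gauss"
    unfolding std_gaussian_def using assms
    by (intro distr_PiM_component prob_space_gauss) auto
  thus "all_moments (distr (std_gaussian n) gauss (\<lambda>g. g j)) (\<lambda>x. x)"
    by (simp add: all_moments_gauss)
qed

lemma all_moments_std_gaussian_linear:
  "all_moments (std_gaussian n) (\<lambda>g. \<Sum>l<n. a l * g l)"
  by (intro all_moments_sum all_moments_mult all_moments_const all_moments_std_gaussian_component
            finite_measure_std_gaussian) auto

text \<open>Fubini isolates coordinate m. With the others frozen, each linear form is an affine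
  polynomial in that coordinate, with slope \<open>A j m\<close>, so the product becomes a
  univariate polynomial; the one-dimensional identity and the product rule give the sum over
  k.\<close>

lemma std_gaussian_stein:
  fixes A :: "nat \<Rightarrow> nat \<Rightarrow> real" and P :: "nat \<Rightarrow> real poly"
  assumes m: "m < n" and J: "finite J"
  shows "(\<integral>g. g m * (\<Prod>j\<in>J. poly (P j) (\<Sum>l<n. A j l * g l)) \<partial>std_gaussian n)
       = (\<Sum>k\<in>J. A k m * (\<integral>g. (\<Prod>j\<in>J - {k}. poly (P j) (\<Sum>l<n. A j l * g l))
             * poly (pderiv (P k)) (\<Sum>l<n. A k l * g l) \<partial>std_gaussian n))"
    (is "?lhs = ?rhs")
proof -
  interpret product_prob_space "\<lambda>_::nat. gauss" "{..<n}"
    by (intro product_prob_spaceI prob_space_gauss)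
  define I where "I = {..<n} - {m}"
  have I: "finite I" "m \<notin> I" "insert m I = {..<n}" using m by (auto simp: I_def)
  have std: "std_gaussian n = PiM (insert m I) (\<lambda>_. gauss)" by (simp add: std_gaussian_def I)
  define y where "y = (\<lambda>j (g::nat \<Rightarrow> real). \<Sum>l<n. A j l * g l)"
  define F where "F = (\<lambda>g. g m * (\<Prod>j\<in>J. poly (P j) (y j g)))"
  define G where "G = (\<lambda>k g. (\<Prod>j\<in>J - {k}. poly (P j) (y j g)) * poly (pderiv (P k)) (y k g))"
  have momy: "all_moments (std_gaussian n) (y j)" for j
    unfolding y_def by (rule all_moments_std_gaussian_linear)
  have intF: "integrable (PiM (insert m I) (\<lambda>_. gauss)) F"
    unfolding F_def std[symmetric]
    by (intro all_moments_integrable all_moments_mult all_moments_prod all_moments_poly momy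
          all_moments_std_gaussian_component m finite_measure_std_gaussian)
  have intG: "integrable (std_gaussian n) (G k)" for k
    unfolding G_def
    by (intro all_moments_integrable all_moments_mult all_moments_prod all_moments_poly momy
          finite_measure_std_gaussian)
  have intS: "integrable (PiM (insert m I) (\<lambda>_. gauss)) (\<lambda>g. \<Sum>k\<in>J. A k m * G k g)"
    unfolding std[symmetric] by (intro Bochner_Integration.integrable_sum integrable_mult_right intG)
  have inner: "(\<integral>t. F (g(m := t)) \<partial>gauss) = (\<integral>t. (\<Sum>k\<in>J. A k m * G k (g(m := t))) \<partial>gauss)" for g
  proof -
    define b where "b j = (\<Sum>l\<in>I. A j l * g l)" for j
    have y_upd: "y j (g(m := t)) = poly [:b j, A j m:] t" for j t
    proof -
      have "y j (g(m := t)) = (\<Sum>l\<in>insert m I. A j l * (g(m := t)) l)" by (simp add: y_def I)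
      also have "\<dots> = A j m * t + (\<Sum>l\<in>I. A j l * (g(m := t)) l)" using I(1,2) by simp
      also have "(\<Sum>l\<in>I. A j l * (g(m := t)) l) = b j"
        unfolding b_def using I by (intro sum.cong) auto
      finally show ?thesis by (simp add: mult.commute del: fun_upd_apply)
    qed
    define q where "q = (\<Prod>j\<in>J. pcompose (P j) [:b j, A j m:])"
    have "(\<integral>t. F (g(m := t)) \<partial>gauss) = (\<integral>t. t * poly q t \<partial>gauss)"
      by (simp add: F_def q_def poly_prod poly_pcompose y_upd)
    also have "\<dots> = (\<integral>t. poly (pderiv q) t \<partial>gauss)" by (rule gauss_stein_poly)
    also have "\<dots> = (\<integral>t. (\<Sum>k\<in>J. A k m * G k (g(m := t))) \<partial>gauss)"
      by (simp add: G_def q_def pderiv_prod poly_sum poly_prod poly_pcompose y_upd pderiv_pcompose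
            pderiv_pCons mult_ac)
    finally show ?thesis .
  qed
  have "?lhs = integral\<^sup>L (PiM (insert m I) (\<lambda>_. gauss)) F"
    by (simp add: F_def y_def std)
  also have "\<dots> = (\<integral>g. (\<integral>t. F (g(m := t)) \<partial>gauss) \<partial>PiM I (\<lambda>_. gauss))"
    by (rule product_integral_insert[OF I(1,2) intF])
  also have "\<dots> = (\<integral>g. (\<integral>t. (\<Sum>k\<in>J. A k m * G k (g(m := t))) \<partial>gauss) \<partial>PiM I (\<lambda>_. gauss))"
    by (simp add: inner)
  also have "\<dots> = integral\<^sup>L (PiM (insert m I) (\<lambda>_. gauss)) (\<lambda>g. \<Sum>k\<in>J. A k m * G k g)"
    by (rule product_integral_insert[OF I(1,2) intS, symmetric])
  also have "\<dots> = (\<Sum>k\<in>J. A k m * integral\<^sup>L (std_gaussian n) (G k))"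
    unfolding std[symmetric]
    by (subst Bochner_Integration.integral_sum) (auto intro!: integrable_mult_right intG)
  finally show ?thesis by (simp add: G_def y_def)
qed

section \<open>Hermite moments of a spiked Gaussian vector\<close>

text \<open>For \<open>\<beta> \<ge> 0\<close> this is the \<open>d\<close>-th moment of a centred Gaussian of variance \<open>\<beta>\<close>.\<close>

fun wick :: "real \<Rightarrow> nat \<Rightarrow> real" where
  "wick \<beta> 0 = 1"
| "wick \<beta> (Suc 0) = 0"
| "wick \<beta> (Suc (Suc d)) = \<beta> * real (Suc d) * wick \<beta> d"

text \<open>Induction on the total degree. One factor is lowered by the Hermite recursion, and
  integrating by parts the linear form y_j so released brings in the covariance of y_j with every
  y_k. Only the covariance A A^T enters, so the formula is uniform in the sign of \<beta>.\<close>

lemma spiked_hermite_expectation: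
  fixes A :: "nat \<Rightarrow> nat \<Rightarrow> real"
  assumes A: "\<And>j k. j < n \<Longrightarrow> k < n \<Longrightarrow> (\<Sum>m<n. A j m * A k m) = (if j = k then 1 else 0) + \<beta> * x j * x k"
  shows "(\<integral>g. (\<Prod>j<n. poly (hermite (\<alpha> j)) (\<Sum>l<n. A j l * g l)) \<partial>std_gaussian n)
        = wick \<beta> (\<Sum>j<n. \<alpha> j) * (\<Prod>j<n. x j ^ \<alpha> j)"
proof (induction "\<Sum>j<n. \<alpha> j" arbitrary: \<alpha> rule: less_induct)
  case less
  interpret prob_space "std_gaussian n" by (rule prob_space_std_gaussian)
  define y where "y = (\<lambda>j (g::nat \<Rightarrow> real). \<Sum>l<n. A j l * g l)"
  have momy: "all_moments (std_gaussian n) (y j)" for j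
    unfolding y_def by (rule all_moments_std_gaussian_linear)
  show ?case
  proof (cases "\<forall>j<n. \<alpha> j = 0")
    case True
    thus ?thesis by (simp add: prob_space)
  next
    case False
    then obtain j a where j: "j < n" "\<alpha> j = Suc a" using not0_implies_Suc by blast
    define b where "b = \<alpha>(j := a)"
    define P where "P k = hermite (b k)" for k
    define T where "T k = (\<integral>g. (\<Prod>i\<in>{..<n} - {k}. poly (P i) (y i g)) * poly (pderiv (P k)) (y k g) \<partial>std_gaussian n)" for k
    have sum_\<alpha>: "(\<Sum>i<n. \<alpha> i) = Suc (\<Sum>i<n. b i)"
      using j by (simp add: sum.remove[of "{..<n}" j] b_def)
    have prod_\<alpha>: "(\<Prod>i<n. x i ^ \<alpha> i) = x j * (\<Prod>i<n. x i ^ b i)"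
      using j by (simp add: prod.remove[of "{..<n}" j] b_def)
    have intT: "integrable (std_gaussian n) (\<lambda>g. (\<Prod>i\<in>{..<n} - {k}. poly (P i) (y i g)) * poly (pderiv (P k)) (y k g))" for k
      by (intro all_moments_integrable all_moments_mult all_moments_prod all_moments_poly momy
          finite_measure_std_gaussian)
    have intg: "integrable (std_gaussian n) (\<lambda>g. A j m * (g m * (\<Prod>i<n. poly (P i) (y i g))))" if "m < n" for m
      using that
      by (intro integrable_mult_right all_moments_integrable all_moments_mult all_moments_prod all_moments_poly momy
          finite_measure_std_gaussian all_moments_std_gaussian_component)
    have "(\<Prod>i<n. poly (hermite (\<alpha> i)) (y i g)) = (\<Sum>m<n. A j m * (g m * (\<Prod>i<n. poly (P i) (y i g))))
            - (\<Prod>i\<in>{..<n} - {j}. poly (P i) (y i g)) * poly (pderiv (P j)) (y j g)" for g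
    proof -
      have "(\<Prod>i<n. poly (hermite (\<alpha> i)) (y i g))
          = (y j g * poly (P j) (y j g) - poly (pderiv (P j)) (y j g)) * (\<Prod>i\<in>{..<n} - {j}. poly (P i) (y i g))"
        using j by (simp add: prod.remove[of "{..<n}" j] P_def b_def)
      also have "\<dots> = y j g * (\<Prod>i<n. poly (P i) (y i g)) - (\<Prod>i\<in>{..<n} - {j}. poly (P i) (y i g)) * poly (pderiv (P j)) (y j g)"
        using j by (simp add: prod.remove[of "{..<n}" j] algebra_simps)
      also have "y j g * (\<Prod>i<n. poly (P i) (y i g)) = (\<Sum>m<n. A j m * (g m * (\<Prod>i<n. poly (P i) (y i g))))"
        by (simp add: y_def sum_distrib_right mult_ac)
      finally show ?thesis .
    qed
    hence "(\<integral>g. (\<Prod>i<n. poly (hermite (\<alpha> i)) (y i g)) \<partial>std_gaussian n)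
        = (\<integral>g. (\<Sum>m<n. A j m * (g m * (\<Prod>i<n. poly (P i) (y i g))))
            - (\<Prod>i\<in>{..<n} - {j}. poly (P i) (y i g)) * poly (pderiv (P j)) (y j g) \<partial>std_gaussian n)"
      by (simp only:)
    also have "\<dots> = (\<integral>g. (\<Sum>m<n. A j m * (g m * (\<Prod>i<n. poly (P i) (y i g)))) \<partial>std_gaussian n) - T j"
      unfolding T_def by (intro Bochner_Integration.integral_diff Bochner_Integration.integrable_sum intT intg) auto
    also have "(\<integral>g. (\<Sum>m<n. A j m * (g m * (\<Prod>i<n. poly (P i) (y i g)))) \<partial>std_gaussian n)
        = (\<Sum>m<n. \<integral>g. A j m * (g m * (\<Prod>i<n. poly (P i) (y i g))) \<partial>std_gaussian n)"
      by (intro Bochner_Integration.integral_sum intg) auto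
    also have "\<dots> = (\<Sum>m<n. A j m * (\<Sum>k<n. A k m * T k))"
    proof (intro sum.cong refl)
      fix m assume "m \<in> {..<n}"
      thus "(\<integral>g. A j m * (g m * (\<Prod>i<n. poly (P i) (y i g))) \<partial>std_gaussian n) = A j m * (\<Sum>k<n. A k m * T k)"
        using std_gaussian_stein[of m n "{..<n}" P A] by (simp add: T_def y_def)
    qed
    also have "\<dots> = (\<Sum>k<n. (\<Sum>m<n. A j m * A k m) * T k)"
      by (simp add: sum_distrib_left sum_distrib_right mult_ac) (rule sum.swap)
    \<comment> \<open>The identity part of the covariance produces \<open>T j\<close>, which cancels
      the derivative term subtracted in the recursion. Only the rank-one part survives, and it
      lowers the total degree by two.\<close>
    also have "\<dots> = (\<Sum>k<n. (if j = k then T k else 0) + \<beta> * x j * x k * T k)"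
      using j by (intro sum.cong refl) (simp add: A distrib_right)
    also have "\<dots> = T j + (\<Sum>k<n. \<beta> * x j * x k * T k)"
      using j by (simp add: sum.distrib)
    also have "T j + (\<Sum>k<n. \<beta> * x j * x k * T k) - T j = \<beta> * x j * (\<Sum>k<n. x k * T k)"
      by (simp add: sum_distrib_left mult_ac)
    also have "(\<Sum>k<n. x k * T k) = (\<Sum>k<n. real (b k) * (wick \<beta> ((\<Sum>i<n. b i) - 1) * (\<Prod>i<n. x i ^ b i)))"
    proof (intro sum.cong refl)
      fix k assume k: "k \<in> {..<n}"
      show "x k * T k = real (b k) * (wick \<beta> ((\<Sum>i<n. b i) - 1) * (\<Prod>i<n. x i ^ b i))"
      proof (cases "b k")
        case 0
        thus ?thesis by (simp add: T_def P_def)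
      next
        case (Suc c)
        define b' where "b' = b(k := c)"
        have sb: "(\<Sum>i<n. b i) = Suc (\<Sum>i<n. b' i)"
          using k Suc by (simp add: sum.remove[of "{..<n}" k] b'_def)
        have pb: "(\<Prod>i<n. x i ^ b i) = x k * (\<Prod>i<n. x i ^ b' i)"
          using k Suc by (simp add: prod.remove[of "{..<n}" k] b'_def)
        have "T k = (\<integral>g. real (b k) * (\<Prod>i<n. poly (hermite (b' i)) (y i g)) \<partial>std_gaussian n)"
          unfolding T_def P_def
        proof (intro Bochner_Integration.integral_cong refl)
          fix g :: "nat \<Rightarrow> real"
          have "(\<Prod>i<n. poly (hermite (b' i)) (y i g)) = poly (hermite c) (y k g) * (\<Prod>i\<in>{..<n} - {k}. poly (hermite (b i)) (y i g))"
            using k by (simp add: prod.remove[of "{..<n}" k] b'_def)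
          thus "(\<Prod>i\<in>{..<n} - {k}. poly (hermite (b i)) (y i g)) * poly (pderiv (hermite (b k))) (y k g) = real (b k) * (\<Prod>i<n. poly (hermite (b' i)) (y i g))"
            by (simp add: pderiv_hermite Suc del: hermite.simps)
        qed
        also have "\<dots> = real (b k) * (wick \<beta> (\<Sum>i<n. b' i) * (\<Prod>i<n. x i ^ b' i))"
          using less[of b'] sum_\<alpha> sb by (simp add: y_def)
        finally show ?thesis using sb pb by simp
      qed
    qed
    also have "\<dots> = real (\<Sum>i<n. b i) * wick \<beta> ((\<Sum>i<n. b i) - 1) * (\<Prod>i<n. x i ^ b i)"
      by (simp add: sum_distrib_right sum_distrib_left mult_ac)
    \<comment> \<open>If the degrees in \<open>b\<close> sum to 0, the truncated subtraction is
      harmless: it is multiplied by 0, in agreement with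
      \<open>wick \<beta> (Suc 0) = 0\<close>.\<close>
    also have "\<beta> * x j * \<dots> = wick \<beta> (\<Sum>i<n. \<alpha> i) * (\<Prod>i<n. x i ^ \<alpha> i)"
      unfolding sum_\<alpha> prod_\<alpha> by (cases "\<Sum>i<n. b i") simp_all
    finally show ?thesis by (simp add: y_def)
  qed
qed

section \<open>The square root of a spiked covariance matrix\<close>

text \<open>
  The coefficient is 0 off the domain where the covariance is positive semidefinite, so that the
  resulting linear map is the identity there, as in the null branch of the planted model.
\<close>

definition spike_coef :: "real \<Rightarrow> nat \<Rightarrow> (nat \<Rightarrow> real) \<Rightarrow> real" where
  "spike_coef \<beta> n x = (if \<beta> * sqnorm n x \<ge> -1 then \<beta> / (1 + sqrt (1 + \<beta> * sqnorm n x)) else 0)"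

definition spike_sqrt :: "real \<Rightarrow> nat \<Rightarrow> (nat \<Rightarrow> real) \<Rightarrow> nat \<Rightarrow> nat \<Rightarrow> real" where
  "spike_sqrt \<beta> n x i j = (if i = j then 1 else 0) + spike_coef \<beta> n x * x i * x j"

lemma sqnorm_nonneg: "sqnorm n x \<ge> 0"
  by (simp add: sqnorm_def sum_nonneg)

text \<open>Write s = |x|^2, r = sqrt (1 + \<beta> s) and c for the coefficient. Then c s = r - 1,
  so r is the eigenvalue of I + c x x^T in direction x, and its square is the eigenvalue 1 + \<beta>
  s of the covariance. The form c = \<beta> / (1 + r), rather than (r - 1) / s, also makes sense at
  x = 0.\<close>

lemma spike_coef_sqnorm:
  assumes "\<beta> * sqnorm n x \<ge> -1"
  shows "1 + spike_coef \<beta> n x * sqnorm n x = sqrt (1 + \<beta> * sqnorm n x)"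
    and "2 * spike_coef \<beta> n x + (spike_coef \<beta> n x)\<^sup>2 * sqnorm n x = \<beta>"
proof -
  define r where "r = sqrt (1 + \<beta> * sqnorm n x)"
  define s where "s = sqnorm n x"
  have r: "r \<ge> 0" "r\<^sup>2 = 1 + \<beta> * s" using assms by (auto simp: r_def s_def)
  have c: "spike_coef \<beta> n x = \<beta> / (1 + r)" using assms by (simp add: spike_coef_def r_def)
  have bs: "\<beta> * s = (r - 1) * (1 + r)" using r by (simp add: algebra_simps power2_eq_square)
  have cs: "spike_coef \<beta> n x * s = r - 1"
    using r(1) bs by (simp add: c divide_simps)
  show "1 + spike_coef \<beta> n x * sqnorm n x = sqrt (1 + \<beta> * sqnorm n x)"
    using cs by (simp add: r_def s_def)
  have "2 * spike_coef \<beta> n x + (spike_coef \<beta> n x)\<^sup>2 * s = spike_coef \<beta> n x * (2 + spike_coef \<beta> n x * s)"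
    by (simp add: algebra_simps power2_eq_square)
  also have "\<dots> = spike_coef \<beta> n x * (1 + r)" by (simp only: cs) simp
  also have "\<dots> = \<beta>" using r(1) by (simp add: c)
  finally show "2 * spike_coef \<beta> n x + (spike_coef \<beta> n x)\<^sup>2 * sqnorm n x = \<beta>" by (simp add: s_def)
qed

lemma spike_sqrt_sym: "spike_sqrt \<beta> n x i j = spike_sqrt \<beta> n x j i"
  by (simp add: spike_sqrt_def)

lemma spike_sqrt_apply:
  assumes "i < n"
  shows "(\<Sum>j<n. spike_sqrt \<beta> n x i j * v j) = v i + spike_coef \<beta> n x * x i * (\<Sum>j<n. x j * v j)"
proof -
  have "(\<Sum>j<n. spike_sqrt \<beta> n x i j * v j)
      = (\<Sum>j<n. (if i = j then v j else 0) + spike_coef \<beta> n x * x i * (x j * v j))"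
    by (intro sum.cong) (auto simp: spike_sqrt_def algebra_simps)
  thus ?thesis using assms by (simp add: sum.distrib sum_distrib_left)
qed

lemma spike_sqrt_square:
  assumes "\<beta> * sqnorm n x \<ge> -1" "i < n" "j < n"
  shows "(\<Sum>k<n. spike_sqrt \<beta> n x i k * spike_sqrt \<beta> n x k j) = spiked_cov \<beta> x i j"
proof -
  define c where "c = spike_coef \<beta> n x"
  have "(\<Sum>k<n. x k * spike_sqrt \<beta> n x k j) = (\<Sum>k<n. spike_sqrt \<beta> n x j k * x k)"
    by (simp add: spike_sqrt_sym mult_ac)
  also have "\<dots> = x j + c * x j * sqnorm n x"
    using assms by (subst spike_sqrt_apply) (simp_all add: sqnorm_def power2_eq_square c_def)
  finally have *: "(\<Sum>k<n. x k * spike_sqrt \<beta> n x k j) = x j + c * x j * sqnorm n x" .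
  have "(\<Sum>k<n. spike_sqrt \<beta> n x i k * spike_sqrt \<beta> n x k j)
      = spike_sqrt \<beta> n x i j + c * x i * (x j + c * x j * sqnorm n x)"
    using assms by (subst spike_sqrt_apply) (simp_all add: * c_def)
  also have "\<dots> = (if i = j then 1 else 0) + (2 * c + c\<^sup>2 * sqnorm n x) * x i * x j"
    by (simp add: spike_sqrt_def c_def algebra_simps power2_eq_square)
  also have "2 * c + c\<^sup>2 * sqnorm n x = \<beta>" using spike_coef_sqnorm(2)[OF assms(1)] by (simp add: c_def)
  finally show ?thesis by (simp add: spiked_cov_def)
qed

lemma spike_sqrt_quadratic_form:
  "(\<Sum>i<n. \<Sum>j<n. v i * spike_sqrt \<beta> n x i j * v j)
     = sqnorm n v + spike_coef \<beta> n x * (\<Sum>i<n. x i * v i)\<^sup>2"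
proof -
  have "(\<Sum>i<n. \<Sum>j<n. v i * spike_sqrt \<beta> n x i j * v j) = (\<Sum>i<n. v i * (\<Sum>j<n. spike_sqrt \<beta> n x i j * v j))"
    by (simp add: sum_distrib_left mult_ac)
  also have "\<dots> = (\<Sum>i<n. (v i)\<^sup>2 + spike_coef \<beta> n x * (\<Sum>j<n. x j * v j) * (x i * v i))"
    by (intro sum.cong refl, subst spike_sqrt_apply) (auto simp: algebra_simps power2_eq_square)
  also have "\<dots> = sqnorm n v + spike_coef \<beta> n x * (\<Sum>i<n. x i * v i)\<^sup>2"
    by (simp add: sum.distrib sqnorm_def sum_distrib_left[symmetric] power2_eq_square)
  finally show ?thesis .
qed

text \<open>The eigenvalues of the root are 1 on the complement of x and sqrt (1 + \<beta> |x|^2)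
  along x. For a nonnegative coefficient the extra square only helps; for a negative one
  Cauchy-Schwarz shows that x is the worst direction.\<close>

lemma spike_sqrt_quadratic_form_lower:
  assumes "\<beta> * sqnorm n x \<ge> -1"
  shows "sqnorm n v + spike_coef \<beta> n x * (\<Sum>i<n. x i * v i)\<^sup>2
           \<ge> min 1 (sqrt (1 + \<beta> * sqnorm n x)) * sqnorm n v"
proof (cases "spike_coef \<beta> n x \<ge> 0")
  case True
  have "min 1 (sqrt (1 + \<beta> * sqnorm n x)) * sqnorm n v \<le> 1 * sqnorm n v"
    by (intro mult_right_mono sqnorm_nonneg) auto
  thus ?thesis using True by (smt (verit) mult_nonneg_nonneg zero_le_power2)
next
  case False
  have "(\<Sum>i<n. x i * v i)\<^sup>2 \<le> sqnorm n x * sqnorm n v"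
    unfolding sqnorm_def by (rule Cauchy_Schwarz_ineq_sum)
  hence "spike_coef \<beta> n x * (\<Sum>i<n. x i * v i)\<^sup>2 \<ge> spike_coef \<beta> n x * (sqnorm n x * sqnorm n v)"
    using False by (intro mult_left_mono_neg) auto
  hence "sqnorm n v + spike_coef \<beta> n x * (\<Sum>i<n. x i * v i)\<^sup>2 \<ge> (1 + spike_coef \<beta> n x * sqnorm n x) * sqnorm n v"
    by (simp add: algebra_simps)
  also have "(1 + spike_coef \<beta> n x * sqnorm n x) = sqrt (1 + \<beta> * sqnorm n x)"
    by (rule spike_coef_sqnorm(1)[OF assms])
  finally have "sqrt (1 + \<beta> * sqnorm n x) * sqnorm n v \<le> sqnorm n v + spike_coef \<beta> n x * (\<Sum>i<n. x i * v i)\<^sup>2" .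
  moreover have "min 1 (sqrt (1 + \<beta> * sqnorm n x)) * sqnorm n v \<le> sqrt (1 + \<beta> * sqnorm n x) * sqnorm n v"
    by (intro mult_right_mono sqnorm_nonneg) auto
  ultimately show ?thesis by linarith
qed

lemma is_psd_sqrt_spike_sqrt:
  assumes "\<beta> * sqnorm n x \<ge> -1"
  shows "is_psd_sqrt n (spiked_cov \<beta> x) (spike_sqrt \<beta> n x)"
proof -
  have "0 \<le> min 1 (sqrt (1 + \<beta> * sqnorm n x)) * sqnorm n v" for v
    using assms by (simp add: sqnorm_nonneg)
  hence "0 \<le> sqnorm n v + spike_coef \<beta> n x * (\<Sum>i<n. x i * v i)\<^sup>2" for v
    using spike_sqrt_quadratic_form_lower[OF assms, of v] order_trans by blast
  thus ?thesis unfolding is_psd_sqrt_def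
    using spike_sqrt_square[OF assms] spike_sqrt_sym
    by (auto simp: spike_sqrt_quadratic_form)
qed

text \<open>Uniqueness of the positive semidefinite root for this covariance, without the spectral
  theorem. A root A commutes with A^2, hence with the rank-one part and with the explicit root B.
  Therefore (A + B)(A - B) = 0, and positivity of both roots forces w^T B w = 0 for every column w
  of A - B. This finishes the argument unless B is singular.\<close>

lemma psd_sqrt_spiked_cov:
  assumes good: "\<beta> * sqnorm n x \<ge> -1" and "i < n" "j < n"
  shows "psd_sqrt n (spiked_cov \<beta> x) i j = spike_sqrt \<beta> n x i j"
proof -
  define A where "A = psd_sqrt n (spiked_cov \<beta> x)"
  define B where "B = spike_sqrt \<beta> n x"
  define c where "c = spike_coef \<beta> n x"
  have "is_psd_sqrt n (spiked_cov \<beta> x) A"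
    unfolding A_def psd_sqrt_def using is_psd_sqrt_spike_sqrt[OF good] by (rule someI[of "is_psd_sqrt n (spiked_cov \<beta> x)"])
  hence Asym: "A i j = A j i"
    and Apos: "(\<Sum>i<n. \<Sum>j<n. v i * A i j * v j) \<ge> 0"
    and Asq: "(\<Sum>k<n. A i k * A k j) = spiked_cov \<beta> x i j" if "i < n" "j < n" for i j v
    using that unfolding is_psd_sqrt_def by blast+
  have Bpos: "(\<Sum>i<n. \<Sum>j<n. v i * B i j * v j) \<ge> 0" for v
    using is_psd_sqrt_spike_sqrt[OF good] unfolding is_psd_sqrt_def B_def by blast
  have Bsq: "(\<Sum>k<n. B i k * B k j) = spiked_cov \<beta> x i j" if "i < n" "j < n" for i j
    using spike_sqrt_square[OF good that] by (simp add: B_def)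
  define u where "u i = (\<Sum>k<n. A i k * x k)" for i
  \<comment> \<open>\<open>A\<close> commutes with its square, hence with \<open>x x\<^sup>T\<close> unless \<open>\<beta> = 0\<close>\<close>
  have comm: "\<beta> * (u i * x j) = \<beta> * (x i * u j)" if "i < n" "j < n" for i j
  proof -
    have "(\<Sum>k<n. A i k * spiked_cov \<beta> x k j) = (\<Sum>k<n. (if k = j then A i k else 0) + \<beta> * x j * (A i k * x k))"
      by (intro sum.cong) (auto simp: spiked_cov_def algebra_simps)
    hence 1: "(\<Sum>k<n. A i k * spiked_cov \<beta> x k j) = A i j + \<beta> * x j * u i"
      using that by (simp add: sum.distrib u_def sum_distrib_left)
    have "(\<Sum>k<n. spiked_cov \<beta> x i k * A k j) = (\<Sum>k<n. (if i = k then A k j else 0) + \<beta> * x i * (A j k * x k))"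
      using that by (intro sum.cong) (auto simp: spiked_cov_def algebra_simps Asym)
    hence 2: "(\<Sum>k<n. spiked_cov \<beta> x i k * A k j) = A i j + \<beta> * x i * u j"
      using that by (simp add: sum.distrib u_def sum_distrib_left)
    have "(\<Sum>k<n. A i k * spiked_cov \<beta> x k j) = (\<Sum>k<n. A i k * (\<Sum>l<n. A k l * A l j))"
      using that by (intro sum.cong) (auto simp: Asq)
    also have "\<dots> = (\<Sum>l<n. (\<Sum>k<n. A i k * A k l) * A l j)"
      by (simp add: sum_distrib_left sum_distrib_right mult.assoc) (rule sum.swap)
    also have "\<dots> = (\<Sum>k<n. spiked_cov \<beta> x i k * A k j)"
      using that by (intro sum.cong) (auto simp: Asq)
    finally show ?thesis using 1 2 by (simp add: mult_ac)
  qed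
  have commc: "c * (u i * x j) = c * (x i * u j)" if "i < n" "j < n" for i j
    using comm[OF that] by (cases "\<beta> = 0") (auto simp: c_def spike_coef_def)
  \<comment> \<open>Column j of A - B. The next claim is (A + B)(A - B) = A^2 - B^2 + BA - AB = 0
    read in this column.\<close>
  define w where "w i = A i j - B i j" for i
  have "(\<Sum>k<n. A i k * w k) + (\<Sum>k<n. B i k * w k) = 0" if i: "i < n" for i
  proof -
    have "(\<Sum>k<n. A i k * B k j) = (\<Sum>k<n. B j k * A i k)"
      by (simp add: B_def spike_sqrt_sym mult_ac)
    also have "\<dots> = A i j + c * x j * u i"
      unfolding B_def using assms by (subst spike_sqrt_apply) (simp_all add: u_def c_def mult_ac)
    finally have AB: "(\<Sum>k<n. A i k * B k j) = A i j + c * x j * u i" .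
    have "(\<Sum>k<n. x k * A k j) = u j"
      unfolding u_def using assms by (intro sum.cong) (auto simp: Asym mult_ac)
    hence BA: "(\<Sum>k<n. B i k * A k j) = A i j + c * x i * u j"
      unfolding B_def using i by (subst spike_sqrt_apply) (simp_all add: c_def)
    have "(\<Sum>k<n. A i k * w k) + (\<Sum>k<n. B i k * w k)
        = ((\<Sum>k<n. A i k * A k j) - (\<Sum>k<n. B i k * B k j)) + ((\<Sum>k<n. B i k * A k j) - (\<Sum>k<n. A i k * B k j))"
      by (simp add: w_def sum_subtractf algebra_simps)
    also have "\<dots> = 0"
      unfolding AB BA Asq[OF i \<open>j < n\<close>] Bsq[OF i \<open>j < n\<close>] using commc[OF i \<open>j < n\<close>] by algebra
    finally show ?thesis .
  qed
  hence "(\<Sum>i<n. w i * ((\<Sum>k<n. A i k * w k) + (\<Sum>k<n. B i k * w k))) = 0" by simp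
  hence "(\<Sum>i<n. \<Sum>k<n. w i * A i k * w k) + (\<Sum>i<n. \<Sum>k<n. w i * B i k * w k) = 0"
    by (simp add: distrib_left sum.distrib sum_distrib_left mult_ac)
  hence "(\<Sum>i<n. \<Sum>k<n. w i * B i k * w k) = 0"
    using Apos[OF assms(2,3), of w] Bpos[of w] by linarith
  hence w0: "sqnorm n w + c * (\<Sum>i<n. x i * w i)\<^sup>2 = 0"
    by (simp add: B_def spike_sqrt_quadratic_form c_def)
  have "sqnorm n w = 0"
  proof (cases "1 + \<beta> * sqnorm n x = 0")
    case False
    hence pos: "min 1 (sqrt (1 + \<beta> * sqnorm n x)) > 0" using good by simp
    have "min 1 (sqrt (1 + \<beta> * sqnorm n x)) * sqnorm n w \<le> 0"
      using spike_sqrt_quadratic_form_lower[OF good, of w] w0 by (simp add: c_def)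
    thus ?thesis using pos sqnorm_nonneg[of n w] by (simp add: mult_le_0_iff)
  next
    case True
    \<comment> \<open>Here B is singular with x in its kernel. The vector u = A x has squared norm
      x^T A^2 x = |x|^2 (1 + \<beta> |x|^2) = 0, so A x = B x = 0 and w is orthogonal to x; then the
      quadratic form of B at w is just |w|^2.\<close>
    have "u j * u j \<le> (\<Sum>i<n. u i * u i)"
      using \<open>j < n\<close> by (intro member_le_sum) auto
    also have "(\<Sum>i<n. u i * u i) = (\<Sum>i<n. \<Sum>k<n. \<Sum>l<n. x k * (A k i * A i l) * x l)"
      unfolding u_def sum_product by (intro sum.cong refl) (simp add: Asym mult_ac)
    also have "\<dots> = (\<Sum>k<n. \<Sum>i<n. \<Sum>l<n. x k * (A k i * A i l) * x l)"
      by (rule sum.swap)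
    also have "\<dots> = (\<Sum>k<n. \<Sum>l<n. \<Sum>i<n. x k * (A k i * A i l) * x l)"
      by (intro sum.cong refl sum.swap)
    also have "\<dots> = (\<Sum>k<n. \<Sum>l<n. x k * (\<Sum>i<n. A k i * A i l) * x l)"
      by (simp add: sum_distrib_left sum_distrib_right)
    also have "\<dots> = (\<Sum>k<n. \<Sum>l<n. (if k = l then x k * x l else 0) + \<beta> * ((x k)\<^sup>2 * (x l)\<^sup>2))"
      by (intro sum.cong refl) (auto simp: Asq spiked_cov_def algebra_simps power2_eq_square)
    also have "\<dots> = sqnorm n x + \<beta> * (sqnorm n x * sqnorm n x)"
      unfolding sqnorm_def sum_product
      by (simp add: sum.distrib power2_eq_square sum_distrib_left[symmetric])
    also have "\<dots> = sqnorm n x * (1 + \<beta> * sqnorm n x)" by (simp add: algebra_simps)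
    finally have "u j * u j \<le> 0" using True by simp
    hence "u j = 0" by (metis linorder_not_le mult_eq_0_iff not_real_square_gt_zero)
    have "(\<Sum>i<n. x i * w i) = (\<Sum>i<n. A j i * x i) - (\<Sum>i<n. B j i * x i)"
      unfolding w_def sum_subtractf[symmetric] using \<open>j < n\<close>
      by (intro sum.cong refl) (simp add: Asym[of _ j] B_def spike_sqrt_sym[of _ _ _ j] algebra_simps)
    also have "(\<Sum>i<n. B j i * x i) = x j * (1 + c * sqnorm n x)"
      unfolding B_def using \<open>j < n\<close>
      by (subst spike_sqrt_apply) (simp_all add: c_def sqnorm_def power2_eq_square algebra_simps)
    also have "1 + c * sqnorm n x = 0"
      using spike_coef_sqnorm(1)[OF good] True by (simp add: c_def)
    finally have "(\<Sum>i<n. x i * w i) = 0" using \<open>u j = 0\<close> by (simp add: u_def)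
    thus ?thesis using w0 by simp
  qed
  hence "w i = 0" using \<open>i < n\<close> by (simp add: sqnorm_def sum_nonneg_eq_0_iff)
  thus ?thesis by (simp add: w_def A_def B_def)
qed

section \<open>Absolute continuity of spiked Gaussian vectors\<close>

text \<open>For measurable T this says that the image of M under T is absolutely continuous with
  respect to M. As a property of maps it is stable under composition, so a linear map can be treated
  by factoring it into maps that change one coordinate, with no determinant or change-of-variables
  formula.\<close>

definition nonsingular :: "'a measure \<Rightarrow> ('a \<Rightarrow> 'a) \<Rightarrow> bool" where
  "nonsingular M T \<longleftrightarrow> T \<in> M \<rightarrow>\<^sub>M M \<and> (\<forall>A\<in>null_sets M. T -` A \<inter> space M \<in> null_sets M)"

lemma nonsingular_comp:
  assumes "nonsingular M S" "nonsingular M T"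
  shows "nonsingular M (\<lambda>x. S (T x))"
  unfolding nonsingular_def
proof (intro conjI ballI)
  have [measurable]: "S \<in> M \<rightarrow>\<^sub>M M" "T \<in> M \<rightarrow>\<^sub>M M" using assms by (auto simp: nonsingular_def)
  show "(\<lambda>x. S (T x)) \<in> M \<rightarrow>\<^sub>M M" by measurable
  fix A assume "A \<in> null_sets M"
  hence "T -` (S -` A \<inter> space M) \<inter> space M \<in> null_sets M"
    using assms unfolding nonsingular_def by blast
  also have "T -` (S -` A \<inter> space M) \<inter> space M = (\<lambda>x. S (T x)) -` A \<inter> space M"
    using measurable_space[OF \<open>T \<in> M \<rightarrow>\<^sub>M M\<close>] by auto
  finally show "(\<lambda>x. S (T x)) -` A \<inter> space M \<in> null_sets M" .
qed

lemma nonsingular_cong: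
  assumes "\<And>x. x \<in> space M \<Longrightarrow> S x = T x" "nonsingular M S"
  shows "nonsingular M T"
proof -
  have "T \<in> M \<rightarrow>\<^sub>M M" using assms measurable_cong[of M S T M] by (auto simp: nonsingular_def)
  moreover have "T -` A \<inter> space M = S -` A \<inter> space M" for A using assms(1) by auto
  ultimately show ?thesis using assms(2) by (auto simp: nonsingular_def)
qed

lemma nonsingular_id: "nonsingular M (\<lambda>x. x)"
  by (auto simp: nonsingular_def dest: null_sets.Int[of _ _ "space M"] intro: null_set_Int1)

lemma nonsingular_imp_absolutely_continuous:
  assumes "nonsingular M T" shows "absolutely_continuous M (distr M M T)"
  using assms by (auto simp: absolutely_continuous_def nonsingular_def null_sets_distr_iff)

lemma AE_gauss_iff: "(AE t in gauss. P t) \<longleftrightarrow> (AE t in lborel. P t)"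
  by (subst AE_density) (auto simp: normal_density_pos)

lemma (in product_sigma_finite) null_PiM_insert_iff:
  assumes I: "finite I" "i \<notin> I" and A[measurable]: "A \<in> sets (PiM (insert i I) M)"
  shows "emeasure (PiM (insert i I) M) A = 0 \<longleftrightarrow> (AE g in PiM I M. AE t in M i. g(i := t) \<notin> A)"
proof -
  have m: "(\<lambda>(g, t). indicator A (g(i := t)) :: ennreal) \<in> borel_measurable (PiM I M \<Otimes>\<^sub>M M i)"
    using measurable_compose[OF measurable_add_dim borel_measurable_indicator[OF A]]
    by (simp add: case_prod_unfold)
  have "emeasure (PiM (insert i I) M) A = (\<integral>\<^sup>+g. indicator A g \<partial>PiM (insert i I) M)" by simp
  also have "\<dots> = (\<integral>\<^sup>+g. \<integral>\<^sup>+t. indicator A (g(i := t)) \<partial>M i \<partial>PiM I M)"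
    using I by (intro product_nn_integral_insert) auto
  also have "\<dots> = 0 \<longleftrightarrow> (AE g in PiM I M. (\<integral>\<^sup>+t. indicator A (g(i := t)) \<partial>M i) = 0)"
    using borel_measurable_nn_integral[OF m] by (rule nn_integral_0_iff_AE)
  also have "\<dots> \<longleftrightarrow> (AE g in PiM I M. AE t in M i. g(i := t) \<notin> A)"
  proof (rule AE_cong)
    fix g assume g: "g \<in> space (PiM I M)"
    have "(\<lambda>t. indicator A (g(i := t)) :: ennreal) \<in> borel_measurable (M i)"
      using measurable_compose[OF measurable_Pair1'[OF g] m] by simp
    hence "(\<integral>\<^sup>+t. indicator A (g(i := t)) \<partial>M i) = 0 \<longleftrightarrow> (AE t in M i. indicator A (g(i := t)) = (0::ennreal))"
      by (rule nn_integral_0_iff_AE)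
    thus "(\<integral>\<^sup>+t. indicator A (g(i := t)) \<partial>M i) = 0 \<longleftrightarrow> (AE t in M i. g(i := t) \<notin> A)"
      by (simp add: indicator_eq_0_iff)
  qed
  finally show ?thesis .
qed

text \<open>A null set of the product is described by an iterated almost-everywhere statement. Such
  a statement passes to the second family one factor at a time: in the inner variable by hypothesis,
  in the outer ones by induction.\<close>

lemma absolutely_continuous_PiM:
  assumes M: "\<And>i. prob_space (M i)" and M': "\<And>i. prob_space (M' i)"
    and sets: "\<And>i. sets (M' i) = sets (M i)"
    and ac: "\<And>i. absolutely_continuous (M i) (M' i)" and "finite I"
  shows "absolutely_continuous (PiM I M) (PiM I M')"
  using \<open>finite I\<close>
proof (induction I rule: finite_induct)
  case empty
  thus ?case by (simp add: absolutely_continuous_def PiM_empty)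
next
  case (insert i I)
  interpret M: product_sigma_finite M
    by (simp add: product_sigma_finite_def M prob_space_imp_sigma_finite)
  interpret M': product_sigma_finite M'
    by (simp add: product_sigma_finite_def M' prob_space_imp_sigma_finite)
  have sets_PiM: "sets (PiM J M') = sets (PiM J M)" for J by (intro sets_PiM_cong sets refl)
  show ?case unfolding absolutely_continuous_def
  proof
    fix A assume A: "A \<in> null_sets (PiM (insert i I) M)"
    hence "AE g in PiM I M. AE t in M i. g(i := t) \<notin> A"
      using insert M.null_PiM_insert_iff[of I i A] by auto
    hence "AE g in PiM I M. AE t in M' i. g(i := t) \<notin> A"
      by eventually_elim (rule absolutely_continuous_AE[OF sets ac])
    hence "AE g in PiM I M'. AE t in M' i. g(i := t) \<notin> A"
      by (rule absolutely_continuous_AE[OF sets_PiM insert.IH])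
    moreover have A': "A \<in> sets (PiM (insert i I) M')" using A by (auto simp: sets_PiM)
    ultimately have "emeasure (PiM (insert i I) M') A = 0"
      using M'.null_PiM_insert_iff[OF insert.hyps A'] by blast
    thus "A \<in> null_sets (PiM (insert i I) M')" using A' by (rule null_setsI)
  qed
qed

text \<open>Since f ignores coordinate j, fixing the other coordinates leaves an affine bijection of
  the line, which preserves Lebesgue null sets; these are the Gaussian null sets because the density
  is positive. Fubini for null sets assembles the slices.\<close>

lemma nonsingular_coordinate_affine:
  assumes j: "j < n" and c: "c \<noteq> 0" and f[measurable]: "f \<in> borel_measurable (Rn n)"
    and f_upd: "\<And>g t. f (g(j := t)) = f g"
  shows "nonsingular (std_gaussian n) (\<lambda>g. g(j := f g + c * g j))"
proof -
  interpret product_prob_space "\<lambda>_::nat. gauss" "{..<n}"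
    by (intro product_prob_spaceI prob_space_gauss)
  define I where "I = {..<n} - {j}"
  have I: "finite I" "j \<notin> I" "insert j I = {..<n}" using j by (auto simp: I_def)
  have std: "std_gaussian n = PiM (insert j I) (\<lambda>_. gauss)" by (simp add: std_gaussian_def I)
  define T where "T g = g(j := f g + c * g j)" for g
  have "T \<in> Rn n \<rightarrow>\<^sub>M Rn n"
  proof (rule measurable_PiM_single')
    fix i assume i: "i \<in> {..<n}"
    hence [measurable]: "(\<lambda>g. g i) \<in> borel_measurable (Rn n)" by measurable
    show "(\<lambda>g. T g i) \<in> borel_measurable (Rn n)"
      using i by (cases "i = j") (simp_all add: T_def)
  next
    show "T \<in> space (Rn n) \<rightarrow> ({..<n} \<rightarrow>\<^sub>E space borel)"
      using j by (auto simp: T_def space_PiM PiE_def extensional_def)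
  qed
  hence T[measurable]: "T \<in> std_gaussian n \<rightarrow>\<^sub>M std_gaussian n"
    by (simp add: measurable_cong_sets[OF sets_std_gaussian sets_std_gaussian])
  have "T -` A \<inter> space (std_gaussian n) \<in> null_sets (std_gaussian n)" if A: "A \<in> null_sets (std_gaussian n)" for A
  proof -
    have [measurable]: "A \<in> sets (std_gaussian n)" using A by auto
    have "AE g in PiM I (\<lambda>_. gauss). AE t in gauss. g(j := t) \<notin> A"
      using A null_PiM_insert_iff[OF I(1,2), of A] by (auto simp: std)
    with AE_space have "AE g in PiM I (\<lambda>_. gauss). AE t in gauss. g(j := t) \<notin> T -` A \<inter> space (std_gaussian n)"
    proof eventually_elim
      case (elim g)
      have upd: "(\<lambda>t. g(j := t)) \<in> gauss \<rightarrow>\<^sub>M PiM (insert j I) (\<lambda>_. gauss)"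
        using measurable_compose[OF measurable_Pair1'[OF elim(1)] measurable_add_dim[of j I "\<lambda>_. gauss"]] by simp
      have "{t\<in>space gauss. g(j := t) \<in> A} \<in> sets gauss"
        using measurable_sets[OF upd, of A] A by (auto simp: std vimage_def Int_def conj_commute)
      hence "{t. g(j := t) \<notin> A} \<in> sets borel"
        using sets.compl_sets by (fastforce simp: Compl_eq_Diff_UNIV set_diff_eq)
      hence "Measurable.pred borel (\<lambda>t. g(j := t) \<notin> A)" by (simp add: pred_def)
      from AE_borel_affine[OF c this, of "f g"]
      have "AE t in gauss. g(j := f g + c * t) \<notin> A" using elim(2) by (simp add: AE_gauss_iff)
      thus ?case by eventually_elim (auto simp: T_def f_upd)
    qed
    moreover have TA: "T -` A \<inter> space (std_gaussian n) \<in> sets (std_gaussian n)" by measurable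
    ultimately have "emeasure (std_gaussian n) (T -` A \<inter> space (std_gaussian n)) = 0"
      using null_PiM_insert_iff[OF I(1,2), of "T -` A \<inter> space (std_gaussian n)"]
      unfolding std by blast
    thus ?thesis using TA by (rule null_setsI)
  qed
  hence "nonsingular (std_gaussian n) T" using T by (auto simp: nonsingular_def)
  thus ?thesis by (simp add: T_def[abs_def])
qed

definition shear :: "(nat \<Rightarrow> real) \<Rightarrow> nat \<Rightarrow> nat set \<Rightarrow> (nat \<Rightarrow> real) \<Rightarrow> nat \<Rightarrow> real" where
  "shear a j J g = (\<lambda>i. if i \<in> J then g i + a i * g j else g i)"

lemma nonsingular_shear:
  assumes "j < n" "finite J" "J \<subseteq> {..<n} - {j}"
  shows "nonsingular (std_gaussian n) (shear a j J)"
  using assms(2,3)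
proof (induction J rule: finite_induct)
  case empty
  thus ?case using nonsingular_id by (simp add: shear_def)
next
  case (insert k J)
  have "nonsingular (std_gaussian n) (\<lambda>g. g(k := a k * g j + 1 * g k))"
    using insert.prems assms(1)
    by (intro nonsingular_coordinate_affine) auto
  from nonsingular_comp[OF this insert.IH] 
  have "nonsingular (std_gaussian n) (\<lambda>g. (shear a j J g)(k := a k * shear a j J g j + 1 * shear a j J g k))"
    using insert.prems by auto
  also have "(\<lambda>g. (shear a j J g)(k := a k * shear a j J g j + 1 * shear a j J g k)) = shear a j (insert k J)"
    using insert.hyps insert.prems by (auto simp: shear_def fun_eq_iff)
  finally show ?case .
qed

definition spike_map :: "real \<Rightarrow> nat \<Rightarrow> (nat \<Rightarrow> real) \<Rightarrow> (nat \<Rightarrow> real) \<Rightarrow> nat \<Rightarrow> real" where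
  "spike_map \<beta> n x g = (\<lambda>i\<in>{..<n}. g i + spike_coef \<beta> n x * x i * (\<Sum>j<n. x j * g j))"

text \<open>
  In the coordinates obtained by a shear that maps \<open>x\<close> to a multiple of the \<open>j\<close>-th unit
  vector, the map only changes the \<open>j\<close>-th coordinate.
\<close>

lemma nonsingular_spike_map:
  assumes "\<beta> * sqnorm n x > -1"
  shows "nonsingular (std_gaussian n) (spike_map \<beta> n x)"
proof (cases "\<forall>j<n. x j = 0")
  case True
  show ?thesis
  proof (rule nonsingular_cong[OF _ nonsingular_id])
    fix g assume "g \<in> space (std_gaussian n)"
    thus "g = spike_map \<beta> n x g"
      using True by (auto simp: spike_map_def space_std_gaussian space_PiM PiE_def extensional_def fun_eq_iff)
  qed
next
  case False
  then obtain j where j: "j < n" "x j \<noteq> 0" by blast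
  define J where "J = {..<n} - {j}"
  have J: "finite J" "J \<subseteq> {..<n} - {j}" "{..<n} = insert j J" "j \<notin> J" using j by (auto simp: J_def)
  define c where "c = spike_coef \<beta> n x"
  define a where "a i = x i / x j" for i
  define f where "f u = c * x j * (\<Sum>i\<in>J. x i * u i)" for u :: "nat \<Rightarrow> real"
  \<comment> \<open>The strict inequality in the hypothesis matters: at \<beta> |x|^2 = -1 this
    factor is 0 and the map collapses the space onto a hyperplane.\<close>
  have nz: "1 + c * sqnorm n x \<noteq> 0"
    using spike_coef_sqnorm(1)[of \<beta> n x] assms by (simp add: c_def)
  have "nonsingular (std_gaussian n) (\<lambda>u. u(j := f u + (1 + c * sqnorm n x) * u j))"
  proof (rule nonsingular_coordinate_affine[OF j(1) nz])
    have "(\<lambda>u. u i) \<in> borel_measurable (Rn n)" if "i \<in> J" for i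
      using that J(3) by (intro measurable_component_singleton) auto
    thus "f \<in> borel_measurable (Rn n)"
      unfolding f_def by (intro borel_measurable_times borel_measurable_sum) auto
    show "f (g(j := t)) = f g" for g t
    proof -
      have "(\<Sum>i\<in>J. x i * (g(j := t)) i) = (\<Sum>i\<in>J. x i * g i)" using J by (intro sum.cong) auto
      thus ?thesis by (simp add: f_def)
    qed
  qed
  from nonsingular_comp[OF nonsingular_shear[OF j(1) J(1,2), of a] nonsingular_comp[OF this nonsingular_shear[OF j(1) J(1,2), of "\<lambda>i. - a i"]]]
  show ?thesis
  proof (rule nonsingular_cong[rotated])
    fix g assume g: "g \<in> space (std_gaussian n)"
    let ?u = "shear (\<lambda>i. - a i) j J g"
    have "(\<Sum>i<n. x i * g i) = x j * g j + (\<Sum>i\<in>J. x i * g i)" using J by simp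
    also have "(\<Sum>i\<in>J. x i * g i) = (\<Sum>i\<in>J. x i * ?u i + (x i)\<^sup>2 * (g j / x j))"
      using j(2) by (intro sum.cong refl) (simp add: shear_def a_def field_simps power2_eq_square)
    also have "x j * g j + \<dots> = (\<Sum>i\<in>J. x i * ?u i) + ((x j)\<^sup>2 + (\<Sum>i\<in>J. (x i)\<^sup>2)) * (g j / x j)"
    proof -
      have "x j * g j = (x j)\<^sup>2 * (g j / x j)" using j(2) by (simp add: power2_eq_square)
      thus ?thesis by (simp only: sum.distrib sum_distrib_right[symmetric] distrib_right)
    qed
    also have "(x j)\<^sup>2 + (\<Sum>i\<in>J. (x i)\<^sup>2) = sqnorm n x" using J by (simp add: sqnorm_def)
    finally have dot: "(\<Sum>i<n. x i * g i) = (\<Sum>i\<in>J. x i * ?u i) + sqnorm n x * (g j / x j)" .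
    have uj: "?u j = g j" using J by (simp add: shear_def)
    \<comment> \<open>In the sheared coordinates the new j-th entry is affine in g_j with slope 1 +
      c |x|^2. Shearing back adds x_i / x_j times it to entry i, which restores g_i and contributes
      exactly c x_i (x . g).\<close>
    have new: "f ?u + (1 + c * sqnorm n x) * ?u j = g j + c * x j * (\<Sum>i<n. x i * g i)"
      unfolding dot uj f_def using j(2) by (simp add: field_simps)
    show "shear a j J (?u(j := f ?u + (1 + c * sqnorm n x) * ?u j)) = spike_map \<beta> n x g"
    proof
      fix i
      show "shear a j J (?u(j := f ?u + (1 + c * sqnorm n x) * ?u j)) i = spike_map \<beta> n x g i"
      proof (cases "i < n")
        case True
        show ?thesis
        proof (cases "i = j")
          case True
          thus ?thesis using J j by (simp add: new) (simp add: shear_def spike_map_def c_def)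
        next
          case False
          hence "i \<in> J" using \<open>i < n\<close> J by auto
          thus ?thesis using False \<open>i < n\<close> j
            by (simp add: new) (simp add: shear_def spike_map_def c_def a_def field_simps)
        qed
      next
        case False
        hence "i \<notin> J" "i \<noteq> j" using j J by auto
        thus ?thesis using False g
          by (simp add: shear_def spike_map_def space_std_gaussian space_PiM PiE_def extensional_def)
      qed
    qed
  qed
qed

section \<open>The planted distribution as an image measure\<close>

definition planted_map ::
  "real \<Rightarrow> nat \<Rightarrow> nat \<Rightarrow> (nat \<Rightarrow> real) \<Rightarrow> (nat \<Rightarrow> nat \<Rightarrow> real) \<Rightarrow> nat \<Rightarrow> nat \<Rightarrow> real" where
  "planted_map \<beta> N n x = compose {..<N} (spike_map \<beta> n x)"

lemma sets_wishart_null [measurable_cong]: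
  "sets (wishart_null \<gamma> n) = sets (PiM {..<num_samples \<gamma> n} (\<lambda>_. Rn n))"
  unfolding wishart_null_def by (intro sets_PiM_cong sets_std_gaussian refl)

lemma prob_space_wishart_null: "prob_space (wishart_null \<gamma> n)"
  unfolding wishart_null_def by (intro prob_space_PiM prob_space_std_gaussian)

lemma finite_measure_wishart_null: "finite_measure (wishart_null \<gamma> n)"
  using prob_space_wishart_null by (simp add: prob_space_def)

lemma measurable_Rn_component: "j < n \<Longrightarrow> (\<lambda>x. x j) \<in> borel_measurable (Rn n)"
  by (intro measurable_component_singleton) auto

lemma measurable_sqnorm [measurable]: "sqnorm n \<in> borel_measurable (Rn n)"
proof -
  have "(\<lambda>x. \<Sum>i<n. (x i)\<^sup>2) \<in> borel_measurable (Rn n)"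
    by (intro borel_measurable_sum borel_measurable_power measurable_Rn_component) auto
  thus ?thesis by (simp add: sqnorm_def[abs_def])
qed

lemma measurable_spike_coef [measurable]: "spike_coef \<beta> n \<in> borel_measurable (Rn n)"
  unfolding spike_coef_def[abs_def] by measurable

lemma measurable_spike_map_pair:
  assumes x: "x \<in> M \<rightarrow>\<^sub>M Rn n" and g: "g \<in> M \<rightarrow>\<^sub>M Rn n"
  shows "(\<lambda>z. spike_map \<beta> n (x z) (g z)) \<in> M \<rightarrow>\<^sub>M Rn n"
  unfolding spike_map_def
proof (rule measurable_restrict)
  fix i assume i: "i \<in> {..<n}"
  have [measurable]: "(\<lambda>z. x z j) \<in> borel_measurable M" "(\<lambda>z. g z j) \<in> borel_measurable M" if "j \<in> {..<n}" for j
    using measurable_compose[OF x measurable_Rn_component[of j]]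
      measurable_compose[OF g measurable_Rn_component[of j]] that by auto
  note x[measurable]
  have "(\<lambda>z. \<Sum>j<n. x z j * g z j) \<in> borel_measurable M"
    by (intro borel_measurable_sum borel_measurable_times) measurable
  thus "(\<lambda>z. g z i + spike_coef \<beta> n (x z) * x z i * (\<Sum>j<n. x z j * g z j)) \<in> borel_measurable M"
    using i by (intro borel_measurable_add borel_measurable_times) measurable
qed

lemma measurable_spike_map: "x \<in> space (Rn n) \<Longrightarrow> spike_map \<beta> n x \<in> std_gaussian n \<rightarrow>\<^sub>M std_gaussian n"
  using measurable_spike_map_pair[of "\<lambda>_. x" "std_gaussian n" n "\<lambda>g. g" \<beta>]
  by (simp add: measurable_cong_sets[OF sets_std_gaussian sets_std_gaussian])

lemma measurable_planted_map_pair: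
  assumes "sets X = sets (Rn n)"
  shows "(\<lambda>(x, y). planted_map \<beta> (num_samples \<gamma> n) n x y) \<in> X \<Otimes>\<^sub>M wishart_null \<gamma> n \<rightarrow>\<^sub>M wishart_null \<gamma> n"
proof -
  have [measurable_cong]: "sets X = sets (Rn n)" by fact
  have "(\<lambda>(x, y). \<lambda>i\<in>{..<num_samples \<gamma> n}. spike_map \<beta> n x (y i)) \<in> X \<Otimes>\<^sub>M wishart_null \<gamma> n \<rightarrow>\<^sub>M PiM {..<num_samples \<gamma> n} (\<lambda>_. Rn n)"
    unfolding case_prod_unfold
  proof (rule measurable_restrict, rule measurable_spike_map_pair)
    fix i assume i: "i \<in> {..<num_samples \<gamma> n}"
    show "(\<lambda>z. fst z) \<in> X \<Otimes>\<^sub>M wishart_null \<gamma> n \<rightarrow>\<^sub>M Rn n" by measurable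
    have "(\<lambda>y. y i) \<in> wishart_null \<gamma> n \<rightarrow>\<^sub>M Rn n"
      using measurable_component_singleton[OF i, of "\<lambda>_. Rn n"] by measurable
    thus "(\<lambda>z. snd z i) \<in> X \<Otimes>\<^sub>M wishart_null \<gamma> n \<rightarrow>\<^sub>M Rn n" by measurable
  qed
  thus ?thesis
    by (simp add: planted_map_def[abs_def] compose_def[abs_def] measurable_cong_sets[OF refl sets_wishart_null])
qed

lemma measurable_planted_map:
  assumes "x \<in> space (Rn n)"
  shows "planted_map \<beta> (num_samples \<gamma> n) n x \<in> wishart_null \<gamma> n \<rightarrow>\<^sub>M wishart_null \<gamma> n"
  using measurable_compose[OF measurable_Pair1'[OF assms] measurable_planted_map_pair[OF refl]] by simp

lemma distr_wishart_null_planted_map: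
  assumes "x \<in> space (Rn n)"
  shows "distr (wishart_null \<gamma> n) (wishart_null \<gamma> n) (planted_map \<beta> (num_samples \<gamma> n) n x)
       = PiM {..<num_samples \<gamma> n} (\<lambda>_. distr (std_gaussian n) (std_gaussian n) (spike_map \<beta> n x))"
  unfolding wishart_null_def planted_map_def
  by (rule distr_PiM_finite_prob_space') (auto intro: prob_space_std_gaussian measurable_spike_map assms)

lemma gaussian_spiked_cov:
  assumes "\<beta> * sqnorm n x \<ge> -1"
  shows "gaussian n (spiked_cov \<beta> x) = distr (std_gaussian n) (std_gaussian n) (spike_map \<beta> n x)"
  unfolding gaussian_def
proof (rule distr_cong)
  fix g
  have "(\<Sum>j<n. psd_sqrt n (spiked_cov \<beta> x) i j * g j) = g i + spike_coef \<beta> n x * x i * (\<Sum>j<n. x j * g j)" if "i < n" for i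
    using that psd_sqrt_spiked_cov[OF assms that] by (simp add: spike_sqrt_apply)
  thus "(\<lambda>i\<in>{..<n}. \<Sum>j<n. psd_sqrt n (spiked_cov \<beta> x) i j * g j) = spike_map \<beta> n x g"
    by (auto simp: spike_map_def)
qed (simp_all add: sets_std_gaussian)

lemma wishart_planted_kernel:
  assumes x: "x \<in> space (Rn n)"
  shows "(if \<beta> * sqnorm n x \<ge> -1
     then PiM {..<num_samples \<gamma> n} (\<lambda>_. gaussian n (spiked_cov \<beta> x))
     else wishart_null \<gamma> n)
     = distr (wishart_null \<gamma> n) (wishart_null \<gamma> n) (planted_map \<beta> (num_samples \<gamma> n) n x)"
proof (cases "\<beta> * sqnorm n x \<ge> -1")
  case True
  thus ?thesis using x by (simp add: distr_wishart_null_planted_map gaussian_spiked_cov)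
next
  case False
  have "distr (std_gaussian n) (std_gaussian n) (spike_map \<beta> n x) = distr (std_gaussian n) (std_gaussian n) (\<lambda>g. g)"
    using False by (intro distr_cong refl)
      (auto simp: spike_map_def spike_coef_def space_std_gaussian space_PiM PiE_def extensional_def fun_eq_iff)
  hence "distr (std_gaussian n) (std_gaussian n) (spike_map \<beta> n x) = std_gaussian n"
    by (simp add: distr_id2)
  thus ?thesis using False by (simp add: distr_wishart_null_planted_map[OF x]) (simp add: wishart_null_def)
qed

text \<open>Sampling the spike and independent white noise and then applying one deterministic map
  gives the planted law. In this form planted expectations are integrals over a product space and
  Fubini applies, which the monadic bind does not offer directly.\<close>

lemma wishart_planted_eq:
  assumes X: "prob_space (X n)" and sets_X: "sets (X n) = sets (Rn n)"
  shows "wishart_planted \<gamma> \<beta> X n = distr (X n \<Otimes>\<^sub>M wishart_null \<gamma> n) (wishart_null \<gamma> n)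
           (\<lambda>(x, y). planted_map \<beta> (num_samples \<gamma> n) n x y)"
proof -
  let ?Q = "wishart_null \<gamma> n" and ?F = "planted_map \<beta> (num_samples \<gamma> n) n"
  interpret Q: prob_space ?Q by (rule prob_space_wishart_null)
  interpret X: prob_space "X n" by fact
  have space_X: "space (X n) = space (Rn n)" by (rule sets_eq_imp_space_eq[OF sets_X])
  have F[measurable]: "(\<lambda>(x, y). ?F x y) \<in> X n \<Otimes>\<^sub>M ?Q \<rightarrow>\<^sub>M ?Q"
    by (rule measurable_planted_map_pair[OF sets_X])
  have kern: "(\<lambda>x. distr ?Q ?Q (?F x)) \<in> X n \<rightarrow>\<^sub>M subprob_algebra ?Q"
    by (rule measurable_distr2[OF F]) (auto simp: space_subprob_algebra intro: Q.subprob_space_axioms)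
  have "wishart_planted \<gamma> \<beta> X n = X n \<bind> (\<lambda>x. distr ?Q ?Q (?F x))"
    unfolding wishart_planted_def
    by (rule bind_cong) (auto simp: space_X wishart_planted_kernel)
  also have "\<dots> = distr (X n \<Otimes>\<^sub>M ?Q) ?Q (\<lambda>(x, y). ?F x y)"
  proof (rule measure_eqI)
    show "sets (X n \<bind> (\<lambda>x. distr ?Q ?Q (?F x))) = sets (distr (X n \<Otimes>\<^sub>M ?Q) ?Q (\<lambda>(x, y). ?F x y))"
      using sets_bind[of "X n" "\<lambda>x. distr ?Q ?Q (?F x)" ?Q] X.not_empty by simp
    hence sets: "sets (X n \<bind> (\<lambda>x. distr ?Q ?Q (?F x))) = sets ?Q" by simp
    fix A assume "A \<in> sets (X n \<bind> (\<lambda>x. distr ?Q ?Q (?F x)))"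
    hence A[measurable]: "A \<in> sets ?Q" by (simp only: sets)
    have "emeasure (X n \<bind> (\<lambda>x. distr ?Q ?Q (?F x))) A = (\<integral>\<^sup>+x. emeasure (distr ?Q ?Q (?F x)) A \<partial>X n)"
      by (rule emeasure_bind[OF X.not_empty kern A])
    also have "\<dots> = (\<integral>\<^sup>+x. emeasure ?Q (Pair x -` ((\<lambda>(x, y). ?F x y) -` A \<inter> space (X n \<Otimes>\<^sub>M ?Q))) \<partial>X n)"
    proof (rule nn_integral_cong)
      fix x assume x: "x \<in> space (X n)"
      show "emeasure (distr ?Q ?Q (?F x)) A = emeasure ?Q (Pair x -` ((\<lambda>(x, y). ?F x y) -` A \<inter> space (X n \<Otimes>\<^sub>M ?Q)))"
        using x by (subst emeasure_distr) (auto simp: space_X measurable_planted_map space_pair_measure intro!: arg_cong[where f="emeasure ?Q"])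
    qed
    also have "\<dots> = emeasure (X n \<Otimes>\<^sub>M ?Q) ((\<lambda>(x, y). ?F x y) -` A \<inter> space (X n \<Otimes>\<^sub>M ?Q))"
      by (rule Q.emeasure_pair_measure_alt[symmetric]) measurable
    also have "\<dots> = emeasure (distr (X n \<Otimes>\<^sub>M ?Q) ?Q (\<lambda>(x, y). ?F x y)) A"
      by (subst emeasure_distr) auto
    finally show "emeasure (X n \<bind> (\<lambda>x. distr ?Q ?Q (?F x))) A = emeasure (distr (X n \<Otimes>\<^sub>M ?Q) ?Q (\<lambda>(x, y). ?F x y)) A" .
  qed
  finally show ?thesis .
qed

text \<open>For almost every spike the linear map is nonsingular in each sample, so almost all
  slices of the preimage of a null set are null. Without this property the Radon-Nikodym derivative
  would not represent the planted measure.\<close>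

lemma absolutely_continuous_wishart_planted:
  assumes X: "prob_space (X n)" and sets_X: "sets (X n) = sets (Rn n)"
    and good: "AE x in X n. \<beta> * sqnorm n x > -1"
  shows "absolutely_continuous (wishart_null \<gamma> n) (wishart_planted \<gamma> \<beta> X n)"
proof -
  let ?Q = "wishart_null \<gamma> n" and ?F = "planted_map \<beta> (num_samples \<gamma> n) n"
  interpret Q: prob_space ?Q by (rule prob_space_wishart_null)
  interpret X: prob_space "X n" by fact
  have space_X: "space (X n) = space (Rn n)" by (rule sets_eq_imp_space_eq[OF sets_X])
  have F[measurable]: "(\<lambda>(x, y). ?F x y) \<in> X n \<Otimes>\<^sub>M ?Q \<rightarrow>\<^sub>M ?Q"
    by (rule measurable_planted_map_pair[OF sets_X])
  have ac: "absolutely_continuous ?Q (distr ?Q ?Q (?F x))"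
    if x: "x \<in> space (Rn n)" and good: "\<beta> * sqnorm n x > -1" for x
  proof -
    have "absolutely_continuous (PiM {..<num_samples \<gamma> n} (\<lambda>_. std_gaussian n))
      (PiM {..<num_samples \<gamma> n} (\<lambda>_. distr (std_gaussian n) (std_gaussian n) (spike_map \<beta> n x)))"
      by (intro absolutely_continuous_PiM nonsingular_imp_absolutely_continuous nonsingular_spike_map good
          prob_space_std_gaussian prob_space.prob_space_distr measurable_spike_map x) auto
    thus ?thesis by (simp add: distr_wishart_null_planted_map[OF x]) (simp add: wishart_null_def)
  qed
  show ?thesis unfolding absolutely_continuous_def
  proof
    fix A assume A: "A \<in> null_sets ?Q"
    hence [measurable]: "A \<in> sets ?Q" by auto
    let ?B = "(\<lambda>(x, y). ?F x y) -` A \<inter> space (X n \<Otimes>\<^sub>M ?Q)"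
    have "emeasure (X n \<Otimes>\<^sub>M ?Q) ?B = (\<integral>\<^sup>+x. emeasure ?Q (Pair x -` ?B) \<partial>X n)"
      by (rule Q.emeasure_pair_measure_alt) measurable
    also have "\<dots> = (\<integral>\<^sup>+x. 0 \<partial>X n)"
    proof (rule nn_integral_cong_AE)
      show "AE x in X n. emeasure ?Q (Pair x -` ?B) = 0"
        using good AE_space
      proof eventually_elim
        case (elim x)
        hence x: "x \<in> space (Rn n)" by (simp add: space_X)
        have "Pair x -` ?B = ?F x -` A \<inter> space ?Q" using elim by (auto simp: space_pair_measure)
        moreover have "A \<in> null_sets (distr ?Q ?Q (?F x))"
          using ac[OF x elim(1)] A by (auto simp: absolutely_continuous_def)
        ultimately show ?case
          by (auto simp: null_sets_distr_iff[OF measurable_planted_map[OF x]])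
      qed
    qed
    finally have "emeasure (X n \<Otimes>\<^sub>M ?Q) ?B = 0" by simp
    thus "A \<in> null_sets (wishart_planted \<gamma> \<beta> X n)"
      unfolding wishart_planted_eq[of X n, OF X sets_X]
      by (subst null_sets_distr_iff[OF F]) (auto intro!: null_setsI)
  qed
qed

section \<open>Hermite moments of the planted distribution\<close>

definition hermite_prod :: "nat \<Rightarrow> nat \<Rightarrow> (nat \<Rightarrow> nat \<Rightarrow> nat) \<Rightarrow> (nat \<Rightarrow> nat \<Rightarrow> real) \<Rightarrow> real" where
  "hermite_prod N n \<alpha> y = (\<Prod>i<N. \<Prod>j<n. poly (hermite (\<alpha> i j)) (y i j))"

lemma all_moments_wishart_null_component:
  assumes "i < num_samples \<gamma> n" "j < n"
  shows "all_moments (wishart_null \<gamma> n) (\<lambda>y. y i j)"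
proof (rule all_moments_distr[where f="\<lambda>g. g j"])
  show "(\<lambda>y. y i) \<in> wishart_null \<gamma> n \<rightarrow>\<^sub>M std_gaussian n"
    unfolding wishart_null_def using assms by (intro measurable_component_singleton) auto
  have "distr (wishart_null \<gamma> n) (std_gaussian n) (\<lambda>y. y i) = std_gaussian n"
    unfolding wishart_null_def using assms
    by (intro distr_PiM_component prob_space_std_gaussian) auto
  thus "all_moments (distr (wishart_null \<gamma> n) (std_gaussian n) (\<lambda>y. y i)) (\<lambda>g. g j)"
    using assms by (simp add: all_moments_std_gaussian_component)
qed

lemma all_moments_hermite_prod:
  assumes "finite_measure M" "\<And>i j. i < N \<Longrightarrow> j < n \<Longrightarrow> all_moments M (\<lambda>z. y z i j)"
  shows "all_moments M (\<lambda>z. hermite_prod N n \<alpha> (y z))"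
  unfolding hermite_prod_def by (intro all_moments_prod all_moments_poly assms) auto

lemma all_moments_wishart_null_hermite_prod:
  "all_moments (wishart_null \<gamma> n) (hermite_prod (num_samples \<gamma> n) n \<alpha>)"
  using all_moments_hermite_prod[of "wishart_null \<gamma> n" "num_samples \<gamma> n" n "\<lambda>y. y" \<alpha>]
  by (simp add: finite_measure_wishart_null all_moments_wishart_null_component)

abbreviation multi_fact :: "nat \<Rightarrow> nat \<Rightarrow> (nat \<Rightarrow> nat \<Rightarrow> nat) \<Rightarrow> real" where
  "multi_fact N n \<alpha> \<equiv> (\<Prod>i<N. \<Prod>j<n. fact (\<alpha> i j))"

text \<open>Independence over samples and coordinates reduces this to dimension one. Extensionality
  of the exponents ensures that two different ones already differ inside the N by n grid, where some
  factor then vanishes.\<close>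

lemma wishart_null_hermite_orthogonal:
  fixes \<gamma> n defines "N \<equiv> num_samples \<gamma> n"
  assumes "\<alpha> \<in> {..<N} \<rightarrow>\<^sub>E ({..<n} \<rightarrow>\<^sub>E UNIV)" "\<alpha>' \<in> {..<N} \<rightarrow>\<^sub>E ({..<n} \<rightarrow>\<^sub>E UNIV)"
  shows "(\<integral>y. hermite_prod N n \<alpha> y * hermite_prod N n \<alpha>' y \<partial>wishart_null \<gamma> n)
       = (if \<alpha> = \<alpha>' then multi_fact N n \<alpha> else 0)"
proof -
  interpret G: product_prob_space "\<lambda>_::nat. gauss" "{..<n}"
    by (intro product_prob_spaceI prob_space_gauss)
  interpret Q: product_prob_space "\<lambda>_::nat. std_gaussian n" "{..<N}"
    by (intro product_prob_spaceI prob_space_std_gaussian)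
  let ?f = "\<lambda>i j t. poly (hermite (\<alpha> i j)) t * poly (hermite (\<alpha>' i j)) t"
  have int: "integrable gauss (?f i j)" for i j
    by (intro all_moments_integrable all_moments_mult all_moments_poly all_moments_gauss finite_measure_gauss)
  have int2: "integrable (std_gaussian n) (\<lambda>g. \<Prod>j<n. ?f i j (g j))" for i
    unfolding std_gaussian_def by (intro G.product_integrable_prod int) auto
  have "(\<integral>y. hermite_prod N n \<alpha> y * hermite_prod N n \<alpha>' y \<partial>wishart_null \<gamma> n)
      = (\<integral>y. (\<Prod>i<N. \<Prod>j<n. ?f i j (y i j)) \<partial>PiM {..<N} (\<lambda>_. std_gaussian n))"
    by (simp add: wishart_null_def hermite_prod_def prod.distrib N_def)
  also have "\<dots> = (\<Prod>i<N. \<integral>g. (\<Prod>j<n. ?f i j (g j)) \<partial>std_gaussian n)"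
    using Q.product_integral_prod[of "{..<N}" "\<lambda>i g. \<Prod>j<n. ?f i j (g j)"] int2 by simp
  also have "\<dots> = (\<Prod>i<N. \<Prod>j<n. \<integral>t. ?f i j t \<partial>gauss)"
    unfolding std_gaussian_def
    using G.product_integral_prod[of "{..<n}" "?f i" for i] int by simp
  also have "\<dots> = (\<Prod>i<N. \<Prod>j<n. if \<alpha> i j = \<alpha>' i j then fact (\<alpha> i j) else 0)"
    by (simp add: gauss_hermite_orthogonal)
  also have "\<dots> = (if \<alpha> = \<alpha>' then multi_fact N n \<alpha> else 0)"
  proof (cases "\<alpha> = \<alpha>'")
    case False
    then obtain i where i: "i \<in> {..<N}" "\<alpha> i \<noteq> \<alpha>' i" using PiE_ext[OF assms(2,3)] by auto
    then obtain j where j: "j \<in> {..<n}" "\<alpha> i j \<noteq> \<alpha>' i j"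
      using PiE_ext[of "\<alpha> i" "{..<n}" "\<lambda>_. UNIV" "\<alpha>' i"] PiE_mem[OF assms(2)] PiE_mem[OF assms(3)] by blast
    have "\<exists>i<N. \<exists>j<n. \<alpha> i j \<noteq> \<alpha>' i j" using i j by auto
    thus ?thesis using False by (auto simp: prod_zero_iff)
  qed simp
  finally show ?thesis .
qed

abbreviation wick_prod :: "real \<Rightarrow> nat \<Rightarrow> nat \<Rightarrow> (nat \<Rightarrow> nat \<Rightarrow> nat) \<Rightarrow> real" where
  "wick_prod \<beta> N n \<alpha> \<equiv> (\<Prod>i<N. wick \<beta> (\<Sum>j<n. \<alpha> i j))"

abbreviation spike_monomial :: "nat \<Rightarrow> nat \<Rightarrow> (nat \<Rightarrow> nat \<Rightarrow> nat) \<Rightarrow> (nat \<Rightarrow> real) \<Rightarrow> real" where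
  "spike_monomial N n \<alpha> x \<equiv> (\<Prod>i<N. \<Prod>j<n. x j ^ \<alpha> i j)"

text \<open>Given the spike the samples are independent, so the moment factors over rows, and each
  row is covered by the Hermite moment formula with the explicit square root.\<close>

lemma wishart_null_hermite_planted_map:
  fixes \<gamma> n defines "N \<equiv> num_samples \<gamma> n"
  assumes x: "x \<in> space (Rn n)" and good: "\<beta> * sqnorm n x \<ge> -1"
  shows "(\<integral>y. hermite_prod N n \<alpha> (planted_map \<beta> N n x y) \<partial>wishart_null \<gamma> n)
       = wick_prod \<beta> N n \<alpha> * spike_monomial N n \<alpha> x"
proof -
  interpret Q: product_prob_space "\<lambda>_::nat. std_gaussian n" "{..<N}"
    by (intro product_prob_spaceI prob_space_std_gaussian)
  let ?f = "\<lambda>i g. \<Prod>j<n. poly (hermite (\<alpha> i j)) (\<Sum>l<n. spike_sqrt \<beta> n x j l * g l)"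
  have int: "integrable (std_gaussian n) (?f i)" for i
    by (intro all_moments_integrable all_moments_prod all_moments_poly all_moments_std_gaussian_linear
         finite_measure_std_gaussian)
  have "(\<integral>y. hermite_prod N n \<alpha> (planted_map \<beta> N n x y) \<partial>wishart_null \<gamma> n)
      = (\<integral>y. (\<Prod>i<N. ?f i (y i)) \<partial>PiM {..<N} (\<lambda>_. std_gaussian n))"
    by (simp add: wishart_null_def hermite_prod_def planted_map_def compose_def spike_map_def
          spike_sqrt_apply flip: N_def)
  also have "\<dots> = (\<Prod>i<N. \<integral>g. ?f i g \<partial>std_gaussian n)"
    using Q.product_integral_prod[of "{..<N}" ?f] int by simp
  also have "\<dots> = (\<Prod>i<N. wick \<beta> (\<Sum>j<n. \<alpha> i j) * (\<Prod>j<n. x j ^ \<alpha> i j))"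
    using spike_sqrt_square[OF good]
    by (subst spiked_hermite_expectation[of n "spike_sqrt \<beta> n x" \<beta> x])
       (auto simp: spiked_cov_def spike_sqrt_sym[of _ _ _ _ "k :: nat" for k])
  finally show ?thesis by (simp add: prod.distrib)
qed

section \<open>Projections onto the span of an orthogonal family\<close>

text \<open>If a projection p exists, L h = (L - p) h + p h is integrable for each h in the family,
  and the coefficients of p are forced to be the Fourier coefficients. Conversely, integrability of
  all L h makes the Fourier combination a projection. All projections therefore have the same norm,
  so the \<open>SOME\<close> in \<open>proj_norm\<close> is harmless, and L itself need not be
  square integrable.\<close>

lemma
  fixes h :: "'i \<Rightarrow> 'a \<Rightarrow> real"
  assumes fin: "finite I"
    and V: "V = {q. \<exists>c. q = (\<lambda>y. \<Sum>\<alpha>\<in>I. c \<alpha> * h \<alpha> y)}"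
    and int: "\<And>\<alpha> \<alpha>'. \<alpha> \<in> I \<Longrightarrow> \<alpha>' \<in> I \<Longrightarrow> integrable Q (\<lambda>y. h \<alpha> y * h \<alpha>' y)"
    and orth: "\<And>\<alpha> \<alpha>'. \<alpha> \<in> I \<Longrightarrow> \<alpha>' \<in> I \<Longrightarrow> (\<integral>y. h \<alpha> y * h \<alpha>' y \<partial>Q) = (if \<alpha> = \<alpha>' then w \<alpha> else 0)"
    and w: "\<And>\<alpha>. \<alpha> \<in> I \<Longrightarrow> w \<alpha> > 0"
  shows proj_norm_orthogonal_infinite:
      "\<not> (\<forall>\<alpha>\<in>I. integrable Q (\<lambda>y. L y * h \<alpha> y)) \<Longrightarrow> proj_norm Q V L = \<infinity>"
    and proj_norm_orthogonal:
      "(\<forall>\<alpha>\<in>I. integrable Q (\<lambda>y. L y * h \<alpha> y)) \<Longrightarrow>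
         proj_norm Q V L = ennreal (sqrt (\<Sum>\<alpha>\<in>I. (\<integral>y. L y * h \<alpha> y \<partial>Q)\<^sup>2 / w \<alpha>))"
proof -
  define comb where "comb c y = (\<Sum>\<alpha>\<in>I. c \<alpha> * h \<alpha> y)" for c y
  have int_comb: "integrable Q (\<lambda>y. comb c y * h \<alpha> y)" if "\<alpha> \<in> I" for c \<alpha>
    unfolding comb_def sum_distrib_right using int that
    by (intro Bochner_Integration.integrable_sum) (simp add: mult.assoc)
  have comb_h: "(\<integral>y. comb c y * h \<alpha> y \<partial>Q) = c \<alpha> * w \<alpha>" if "\<alpha> \<in> I" for c \<alpha>
  proof -
    have "(\<integral>y. comb c y * h \<alpha> y \<partial>Q) = (\<integral>y. (\<Sum>\<alpha>'\<in>I. c \<alpha>' * (h \<alpha>' y * h \<alpha> y)) \<partial>Q)"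
      by (simp add: comb_def sum_distrib_right mult.assoc)
    also have "\<dots> = (\<Sum>\<alpha>'\<in>I. c \<alpha>' * (\<integral>y. h \<alpha>' y * h \<alpha> y \<partial>Q))"
      using int that by (subst Bochner_Integration.integral_sum) auto
    also have "\<dots> = (\<Sum>\<alpha>'\<in>I. if \<alpha>' = \<alpha> then c \<alpha> * w \<alpha> else 0)"
      using that by (intro sum.cong) (auto simp: orth)
    finally show ?thesis using that fin by simp
  qed
  have h_V: "h \<alpha> \<in> V" if "\<alpha> \<in> I" for \<alpha>
  proof -
    have "h \<alpha> = (\<lambda>y. \<Sum>\<alpha>'\<in>I. (if \<alpha>' = \<alpha> then 1 else 0) * h \<alpha>' y)"
    proof
      fix y
      have "(\<Sum>\<alpha>'\<in>I. (if \<alpha>' = \<alpha> then 1 else 0) * h \<alpha>' y) = (\<Sum>\<alpha>'\<in>I. if \<alpha>' = \<alpha> then h \<alpha>' y else 0)"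
        by (intro sum.cong) auto
      thus "h \<alpha> y = (\<Sum>\<alpha>'\<in>I. (if \<alpha>' = \<alpha> then 1 else 0) * h \<alpha>' y)" using that fin by simp
    qed
    thus ?thesis unfolding V mem_Collect_eq by (rule exI[of _ "\<lambda>\<alpha>'. if \<alpha>' = \<alpha> then 1 else 0"])
  qed
  have proj: "(\<forall>\<alpha>\<in>I. integrable Q (\<lambda>y. L y * h \<alpha> y)) \<and>
      L2_norm Q p = sqrt (\<Sum>\<alpha>\<in>I. (\<integral>y. L y * h \<alpha> y \<partial>Q)\<^sup>2 / w \<alpha>)" if p: "is_orth_proj Q V L p" for p
  proof -
    obtain c where c: "p = comb c" using p unfolding is_orth_proj_def V comb_def by auto
    have Lh: "integrable Q (\<lambda>y. L y * h \<alpha> y)" "(\<integral>y. L y * h \<alpha> y \<partial>Q) = c \<alpha> * w \<alpha>" if \<alpha>: "\<alpha> \<in> I" for \<alpha>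
    proof -
      have "has_bochner_integral Q (\<lambda>y. (L y - p y) * h \<alpha> y) 0"
        using p h_V[OF \<alpha>] unfolding is_orth_proj_def by blast
      moreover have "has_bochner_integral Q (\<lambda>y. p y * h \<alpha> y) (c \<alpha> * w \<alpha>)"
        using int_comb[OF \<alpha>, of c] comb_h[OF \<alpha>, of c] by (simp add: c has_bochner_integral_iff)
      ultimately have "has_bochner_integral Q (\<lambda>y. (L y - p y) * h \<alpha> y + p y * h \<alpha> y) (0 + c \<alpha> * w \<alpha>)"
        by (rule has_bochner_integral_add)
      hence "has_bochner_integral Q (\<lambda>y. L y * h \<alpha> y) (c \<alpha> * w \<alpha>)" by (simp add: algebra_simps)
      thus "integrable Q (\<lambda>y. L y * h \<alpha> y)" "(\<integral>y. L y * h \<alpha> y \<partial>Q) = c \<alpha> * w \<alpha>"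
        by (simp_all add: has_bochner_integral_iff)
    qed
    have "(\<integral>y. (p y)\<^sup>2 \<partial>Q) = (\<integral>y. (\<Sum>\<alpha>\<in>I. c \<alpha> * (p y * h \<alpha> y)) \<partial>Q)"
    proof (rule Bochner_Integration.integral_cong[OF refl])
      fix y
      have "(p y)\<^sup>2 = p y * (\<Sum>\<alpha>\<in>I. c \<alpha> * h \<alpha> y)"
        unfolding power2_eq_square using c by (simp add: comb_def)
      thus "(p y)\<^sup>2 = (\<Sum>\<alpha>\<in>I. c \<alpha> * (p y * h \<alpha> y))" by (simp add: sum_distrib_left mult_ac)
    qed
    also have "\<dots> = (\<Sum>\<alpha>\<in>I. c \<alpha> * (\<integral>y. p y * h \<alpha> y \<partial>Q))"
      using int_comb by (subst Bochner_Integration.integral_sum) (auto simp: c)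
    also have "\<dots> = (\<Sum>\<alpha>\<in>I. (\<integral>y. L y * h \<alpha> y \<partial>Q)\<^sup>2 / w \<alpha>)"
      using w by (intro sum.cong refl) (fastforce simp: c comb_h Lh power2_eq_square)
    finally show ?thesis using Lh by (simp add: L2_norm_def)
  qed
  show "proj_norm Q V L = \<infinity>" if "\<not> (\<forall>\<alpha>\<in>I. integrable Q (\<lambda>y. L y * h \<alpha> y))"
    using that proj unfolding proj_norm_def by auto
  assume Lint: "\<forall>\<alpha>\<in>I. integrable Q (\<lambda>y. L y * h \<alpha> y)"
  define c where "c \<alpha> = (\<integral>y. L y * h \<alpha> y \<partial>Q) / w \<alpha>" for \<alpha>
  have "is_orth_proj Q V L (comb c)" unfolding is_orth_proj_def
  proof (intro conjI ballI)
    show "comb c \<in> V" unfolding V comb_def by auto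
    fix q assume "q \<in> V"
    then obtain e where e: "q = comb e" unfolding V comb_def by auto
    have "has_bochner_integral Q (\<lambda>y. e \<alpha> * (L y * h \<alpha> y - comb c y * h \<alpha> y)) (e \<alpha> * (w \<alpha> * c \<alpha> - c \<alpha> * w \<alpha>))" if "\<alpha> \<in> I" for \<alpha>
      using Lint that int_comb[OF that, of c] comb_h[OF that, of c] w[OF that]
      by (intro has_bochner_integral_mult_right has_bochner_integral_diff)
         (auto simp: has_bochner_integral_iff c_def)
    hence "has_bochner_integral Q (\<lambda>y. \<Sum>\<alpha>\<in>I. e \<alpha> * (L y * h \<alpha> y - comb c y * h \<alpha> y)) (\<Sum>\<alpha>\<in>I. e \<alpha> * (w \<alpha> * c \<alpha> - c \<alpha> * w \<alpha>))"
      by (intro has_bochner_integral_sum)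
    moreover have "(\<Sum>\<alpha>\<in>I. e \<alpha> * (L y * h \<alpha> y - comb c y * h \<alpha> y)) = (L y - comb c y) * q y" for y
      unfolding e comb_def[of e] by (simp add: sum_distrib_left algebra_simps)
    ultimately show "has_bochner_integral Q (\<lambda>y. (L y - comb c y) * q y) 0" by simp
  qed
  hence ex: "\<exists>p. is_orth_proj Q V L p" by blast
  hence "is_orth_proj Q V L (SOME p. is_orth_proj Q V L p)" by (rule someI_ex)
  thus "proj_norm Q V L = ennreal (sqrt (\<Sum>\<alpha>\<in>I. (\<integral>y. L y * h \<alpha> y \<partial>Q)\<^sup>2 / w \<alpha>))"
    using proj ex unfolding proj_norm_def by auto
qed

section \<open>Polynomials in terms of Hermite products\<close>

text \<open>Extensional exponents name each monomial exactly once, whereas \<open>polys_upto\<close>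
  admits arbitrary functions, many of which agree on the grid and denote the same monomial.\<close>

definition exponents :: "nat \<Rightarrow> nat \<Rightarrow> nat \<Rightarrow> (nat \<Rightarrow> nat \<Rightarrow> nat) set" where
  "exponents N n D = {\<alpha> \<in> {..<N} \<rightarrow>\<^sub>E ({..<n} \<rightarrow>\<^sub>E UNIV). (\<Sum>i<N. \<Sum>j<n. \<alpha> i j) \<le> D}"

lemma finite_exponents: "finite (exponents N n D)"
proof (rule finite_subset)
  show "exponents N n D \<subseteq> {..<N} \<rightarrow>\<^sub>E ({..<n} \<rightarrow>\<^sub>E {..D})"
  proof
    fix \<alpha> assume \<alpha>: "\<alpha> \<in> exponents N n D"
    have "\<alpha> i j \<le> D" if "i < N" "j < n" for i j
    proof -
      have "\<alpha> i j \<le> (\<Sum>j<n. \<alpha> i j)" using that by (intro member_le_sum) auto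
      also have "\<dots> \<le> (\<Sum>i<N. \<Sum>j<n. \<alpha> i j)"
        using that by (intro member_le_sum[of i "{..<N}" "\<lambda>i. \<Sum>j<n. \<alpha> i j"]) auto
      finally show ?thesis using \<alpha> by (simp add: exponents_def)
    qed
    thus "\<alpha> \<in> {..<N} \<rightarrow>\<^sub>E ({..<n} \<rightarrow>\<^sub>E {..D})"
      using \<alpha> by (auto simp: exponents_def PiE_iff)
  qed
qed (intro finite_PiE finite_lessThan finite_atMost)

abbreviation exponent_box :: "nat \<Rightarrow> nat \<Rightarrow> (nat \<Rightarrow> nat \<Rightarrow> nat) \<Rightarrow> (nat \<Rightarrow> nat \<Rightarrow> nat) set" where
  "exponent_box N n \<alpha> \<equiv> PiE {..<N} (\<lambda>i. PiE {..<n} (\<lambda>j. {..\<alpha> i j}))"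

abbreviation data_monomial :: "nat \<Rightarrow> nat \<Rightarrow> (nat \<Rightarrow> nat \<Rightarrow> nat) \<Rightarrow> (nat \<Rightarrow> nat \<Rightarrow> real) \<Rightarrow> real" where
  "data_monomial N n \<alpha> y \<equiv> (\<Prod>i<N. \<Prod>j<n. y i j ^ \<alpha> i j)"

lemma prod_prod_sum_atMost:
  fixes f :: "nat \<Rightarrow> nat \<Rightarrow> nat \<Rightarrow> real"
  shows "(\<Prod>i<N. \<Prod>j<n. \<Sum>k\<le>\<alpha> i j. f i j k)
       = (\<Sum>\<kappa>\<in>exponent_box N n \<alpha>. \<Prod>i<N. \<Prod>j<n. f i j (\<kappa> i j))"
  by (simp add: prod_sum_PiE finite_PiE)

lemma box_subset_exponents:
  assumes "(\<Sum>i<N. \<Sum>j<n. \<alpha> i j) \<le> D"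
  shows "exponent_box N n \<alpha> \<subseteq> exponents N n D"
proof
  fix \<kappa> assume \<kappa>: "\<kappa> \<in> exponent_box N n \<alpha>"
  have "(\<Sum>i<N. \<Sum>j<n. \<kappa> i j) \<le> (\<Sum>i<N. \<Sum>j<n. \<alpha> i j)"
    using \<kappa> by (intro sum_mono) (fastforce simp: PiE_iff)
  thus "\<kappa> \<in> exponents N n D" using \<kappa> assms by (auto simp: exponents_def PiE_iff)
qed

lemma polys_upto_sum:
  assumes "finite A" "\<And>\<alpha>. \<alpha> \<in> A \<Longrightarrow> f \<alpha> \<in> polys_upto N n D"
  shows "(\<lambda>y. \<Sum>\<alpha>\<in>A. c \<alpha> * f \<alpha> y) \<in> polys_upto N n D"
  using assms
proof (induction A rule: finite_induct)
  case empty
  show ?case by (auto simp: polys_upto_def intro!: exI[of _ "{}"])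
next
  case (insert \<alpha> A)
  let ?m = "\<lambda>\<alpha> y. \<Prod>i<N. \<Prod>j<n. y i j ^ \<alpha> i j"
  from insert obtain B b where B: "finite B" "\<forall>\<beta>\<in>B. (\<Sum>i<N. \<Sum>j<n. \<beta> i j) \<le> D"
    "(\<lambda>y. \<Sum>\<alpha>\<in>A. c \<alpha> * f \<alpha> y) = (\<lambda>y. \<Sum>\<beta>\<in>B. b \<beta> * ?m \<beta> y)" by (auto simp: polys_upto_def)
  from insert have "f \<alpha> \<in> polys_upto N n D" by auto
  then obtain E e where E: "finite E" "\<forall>\<beta>\<in>E. (\<Sum>i<N. \<Sum>j<n. \<beta> i j) \<le> D"
    "f \<alpha> = (\<lambda>y. \<Sum>\<beta>\<in>E. e \<beta> * ?m \<beta> y)" by (auto simp: polys_upto_def)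
  define d where "d \<beta> = (if \<beta> \<in> B then b \<beta> else 0) + c \<alpha> * (if \<beta> \<in> E then e \<beta> else 0)" for \<beta>
  have "(\<Sum>\<alpha>\<in>insert \<alpha> A. c \<alpha> * f \<alpha> y) = (\<Sum>\<beta>\<in>B \<union> E. d \<beta> * ?m \<beta> y)" for y
  proof -
    have "(\<Sum>\<beta>\<in>B. b \<beta> * ?m \<beta> y) = (\<Sum>\<beta>\<in>B \<union> E. (if \<beta> \<in> B then b \<beta> else 0) * ?m \<beta> y)"
      using B E by (intro sum.mono_neutral_cong_left) auto
    moreover have "(\<Sum>\<beta>\<in>E. e \<beta> * ?m \<beta> y) = (\<Sum>\<beta>\<in>B \<union> E. (if \<beta> \<in> E then e \<beta> else 0) * ?m \<beta> y)"
      using B E by (intro sum.mono_neutral_cong_left) auto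
    moreover have "(\<Sum>\<alpha>\<in>A. c \<alpha> * f \<alpha> y) = (\<Sum>\<beta>\<in>B. b \<beta> * ?m \<beta> y)" using fun_cong[OF B(3)] .
    ultimately show ?thesis
      using insert.hyps by (simp add: E(3) d_def sum.distrib sum_distrib_left distrib_right mult.assoc add.commute)
  qed
  thus ?case using B E unfolding polys_upto_def mem_Collect_eq
    by (intro exI[of _ "B \<union> E"] exI[of _ d]) auto
qed

lemma monomial_polys_upto:
  assumes "(\<Sum>i<N. \<Sum>j<n. \<alpha> i j) \<le> D"
  shows "(\<lambda>y. \<Prod>i<N. \<Prod>j<n. y i j ^ \<alpha> i j) \<in> polys_upto N n D"
  unfolding polys_upto_def mem_Collect_eq
  by (rule exI[of _ "{\<alpha>}"], rule exI[of _ "\<lambda>_. 1"]) (use assms in auto)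

lemma hermite_prod_polys_upto:
  assumes "(\<Sum>i<N. \<Sum>j<n. \<alpha> i j) \<le> D"
  shows "hermite_prod N n \<alpha> \<in> polys_upto N n D"
proof -
  obtain c where c: "\<And>m y. poly (hermite m) y = (\<Sum>k\<le>m. c m k * y ^ k)"
    using hermite_sum_power by metis
  let ?B = "exponent_box N n \<alpha>"
  have "hermite_prod N n \<alpha> = (\<lambda>y. \<Sum>\<kappa>\<in>?B. (\<Prod>i<N. \<Prod>j<n. c (\<alpha> i j) (\<kappa> i j)) * (\<Prod>i<N. \<Prod>j<n. y i j ^ \<kappa> i j))"
    by (simp add: fun_eq_iff hermite_prod_def c prod_prod_sum_atMost prod.distrib)
  also have "\<dots> \<in> polys_upto N n D"
    using box_subset_exponents[OF assms]
    by (intro polys_upto_sum monomial_polys_upto finite_PiE) (auto simp: exponents_def)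
  finally show ?thesis .
qed

lemma monomial_hermite_sum:
  assumes "(\<Sum>i<N. \<Sum>j<n. \<alpha> i j) \<le> D"
  shows "\<exists>c. \<forall>y. data_monomial N n \<alpha> y = (\<Sum>\<kappa>\<in>exponents N n D. c \<kappa> * hermite_prod N n \<kappa> y)"
proof -
  obtain c where c: "\<And>m y. y ^ m = (\<Sum>k\<le>m. c m k * poly (hermite k) y)"
    using power_eq_hermite_sum by metis
  let ?B = "exponent_box N n \<alpha>"
  have "data_monomial N n \<alpha> y
      = (\<Sum>\<kappa>\<in>exponents N n D. (if \<kappa> \<in> ?B then (\<Prod>i<N. \<Prod>j<n. c (\<alpha> i j) (\<kappa> i j)) else 0) * hermite_prod N n \<kappa> y)" for y
  proof -
    have "data_monomial N n \<alpha> y = (\<Prod>i<N. \<Prod>j<n. \<Sum>k\<le>\<alpha> i j. c (\<alpha> i j) k * poly (hermite k) (y i j))"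
      by (intro prod.cong refl c)
    also have "\<dots> = (\<Sum>\<kappa>\<in>?B. (\<Prod>i<N. \<Prod>j<n. c (\<alpha> i j) (\<kappa> i j)) * hermite_prod N n \<kappa> y)"
      unfolding prod_prod_sum_atMost hermite_prod_def prod.distrib ..
    also have "\<dots> = (\<Sum>\<kappa>\<in>exponents N n D. (if \<kappa> \<in> ?B then (\<Prod>i<N. \<Prod>j<n. c (\<alpha> i j) (\<kappa> i j)) else 0) * hermite_prod N n \<kappa> y)"
      using box_subset_exponents[OF assms] finite_exponents
      by (intro sum.mono_neutral_cong_left) auto
    finally show ?thesis .
  qed
  thus ?thesis by (intro exI allI)
qed

text \<open>In each variable the change of basis between powers and Hermite polynomials is
  triangular, so expanding a product only produces exponents that are entrywise smaller; the bound
  on the total degree is kept in both directions.\<close>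

lemma polys_upto_eq_hermite_span:
  "polys_upto N n D = {q. \<exists>c. q = (\<lambda>y. \<Sum>\<alpha>\<in>exponents N n D. c \<alpha> * hermite_prod N n \<alpha> y)}"
proof (intro equalityI subsetI)
  fix q assume "q \<in> polys_upto N n D"
  then obtain A c where A: "finite A" "\<forall>\<alpha>\<in>A. (\<Sum>i<N. \<Sum>j<n. \<alpha> i j) \<le> D"
     "q = (\<lambda>y. \<Sum>\<alpha>\<in>A. c \<alpha> * data_monomial N n \<alpha> y)" by (auto simp: polys_upto_def)
  from A(2) have "\<forall>\<alpha>\<in>A. \<exists>e. \<forall>y. data_monomial N n \<alpha> y = (\<Sum>\<kappa>\<in>exponents N n D. e \<kappa> * hermite_prod N n \<kappa> y)"
    using monomial_hermite_sum by blast
  from bchoice[OF this] obtain e where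
    e: "\<forall>\<alpha>\<in>A. \<forall>y. data_monomial N n \<alpha> y = (\<Sum>\<kappa>\<in>exponents N n D. e \<alpha> \<kappa> * hermite_prod N n \<kappa> y)"
    by blast
  have "q = (\<lambda>y. \<Sum>\<kappa>\<in>exponents N n D. (\<Sum>\<alpha>\<in>A. c \<alpha> * e \<alpha> \<kappa>) * hermite_prod N n \<kappa> y)"
  proof
    fix y
    have "q y = (\<Sum>\<alpha>\<in>A. \<Sum>\<kappa>\<in>exponents N n D. c \<alpha> * e \<alpha> \<kappa> * hermite_prod N n \<kappa> y)"
      unfolding A(3) by (intro sum.cong refl) (simp add: e sum_distrib_left mult.assoc)
    also have "\<dots> = (\<Sum>\<kappa>\<in>exponents N n D. \<Sum>\<alpha>\<in>A. c \<alpha> * e \<alpha> \<kappa> * hermite_prod N n \<kappa> y)"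
      by (rule sum.swap)
    finally show "q y = (\<Sum>\<kappa>\<in>exponents N n D. (\<Sum>\<alpha>\<in>A. c \<alpha> * e \<alpha> \<kappa>) * hermite_prod N n \<kappa> y)"
      by (simp add: sum_distrib_right)
  qed
  thus "q \<in> {q. \<exists>c. q = (\<lambda>y. \<Sum>\<alpha>\<in>exponents N n D. c \<alpha> * hermite_prod N n \<alpha> y)}"
    unfolding mem_Collect_eq by (rule exI[of _ "\<lambda>\<kappa>. \<Sum>\<alpha>\<in>A. c \<alpha> * e \<alpha> \<kappa>"])
next
  fix q assume "q \<in> {q. \<exists>c. q = (\<lambda>y. \<Sum>\<alpha>\<in>exponents N n D. c \<alpha> * hermite_prod N n \<alpha> y)}"
  then obtain c where q: "q = (\<lambda>y. \<Sum>\<alpha>\<in>exponents N n D. c \<alpha> * hermite_prod N n \<alpha> y)" by blast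
  show "q \<in> polys_upto N n D" unfolding q
    by (intro polys_upto_sum finite_exponents hermite_prod_polys_upto) (auto simp: exponents_def)
qed

section \<open>The multinomial theorem\<close>

definition compositions :: "nat \<Rightarrow> nat \<Rightarrow> (nat \<Rightarrow> nat) set" where
  "compositions n m = {a \<in> {..<n} \<rightarrow>\<^sub>E UNIV. (\<Sum>j<n. a j) = m}"

lemma finite_compositions: "finite (compositions n m)"
proof (rule finite_subset)
  show "compositions n m \<subseteq> {..<n} \<rightarrow>\<^sub>E {..m}"
  proof
    fix a assume a: "a \<in> compositions n m"
    have "a j \<le> m" if "j < n" for j
      using a that member_le_sum[of j "{..<n}" a] by (auto simp: compositions_def)
    thus "a \<in> {..<n} \<rightarrow>\<^sub>E {..m}" using a by (auto simp: compositions_def PiE_iff)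
  qed
qed (intro finite_PiE finite_lessThan finite_atMost)

lemma compositions_Suc:
  "compositions (Suc n) m = (\<lambda>(k, b). b(n := k)) ` (SIGMA k:{..m}. compositions n (m - k))"
proof (intro equalityI subsetI)
  fix a assume a: "a \<in> compositions (Suc n) m"
  define b where "b = restrict a {..<n}"
  have "a = b(n := a n)" using a by (auto simp: b_def compositions_def PiE_iff extensional_def fun_eq_iff)
  moreover have "(a n, b) \<in> (SIGMA k:{..m}. compositions n (m - k))"
  proof -
    have "(\<Sum>j<n. b j) = (\<Sum>j<n. a j)" by (intro sum.cong) (auto simp: b_def)
    moreover have "(\<Sum>j<n. a j) + a n = m" using a by (simp add: compositions_def)
    moreover have "b \<in> {..<n} \<rightarrow>\<^sub>E UNIV" by (simp add: b_def)
    ultimately show ?thesis by (simp add: compositions_def)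
  qed
  ultimately show "a \<in> (\<lambda>(k, b). b(n := k)) ` (SIGMA k:{..m}. compositions n (m - k))"
    by (metis (no_types, lifting) case_prod_conv image_eqI)
next
  fix a assume "a \<in> (\<lambda>(k, b). b(n := k)) ` (SIGMA k:{..m}. compositions n (m - k))"
  then obtain k b where kb: "k \<le> m" "b \<in> compositions n (m - k)" "a = b(n := k)" by auto
  have "(\<Sum>j<n. a j) = (\<Sum>j<n. b j)" using kb by (intro sum.cong) auto
  thus "a \<in> compositions (Suc n) m"
    using kb by (auto simp: compositions_def PiE_iff extensional_def)
qed

text \<open>Dividing by factorials makes this the comparison of coefficients in exp (u_0 z) ... exp
  (u_(n-1) z), with zero parts allowed. The induction splits off the last part, and the sum over its
  value is the binomial theorem.\<close>

lemma multinomial_compositions: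
  fixes u :: "nat \<Rightarrow> real"
  shows "(\<Sum>a\<in>compositions n m. \<Prod>j<n. u j ^ a j / fact (a j)) = (\<Sum>j<n. u j) ^ m / fact m"
proof (induction n arbitrary: m)
  case 0
  have "compositions 0 m = (if m = 0 then {\<lambda>_. undefined} else {})" by (auto simp: compositions_def)
  thus ?case by simp
next
  case (Suc n)
  have inj: "inj_on (\<lambda>(k, b). b(n := k)) (SIGMA k:{..m}. compositions n (m - k))"
  proof (rule inj_on_subset)
    show "inj_on (\<lambda>(k, b). b(n := k)) (UNIV \<times> ({..<n} \<rightarrow>\<^sub>E (UNIV :: nat set)))"
      using inj_combinator[of n "{..<n}" "\<lambda>_. UNIV :: nat set"] by simp
  qed (auto simp: compositions_def)
  have "(\<Sum>a\<in>compositions (Suc n) m. \<Prod>j<Suc n. u j ^ a j / fact (a j))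
      = (\<Sum>(k, b)\<in>(SIGMA k:{..m}. compositions n (m - k)). u n ^ k / fact k * (\<Prod>j<n. u j ^ b j / fact (b j)))"
    unfolding compositions_Suc by (subst sum.reindex[OF inj]) (auto intro!: sum.cong prod.cong)
  also have "\<dots> = (\<Sum>k\<le>m. \<Sum>b\<in>compositions n (m - k). u n ^ k / fact k * (\<Prod>j<n. u j ^ b j / fact (b j)))"
    by (subst sum.Sigma) (auto simp: finite_compositions)
  also have "\<dots> = (\<Sum>k\<le>m. u n ^ k / fact k * ((\<Sum>j<n. u j) ^ (m - k) / fact (m - k)))"
    unfolding sum_distrib_left[symmetric] Suc.IH ..
  also have "\<dots> = (\<Sum>k\<le>m. of_nat (m choose k) * u n ^ k * (\<Sum>j<n. u j) ^ (m - k)) / fact m"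
    by (simp add: sum_divide_distrib, intro sum.cong refl) (simp add: binomial_fact field_simps)
  also have "\<dots> = (u n + (\<Sum>j<n. u j)) ^ m / fact m" by (simp add: binomial_ring)
  finally show ?case by (simp add: add.commute)
qed

section \<open>The low-degree norm\<close>

abbreviation planted_hermite ::
  "real \<Rightarrow> nat \<Rightarrow> nat \<Rightarrow> (nat \<Rightarrow> nat \<Rightarrow> nat) \<Rightarrow> (nat \<Rightarrow> real) \<times> (nat \<Rightarrow> nat \<Rightarrow> real) \<Rightarrow> real" where
  "planted_hermite \<beta> N n \<alpha> \<equiv> (\<lambda>z. hermite_prod N n \<alpha> (planted_map \<beta> N n (fst z) (snd z)))"


text \<open>Three changes of measure: the likelihood ratio turns the null integral into a planted
  one, the image description moves it to spike and noise, and Fubini integrates out the noise. The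
  Wick factor stays inside the integrand because it may be 0, and then nothing follows about the
  monomial alone.\<close>

lemma
  fixes \<gamma> n defines "N \<equiv> num_samples \<gamma> n"
  assumes X: "prob_space (X n)" and sets_X: "sets (X n) = sets (Rn n)"
    and good: "AE x in X n. \<beta> * sqnorm n x > -1"
  shows likelihood_ratio_hermite_integrable:
    "integrable (wishart_null \<gamma> n) (\<lambda>y. likelihood_ratio \<gamma> \<beta> X n y * hermite_prod N n \<alpha> y) \<longleftrightarrow>
     integrable (X n \<Otimes>\<^sub>M wishart_null \<gamma> n) (planted_hermite \<beta> N n \<alpha>)"
      (is "?I1 \<longleftrightarrow> ?I2")
    and likelihood_ratio_hermite_integral:
    "integrable (X n \<Otimes>\<^sub>M wishart_null \<gamma> n) (planted_hermite \<beta> N n \<alpha>) \<Longrightarrow>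
     has_bochner_integral (X n) (\<lambda>x. wick_prod \<beta> N n \<alpha> * spike_monomial N n \<alpha> x)
       (\<integral>y. likelihood_ratio \<gamma> \<beta> X n y * hermite_prod N n \<alpha> y \<partial>wishart_null \<gamma> n)"
proof -
  let ?Q = "wishart_null \<gamma> n" and ?F = "planted_map \<beta> N n" and ?P = "wishart_planted \<gamma> \<beta> X n"
  let ?h = "hermite_prod N n \<alpha>"
  interpret Q: prob_space ?Q by (rule prob_space_wishart_null)
  interpret X: prob_space "X n" by fact
  interpret XQ: pair_prob_space "X n" ?Q ..
  have space_X: "space (X n) = space (Rn n)" by (rule sets_eq_imp_space_eq[OF sets_X])
  have F[measurable]: "(\<lambda>(x, y). ?F x y) \<in> X n \<Otimes>\<^sub>M ?Q \<rightarrow>\<^sub>M ?Q"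
    unfolding N_def by (rule measurable_planted_map_pair[OF sets_X])
  have h[measurable]: "?h \<in> borel_measurable ?Q"
    unfolding N_def by (rule all_moments_measurable[OF all_moments_wishart_null_hermite_prod])
  have P: "?P = distr (X n \<Otimes>\<^sub>M ?Q) ?Q (\<lambda>(x, y). ?F x y)"
    unfolding N_def by (rule wishart_planted_eq[of X n, OF X sets_X])
  have sets_P: "sets ?P = sets ?Q" by (simp add: P)
  interpret P: prob_space ?P unfolding P by (rule XQ.prob_space_distr[OF F])
  have ac: "absolutely_continuous ?Q ?P" by (rule absolutely_continuous_wishart_planted[of X n, OF X sets_X good])
  note RN = P.sigma_finite_measure_axioms ac sets_P h
  have "?I1 \<longleftrightarrow> integrable ?P ?h"
    unfolding likelihood_ratio_def by (rule Q.RN_deriv_integrable[OF RN, symmetric])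
  also have "\<dots> \<longleftrightarrow> ?I2"
    unfolding P by (subst integrable_distr_eq[OF F h]) (simp add: case_prod_unfold)
  finally show "?I1 \<longleftrightarrow> ?I2" .
  assume I2: ?I2
  have eq: "AE x in X n. wick_prod \<beta> N n \<alpha> * spike_monomial N n \<alpha> x = (\<integral>y. ?h (?F x y) \<partial>?Q)"
    using good AE_space
    by eventually_elim (simp add: N_def wishart_null_hermite_planted_map space_X)
  have meas: "(\<lambda>x. wick_prod \<beta> N n \<alpha> * spike_monomial N n \<alpha> x) \<in> borel_measurable (X n)"
  proof -
    have "(\<lambda>x. x j) \<in> borel_measurable (X n)" if "j < n" for j
      using measurable_Rn_component[OF that] by (simp add: measurable_cong_sets[OF sets_X refl])
    thus ?thesis by (intro borel_measurable_times borel_measurable_prod borel_measurable_power) auto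
  qed
  have int: "integrable (X n) (\<lambda>x. \<integral>y. ?h (?F x y) \<partial>?Q)"
    using XQ.integrable_fst'[OF I2] by simp
  have "(\<integral>y. likelihood_ratio \<gamma> \<beta> X n y * ?h y \<partial>?Q) = (\<integral>y. ?h y \<partial>?P)"
    unfolding likelihood_ratio_def by (rule Q.RN_deriv_integral[OF RN, symmetric])
  also have "\<dots> = (\<integral>z. ?h (?F (fst z) (snd z)) \<partial>(X n \<Otimes>\<^sub>M ?Q))"
    unfolding P by (subst integral_distr[OF F h]) (simp add: case_prod_unfold)
  also have "\<dots> = (\<integral>x. \<integral>y. ?h (?F x y) \<partial>?Q \<partial>X n)"
    using XQ.integral_fst'[OF I2] by simp
  finally have "has_bochner_integral (X n) (\<lambda>x. \<integral>y. ?h (?F x y) \<partial>?Q)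
       (\<integral>y. likelihood_ratio \<gamma> \<beta> X n y * ?h y \<partial>?Q)"
    using int by (simp add: has_bochner_integral_iff)
  thus "has_bochner_integral (X n) (\<lambda>x. wick_prod \<beta> N n \<alpha> * spike_monomial N n \<alpha> x)
       (\<integral>y. likelihood_ratio \<gamma> \<beta> X n y * ?h y \<partial>?Q)"
    using int by (subst has_bochner_integral_cong_AE[OF meas _ eq]) auto
qed

lemma
  fixes \<gamma> n defines "N \<equiv> num_samples \<gamma> n"
  assumes X: "prob_space (X n)" and sets_X: "sets (X n) = sets (Rn n)"
    and good: "AE x in X n. \<beta> * sqnorm n x > -1"
  shows low_degree_norm_infinite:
      "\<not> (\<forall>\<alpha>\<in>exponents N n D. integrable (X n \<Otimes>\<^sub>M wishart_null \<gamma> n)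
           (planted_hermite \<beta> N n \<alpha>)) \<Longrightarrow>
       low_degree_norm \<gamma> \<beta> X D n = \<infinity>"
    and low_degree_norm_eq_hermite_sum:
      "(\<forall>\<alpha>\<in>exponents N n D. integrable (X n \<Otimes>\<^sub>M wishart_null \<gamma> n)
           (planted_hermite \<beta> N n \<alpha>)) \<Longrightarrow>
       low_degree_norm \<gamma> \<beta> X D n = ennreal (sqrt (\<Sum>\<alpha>\<in>exponents N n D.
         (\<integral>x. wick_prod \<beta> N n \<alpha> * spike_monomial N n \<alpha> x \<partial>X n)\<^sup>2
           / multi_fact N n \<alpha>))"
proof -
  let ?Q = "wishart_null \<gamma> n" and ?L = "likelihood_ratio \<gamma> \<beta> X n"
  let ?I = "\<lambda>\<alpha>. integrable (X n \<Otimes>\<^sub>M ?Q) (planted_hermite \<beta> N n \<alpha>)"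
  have int: "integrable ?Q (\<lambda>y. hermite_prod N n \<alpha> y * hermite_prod N n \<alpha>' y)" for \<alpha> \<alpha>'
    unfolding N_def
    by (intro all_moments_integrable all_moments_mult all_moments_wishart_null_hermite_prod)
  have orth: "(\<integral>y. hermite_prod N n \<alpha> y * hermite_prod N n \<alpha>' y \<partial>?Q)
      = (if \<alpha> = \<alpha>' then multi_fact N n \<alpha> else 0)"
    if "\<alpha> \<in> exponents N n D" "\<alpha>' \<in> exponents N n D" for \<alpha> \<alpha>'
    using that unfolding N_def by (intro wishart_null_hermite_orthogonal) (auto simp: exponents_def)
  have pos: "multi_fact N n \<alpha> > (0::real)" for \<alpha> by (intro prod_pos) auto
  note * = finite_exponents[of N n D] polys_upto_eq_hermite_span[of N n D] int orth pos
  have iff: "(\<forall>\<alpha>\<in>exponents N n D. integrable ?Q (\<lambda>y. ?L y * hermite_prod N n \<alpha> y)) \<longleftrightarrow> (\<forall>\<alpha>\<in>exponents N n D. ?I \<alpha>)"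
    unfolding N_def using likelihood_ratio_hermite_integrable[of X n, OF X sets_X good] by blast
  show "low_degree_norm \<gamma> \<beta> X D n = \<infinity>" if "\<not> (\<forall>\<alpha>\<in>exponents N n D. ?I \<alpha>)"
    using that proj_norm_orthogonal_infinite[OF *, of ?L] unfolding low_degree_norm_def N_def[symmetric] iff by blast
  assume I: "\<forall>\<alpha>\<in>exponents N n D. ?I \<alpha>"
  have "low_degree_norm \<gamma> \<beta> X D n = ennreal (sqrt (\<Sum>\<alpha>\<in>exponents N n D.
      (\<integral>y. ?L y * hermite_prod N n \<alpha> y \<partial>?Q)\<^sup>2 / multi_fact N n \<alpha>))"
    using I proj_norm_orthogonal[OF *, of ?L] unfolding low_degree_norm_def N_def[symmetric] iff by blast
  also have "(\<Sum>\<alpha>\<in>exponents N n D. (\<integral>y. ?L y * hermite_prod N n \<alpha> y \<partial>?Q)\<^sup>2 / multi_fact N n \<alpha>)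
     = (\<Sum>\<alpha>\<in>exponents N n D.
         (\<integral>x. wick_prod \<beta> N n \<alpha> * spike_monomial N n \<alpha> x \<partial>X n)\<^sup>2
           / multi_fact N n \<alpha>)"
    using I likelihood_ratio_hermite_integral[of X n, OF X sets_X good, of \<gamma>]
    by (intro sum.cong refl) (simp add: has_bochner_integral_iff N_def)
  finally show "low_degree_norm \<gamma> \<beta> X D n = ennreal (sqrt (\<Sum>\<alpha>\<in>exponents N n D.
         (\<integral>x. wick_prod \<beta> N n \<alpha> * spike_monomial N n \<alpha> x \<partial>X n)\<^sup>2
           / multi_fact N n \<alpha>))" .
qed

section \<open>Replicas\<close>

text \<open>Lets a squared expectation be written as a single expectation over two independent
  draws, under which sums over exponents can be evaluated pointwise.\<close>

lemma
  fixes f g :: "_ \<Rightarrow> real"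
  assumes X: "prob_space X" and f: "integrable X f" and g: "integrable X g"
  shows integrable_replica_mult: "integrable (X \<Otimes>\<^sub>M X) (\<lambda>z. f (fst z) * g (snd z))"
    and integral_replica_mult: "(\<integral>z. f (fst z) * g (snd z) \<partial>(X \<Otimes>\<^sub>M X)) = (\<integral>x. f x \<partial>X) * (\<integral>x. g x \<partial>X)"
proof -
  interpret X: prob_space X by fact
  interpret XX: pair_prob_space X X ..
  have [measurable]: "f \<in> borel_measurable X" "g \<in> borel_measurable X" using f g by auto
  show int: "integrable (X \<Otimes>\<^sub>M X) (\<lambda>z. f (fst z) * g (snd z))"
  proof (rule XX.Fubini_integrable)
    show "(\<lambda>z. f (fst z) * g (snd z)) \<in> borel_measurable (X \<Otimes>\<^sub>M X)" by measurable
    show "integrable X (\<lambda>x. \<integral>y. norm (f (fst (x, y)) * g (snd (x, y))) \<partial>X)"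
      using f by (simp add: abs_mult)
    show "AE x in X. integrable X (\<lambda>y. f (fst (x, y)) * g (snd (x, y)))" using g by simp
  qed
  show "(\<integral>z. f (fst z) * g (snd z) \<partial>(X \<Otimes>\<^sub>M X)) = (\<integral>x. f x \<partial>X) * (\<integral>x. g x \<partial>X)"
    using XX.integral_fst'[OF int] by simp
qed

definition overlap :: "nat \<Rightarrow> (nat \<Rightarrow> real) \<times> (nat \<Rightarrow> real) \<Rightarrow> real" where
  "overlap n z = (\<Sum>j<n. fst z j * snd z j)"

text \<open>The multinomial theorem inside the expectation. The right-hand side is a sum of squares
  with positive weights, so a lower bound on the moment may keep any convenient part of it.\<close>

lemma overlap_moment:
  assumes X: "prob_space X"
    and int: "\<And>a. a \<in> compositions n m \<Longrightarrow> integrable X (\<lambda>x. \<Prod>j<n. x j ^ a j)"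
  shows "(\<integral>z. overlap n z ^ m \<partial>(X \<Otimes>\<^sub>M X))
     = fact m * (\<Sum>a\<in>compositions n m. (\<integral>x. (\<Prod>j<n. x j ^ a j) \<partial>X)\<^sup>2 / (\<Prod>j<n. fact (a j)))"
proof -
  let ?m = "\<lambda>a x. \<Prod>j<n. x j ^ a j :: real"
  have "overlap n z ^ m = (\<Sum>a\<in>compositions n m. (fact m / (\<Prod>j<n. fact (a j))) * (?m a (fst z) * ?m a (snd z)))" for z
  proof -
    have "overlap n z ^ m = fact m * (\<Sum>a\<in>compositions n m. \<Prod>j<n. (fst z j * snd z j) ^ a j / fact (a j))"
      by (simp add: multinomial_compositions overlap_def)
    thus ?thesis by (simp add: sum_distrib_left prod_dividef power_mult_distrib prod.distrib)
  qed
  hence "(\<integral>z. overlap n z ^ m \<partial>(X \<Otimes>\<^sub>M X))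
     = (\<integral>z. (\<Sum>a\<in>compositions n m. (fact m / (\<Prod>j<n. fact (a j))) * (?m a (fst z) * ?m a (snd z))) \<partial>(X \<Otimes>\<^sub>M X))"
    by (simp only:)
  also have "\<dots> = (\<Sum>a\<in>compositions n m. \<integral>z. (fact m / (\<Prod>j<n. fact (a j))) * (?m a (fst z) * ?m a (snd z)) \<partial>(X \<Otimes>\<^sub>M X))"
    using int X by (intro Bochner_Integration.integral_sum integrable_mult_right integrable_replica_mult[of X "?m a" "?m a" for a])
  also have "\<dots> = (\<Sum>a\<in>compositions n m. (fact m / (\<Prod>j<n. fact (a j))) * (\<integral>x. ?m a x \<partial>X)\<^sup>2)"
    using int X integral_replica_mult[of X "?m a" "?m a" for a]
    by (intro sum.cong refl) (simp only: integral_mult_right_zero power2_eq_square)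
  finally show ?thesis by (simp add: sum_distrib_left)
qed

definition wick_weight :: "real \<Rightarrow> nat \<Rightarrow> real" where
  "wick_weight \<beta> d = (wick \<beta> d)\<^sup>2 / fact d"

abbreviation row_weight :: "real \<Rightarrow> nat \<Rightarrow> (nat \<Rightarrow> nat) \<Rightarrow> real" where
  "row_weight \<beta> N d \<equiv> (\<Prod>i<N. wick_weight \<beta> (d i))"

abbreviation overlap_mean :: "nat \<Rightarrow> (nat \<Rightarrow> real) measure \<Rightarrow> nat \<Rightarrow> real" where
  "overlap_mean n X m \<equiv> (\<integral>z. overlap n z ^ m \<partial>(X \<Otimes>\<^sub>M X))"

definition row_degrees :: "nat \<Rightarrow> nat \<Rightarrow> (nat \<Rightarrow> nat) set" where
  "row_degrees N D = {d \<in> {..<N} \<rightarrow>\<^sub>E UNIV. (\<Sum>i<N. d i) \<le> D}"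

lemma row_degrees_eq_UN: "row_degrees N D = (\<Union>m\<le>D. compositions N m)"
  by (auto simp: row_degrees_def compositions_def)

lemma finite_row_degrees: "finite (row_degrees N D)"
  by (simp add: row_degrees_eq_UN finite_compositions)

text \<open>With the degree of each row prescribed, the rows can be chosen independently. This
  product structure is what allows the sum over exponents to factor over the samples.\<close>

lemma exponents_with_row_degrees:
  assumes "d \<in> row_degrees N D"
  shows "{\<alpha> \<in> exponents N n D. (\<lambda>i\<in>{..<N}. \<Sum>j<n. \<alpha> i j) = d} = PiE {..<N} (\<lambda>i. compositions n (d i))"
proof (intro equalityI subsetI)
  fix \<alpha> assume "\<alpha> \<in> {\<alpha> \<in> exponents N n D. (\<lambda>i\<in>{..<N}. \<Sum>j<n. \<alpha> i j) = d}"
  thus "\<alpha> \<in> PiE {..<N} (\<lambda>i. compositions n (d i))"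
    by (auto simp: exponents_def compositions_def PiE_iff)
next
  fix \<alpha> assume \<alpha>: "\<alpha> \<in> PiE {..<N} (\<lambda>i. compositions n (d i))"
  hence row: "(\<Sum>j<n. \<alpha> i j) = d i" if "i < N" for i using that by (auto simp: compositions_def)
  hence "(\<Sum>i<N. \<Sum>j<n. \<alpha> i j) = (\<Sum>i<N. d i)" by (intro sum.cong) auto
  moreover have "(\<lambda>i\<in>{..<N}. \<Sum>j<n. \<alpha> i j) = d"
    using assms row by (auto simp: row_degrees_def PiE_iff extensional_def fun_eq_iff)
  ultimately show "\<alpha> \<in> {\<alpha> \<in> exponents N n D. (\<lambda>i\<in>{..<N}. \<Sum>j<n. \<alpha> i j) = d}"
    using \<alpha> assms by (auto simp: exponents_def row_degrees_def compositions_def PiE_iff)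
qed

text \<open>Exponents are grouped by their row degrees, on which alone the Wick factors depend.
  Within a group the monomials of the two replicas combine to powers of x_j x'_j, and the
  multinomial theorem in row i sums them to the overlap to the power d_i over d_i factorial.\<close>

lemma hermite_sum_eq_overlap_sum:
  assumes X: "prob_space X"
    and int: "\<And>\<alpha>. \<alpha> \<in> exponents N n D \<Longrightarrow>
      integrable X (\<lambda>x. wick_prod \<beta> N n \<alpha> * spike_monomial N n \<alpha> x)"
  shows "(\<Sum>\<alpha>\<in>exponents N n D.
         (\<integral>x. wick_prod \<beta> N n \<alpha> * spike_monomial N n \<alpha> x \<partial>X)\<^sup>2
           / multi_fact N n \<alpha>)
     = (\<Sum>d\<in>row_degrees N D. row_weight \<beta> N d * overlap_mean n X (\<Sum>i<N. d i))"
proof -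
  let ?row = "\<lambda>\<alpha>. (\<lambda>i\<in>{..<N}. \<Sum>j<n. \<alpha> i j) :: nat \<Rightarrow> nat"
  let ?m = "\<lambda>\<alpha> x. \<Prod>i<N. \<Prod>j<n. x j ^ \<alpha> i j :: real"
  let ?W = "\<lambda>\<alpha>. \<Prod>i<N. wick \<beta> (\<Sum>j<n. \<alpha> i j)"
  let ?T = "\<lambda>\<alpha>. (\<integral>x. ?W \<alpha> * ?m \<alpha> x \<partial>X)\<^sup>2 / multi_fact N n \<alpha>"
  have "(\<Sum>\<alpha>\<in>exponents N n D. ?T \<alpha>) = (\<Sum>d\<in>row_degrees N D. \<Sum>\<alpha>\<in>{\<alpha> \<in> exponents N n D. ?row \<alpha> = d}. ?T \<alpha>)"
    by (rule sum.group[OF finite_exponents finite_row_degrees, symmetric])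
       (auto simp: exponents_def row_degrees_def)
  also have "\<dots> = (\<Sum>d\<in>row_degrees N D. row_weight \<beta> N d * overlap_mean n X (\<Sum>i<N. d i))"
  proof (intro sum.cong refl)
    fix d assume d: "d \<in> row_degrees N D"
    let ?A = "PiE {..<N} (\<lambda>i. compositions n (d i))"
    have A: "{\<alpha> \<in> exponents N n D. ?row \<alpha> = d} = ?A" by (rule exponents_with_row_degrees[OF d])
    have AE: "\<alpha> \<in> exponents N n D" if "\<alpha> \<in> ?A" for \<alpha> using that A by blast
    define w where "w = (\<Prod>i<N. wick \<beta> (d i))"
    have W: "?W \<alpha> = w" if "\<alpha> \<in> ?A" for \<alpha>
      unfolding w_def using that by (intro prod.cong) (auto simp: compositions_def PiE_iff)
    have ww: "row_weight \<beta> N d = w\<^sup>2 / (\<Prod>i<N. fact (d i))"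
      by (simp add: wick_weight_def w_def prod_dividef prod_power_distrib)
    have "(\<Sum>\<alpha>\<in>?A. ?T \<alpha>) = w\<^sup>2 / (\<Prod>i<N. fact (d i)) * overlap_mean n X (\<Sum>i<N. d i)"
    proof (cases "w = 0")
      case True
      have "(\<Sum>\<alpha>\<in>?A. ?T \<alpha>) = (\<Sum>\<alpha>\<in>?A. 0)"
        by (intro sum.cong refl) (simp only: W True, simp)
      thus ?thesis using True by simp
    next
      case False
      have intm: "integrable X (?m \<alpha>)" if "\<alpha> \<in> ?A" for \<alpha>
        using int[OF AE[OF that]] W[OF that] False by simp
      have "(\<Sum>\<alpha>\<in>?A. ?T \<alpha>) = (\<Sum>\<alpha>\<in>?A. w\<^sup>2 * (1 / multi_fact N n \<alpha> * (\<integral>z. ?m \<alpha> (fst z) * ?m \<alpha> (snd z) \<partial>(X \<Otimes>\<^sub>M X))))"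
      proof (intro sum.cong refl)
        fix \<alpha> assume \<alpha>: "\<alpha> \<in> ?A"
        have "(\<integral>z. ?m \<alpha> (fst z) * ?m \<alpha> (snd z) \<partial>(X \<Otimes>\<^sub>M X)) = (\<integral>x. ?m \<alpha> x \<partial>X)\<^sup>2"
          using integral_replica_mult[OF X intm[OF \<alpha>] intm[OF \<alpha>]] by (simp only: power2_eq_square)
        moreover have "(\<integral>x. ?W \<alpha> * ?m \<alpha> x \<partial>X) = w * (\<integral>x. ?m \<alpha> x \<partial>X)"
          by (simp only: W[OF \<alpha>] integral_mult_right_zero)
        ultimately show "?T \<alpha> = w\<^sup>2 * (1 / multi_fact N n \<alpha> * (\<integral>z. ?m \<alpha> (fst z) * ?m \<alpha> (snd z) \<partial>(X \<Otimes>\<^sub>M X)))"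
          by (simp only: power_mult_distrib) simp
      qed
      also have "\<dots> = w\<^sup>2 * (\<Sum>\<alpha>\<in>?A. \<integral>z. 1 / multi_fact N n \<alpha> * (?m \<alpha> (fst z) * ?m \<alpha> (snd z)) \<partial>(X \<Otimes>\<^sub>M X))"
        by (simp only: sum_distrib_left integral_mult_right_zero)
      also have "(\<Sum>\<alpha>\<in>?A. \<integral>z. 1 / multi_fact N n \<alpha> * (?m \<alpha> (fst z) * ?m \<alpha> (snd z)) \<partial>(X \<Otimes>\<^sub>M X))
          = (\<integral>z. (\<Sum>\<alpha>\<in>?A. 1 / multi_fact N n \<alpha> * (?m \<alpha> (fst z) * ?m \<alpha> (snd z))) \<partial>(X \<Otimes>\<^sub>M X))"
        by (intro Bochner_Integration.integral_sum[symmetric] integrable_mult_right integrable_replica_mult[OF X intm intm])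
      also have "(\<lambda>z. \<Sum>\<alpha>\<in>?A. 1 / multi_fact N n \<alpha> * (?m \<alpha> (fst z) * ?m \<alpha> (snd z)))
          = (\<lambda>z. overlap n z ^ (\<Sum>i<N. d i) * (1 / (\<Prod>i<N. fact (d i))))"
      proof
        fix z
        have "(\<Sum>\<alpha>\<in>?A. 1 / multi_fact N n \<alpha> * (?m \<alpha> (fst z) * ?m \<alpha> (snd z)))
            = (\<Sum>\<alpha>\<in>?A. \<Prod>i<N. \<Prod>j<n. (fst z j * snd z j) ^ \<alpha> i j / fact (\<alpha> i j))"
          by (simp add: prod_dividef power_mult_distrib prod.distrib)
        also have "\<dots> = (\<Prod>i<N. \<Sum>a\<in>compositions n (d i). \<Prod>j<n. (fst z j * snd z j) ^ a j / fact (a j))"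
          by (rule prod_sum_PiE[symmetric]) (auto simp: finite_compositions)
        also have "\<dots> = (\<Prod>i<N. overlap n z ^ d i / fact (d i))"
          by (simp add: multinomial_compositions overlap_def)
        also have "\<dots> = overlap n z ^ (\<Sum>i<N. d i) * (1 / (\<Prod>i<N. fact (d i)))"
          by (simp add: prod_dividef power_sum)
        finally show "(\<Sum>\<alpha>\<in>?A. 1 / multi_fact N n \<alpha> * (?m \<alpha> (fst z) * ?m \<alpha> (snd z)))
            = overlap n z ^ (\<Sum>i<N. d i) * (1 / (\<Prod>i<N. fact (d i)))" .
      qed
      finally show ?thesis by (simp only: integral_mult_left_zero) simp
    qed
    thus "(\<Sum>\<alpha>\<in>{\<alpha> \<in> exponents N n D. ?row \<alpha> = d}. ?T \<alpha>)
       = row_weight \<beta> N d * overlap_mean n X (\<Sum>i<N. d i)"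
      by (simp only: A ww)
  qed
  finally show ?thesis .
qed

section \<open>The lower bound\<close>

lemma wick_odd: "odd d \<Longrightarrow> wick \<beta> d = 0"
  by (induction \<beta> d rule: wick.induct) auto

lemma wick_even_nonzero: "\<beta> \<noteq> 0 \<Longrightarrow> even d \<Longrightarrow> wick \<beta> d \<noteq> 0"
  by (induction \<beta> d rule: wick.induct) (auto simp del: of_nat_Suc)

lemma wick_weight_nonneg: "wick_weight \<beta> d \<ge> 0"
  by (simp add: wick_weight_def)

text \<open>An odd total degree forces some row of odd degree, whose weight is 0; an even power of
  the overlap is nonnegative. Hence any set of terms may be dropped in a lower bound.\<close>

lemma overlap_term_nonneg:
  fixes N :: nat
  shows "row_weight \<beta> N d * overlap_mean n X (\<Sum>i<N. d i) \<ge> 0"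
proof (cases "even (\<Sum>i<N. d i)")
  case True
  thus ?thesis
    by (intro mult_nonneg_nonneg prod_nonneg Bochner_Integration.integral_nonneg)
       (auto simp: wick_weight_nonneg zero_le_even_power)
next
  case False
  then obtain i where "i < N" "odd (d i)" by (metis dvd_sum lessThan_iff)
  hence "row_weight \<beta> N d = 0" 
    by (intro prod_zero) (auto intro!: bexI[of _ i] simp: wick_weight_def wick_odd)
  thus ?thesis by (simp only: mult_zero_left order_refl)
qed

text \<open>For these exponents the moment of an iid vector involves only the second moment of the
  entries, so it can be computed without knowing any higher moment of \<pi>.\<close>

definition twos :: "nat \<Rightarrow> nat set \<Rightarrow> nat \<Rightarrow> nat" where
  "twos n K = (\<lambda>j\<in>{..<n}. if j \<in> K then 2 else 0)"

lemma twos_compositions: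
  assumes "K \<subseteq> {..<n}" "card K = k" shows "twos n K \<in> compositions n (2 * k)"
proof -
  have "(\<Sum>j<n. twos n K j) = (\<Sum>j\<in>K. 2)"
    using assms by (intro sum.mono_neutral_cong_right) (auto simp: twos_def)
  thus ?thesis using assms by (auto simp: compositions_def twos_def)
qed

lemma prod_twos:
  fixes f :: "nat \<Rightarrow> nat \<Rightarrow> 'a::comm_monoid_mult"
  assumes "K \<subseteq> {..<n}" "\<And>j. f j 0 = 1"
  shows "(\<Prod>j<n. f j (twos n K j)) = (\<Prod>j\<in>K. f j 2)"
  using assms by (intro prod.mono_neutral_cong_right) (auto simp: twos_def)

text \<open>Each k-subset gives a different composition, hence the binomial coefficient. The bound
  serves twice: for the coordinates of the spike and for the samples.\<close>

lemma sum_compositions_ge_twos: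
  fixes F :: "(nat \<Rightarrow> nat) \<Rightarrow> real"
  assumes "\<And>a. a \<in> compositions n (2 * k) \<Longrightarrow> F a \<ge> 0"
    and "\<And>K. K \<subseteq> {..<n} \<Longrightarrow> card K = k \<Longrightarrow> F (twos n K) = v"
  shows "(\<Sum>a\<in>compositions n (2 * k). F a) \<ge> real (n choose k) * v"
proof -
  let ?S = "{K. K \<subseteq> {..<n} \<and> card K = k}"
  have inj: "inj_on (twos n) ?S"
  proof (rule inj_onI)
    fix K K' assume K: "K \<in> ?S" "K' \<in> ?S" "twos n K = twos n K'"
    have "j \<in> K \<longleftrightarrow> j \<in> K'" if "j < n" for j
      using fun_cong[OF K(3), of j] that by (auto simp: twos_def split: if_splits)
    thus "K = K'" using K by auto
  qed
  have "real (n choose k) * v = (\<Sum>K\<in>?S. F (twos n K))"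
    using n_subsets[of "{..<n}" k] assms(2) by simp
  also have "\<dots> = (\<Sum>a\<in>twos n ` ?S. F a)" by (simp add: sum.reindex[OF inj])
  also have "\<dots> \<le> (\<Sum>a\<in>compositions n (2 * k). F a)"
    using assms(1) by (intro sum_mono2 finite_compositions) (auto intro: twos_compositions)
  finally show ?thesis .
qed

section \<open>Second moments of the iid prior\<close>

lemma prob_space_standardized: "standardized \<pi> \<Longrightarrow> prob_space \<pi>"
  by (simp add: standardized_def real_distribution_def)

lemma sets_standardized: "standardized \<pi> \<Longrightarrow> sets \<pi> = sets borel"
  by (simp add: standardized_def real_distribution_def real_distribution_axioms_def)

lemma measurable_standardized: "standardized \<pi> \<Longrightarrow> f \<in> borel_measurable borel \<Longrightarrow> f \<in> borel_measurable \<pi>"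
  using measurable_cong_sets[OF sets_standardized refl] by blast

lemma prob_space_iid_prior:
  assumes "standardized \<pi>" shows "prob_space (iid_prior \<pi> n)"
proof -
  have "prob_space (distr \<pi> borel (\<lambda>t. t / sqrt (real n)))"
    by (rule prob_space.prob_space_distr[OF prob_space_standardized[OF assms] measurable_standardized[OF assms]]) simp
  thus ?thesis unfolding iid_prior_def by (intro prob_space_PiM)
qed

lemma sets_iid_prior: "sets (iid_prior \<pi> n) = sets (Rn n)"
  unfolding iid_prior_def by (intro sets_PiM_cong) auto

lemma iid_prior_twos_moment:
  assumes \<pi>: "standardized \<pi>" and K: "K \<subseteq> {..<n}" "card K = k" and n: "n > 0"
  shows "(\<integral>x. (\<Prod>j<n. x j ^ twos n K j) \<partial>iid_prior \<pi> n) = (1 / real n) ^ k"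
proof -
  let ?\<mu> = "distr \<pi> borel (\<lambda>t. t / sqrt (real n))"
  have meas: "(\<lambda>t. t / sqrt (real n)) \<in> borel_measurable \<pi>"
    by (rule measurable_standardized[OF \<pi>]) simp
  interpret \<mu>: prob_space ?\<mu>
    by (rule prob_space.prob_space_distr[OF prob_space_standardized[OF \<pi>] meas])
  interpret product_prob_space "\<lambda>_::nat. ?\<mu>" "{..<n}" ..
  have sq: "has_bochner_integral \<pi> (\<lambda>t. (t / sqrt (real n))\<^sup>2) (1 / real n)"
  proof -
    have "has_bochner_integral \<pi> (\<lambda>t. t\<^sup>2) 1" using \<pi> by (simp add: standardized_def)
    from has_bochner_integral_divide_zero[OF this, of "real n"] show ?thesis
      by (simp add: power_divide)
  qed
  have int2: "integrable ?\<mu> (\<lambda>t. t\<^sup>2)" "(\<integral>t. t\<^sup>2 \<partial>?\<mu>) = 1 / real n"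
    using sq by (simp_all add: integrable_distr_eq[OF meas] integral_distr[OF meas] has_bochner_integral_iff)
  have "integrable ?\<mu> (\<lambda>t. t ^ twos n K j)" if "j < n" for j
    using that int2 by (auto simp: twos_def)
  hence "(\<integral>x. (\<Prod>j<n. x j ^ twos n K j) \<partial>iid_prior \<pi> n) = (\<Prod>j<n. \<integral>t. t ^ twos n K j \<partial>?\<mu>)"
    unfolding iid_prior_def using product_integral_prod[of "{..<n}" "\<lambda>j t. t ^ twos n K j"] by simp
  also have "\<dots> = (\<Prod>j\<in>K. \<integral>t. t ^ 2 \<partial>?\<mu>)"
    using \<mu>.prob_space by (intro prod_twos[OF K(1), of "\<lambda>j m. \<integral>t. t ^ m \<partial>?\<mu>"]) simp
  finally show ?thesis using K int2 by simp
qed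

text \<open>If some Hermite product is not integrable, the norm is infinite and there is nothing to
  show. Otherwise the selection of exponents 0 and 2 is made once in the overlap moment, where the
  factorials give 2^(-k), and once in the row degrees, where each chosen row has weight \<beta>^2 /
  2.\<close>

lemma low_degree_norm_iid_ge:
  fixes \<gamma> n defines "N \<equiv> num_samples \<gamma> n"
  assumes \<pi>: "standardized \<pi>" and good: "AE x in iid_prior \<pi> n. \<beta> * sqnorm n x > -1"
    and \<beta>: "\<beta> \<noteq> 0" and n: "n > 0" and N: "N > 0" and kD: "2 * k \<le> D"
  shows "low_degree_norm \<gamma> \<beta> (iid_prior \<pi>) D n \<ge> ennreal (sqrt (
           real (N choose k) * (\<beta>\<^sup>2 / 2) ^ k * (fact (2 * k) * (real (n choose k) * ((1 / real n) ^ (2 * k) / 2 ^ k)))))"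
proof (cases "\<forall>\<alpha>\<in>exponents N n D. integrable (iid_prior \<pi> n \<Otimes>\<^sub>M wishart_null \<gamma> n)
           (planted_hermite \<beta> N n \<alpha>)")
  case False
  thus ?thesis
    using low_degree_norm_infinite[of "iid_prior \<pi>" n, OF prob_space_iid_prior[OF \<pi>] sets_iid_prior good]
    by (simp add: N_def)
next
  case True
  let ?X = "iid_prior \<pi> n"
  note P = prob_space_iid_prior[OF \<pi>, of n] sets_iid_prior[of \<pi> n] good
  let ?W = "\<lambda>\<alpha>. \<Prod>i<N. wick \<beta> (\<Sum>j<n. \<alpha> i j)"
  let ?m = "\<lambda>\<alpha> x. \<Prod>i<N. \<Prod>j<n. x j ^ \<alpha> i j :: real"
  let ?r = "\<integral>z. overlap n z ^ (2 * k) \<partial>(?X \<Otimes>\<^sub>M ?X)"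
  have int: "integrable ?X (\<lambda>x. ?W \<alpha> * ?m \<alpha> x)" if "\<alpha> \<in> exponents N n D" for \<alpha>
    using likelihood_ratio_hermite_integral[of "iid_prior \<pi>" n, OF P, of \<gamma> \<alpha>] True that
    by (simp add: N_def has_bochner_integral_iff)
  have intm: "integrable ?X (\<lambda>x. \<Prod>j<n. x j ^ a j)" if a: "a \<in> compositions n (2 * k)" for a
  proof -
    \<comment> \<open>Integrability is only known for monomials times their Wick factor. Putting all
      of \<open>a\<close> into row 0 gives the factor \<open>wick \<beta> (2 * k)\<close>, which is
      nonzero because the degree is even and \<beta> is nonzero.\<close>
    define \<alpha> where "\<alpha> = (\<lambda>i\<in>{..<N}. if i = 0 then a else (\<lambda>j\<in>{..<n}. 0))"
    have 0: "{..<N} = insert 0 {0<..<N}" using N by auto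
    have "(\<Sum>i<N. \<Sum>j<n. \<alpha> i j) = (\<Sum>j<n. a j)"
      unfolding 0 using N by (simp add: \<alpha>_def)
    hence "\<alpha> \<in> exponents N n D"
      using a kD by (auto simp: exponents_def \<alpha>_def compositions_def)
    from int[OF this] have "integrable ?X (\<lambda>x. ?W \<alpha> * ?m \<alpha> x)" .
    moreover have "?W \<alpha> = wick \<beta> (2 * k)"
      unfolding 0 using N a by (simp add: \<alpha>_def compositions_def)
    moreover have "?m \<alpha> x = (\<Prod>j<n. x j ^ a j)" for x
      unfolding 0 using N by (simp add: \<alpha>_def)
    ultimately show ?thesis using wick_even_nonzero[OF \<beta>, of "2 * k"] by simp
  qed
  have "?r = fact (2 * k) * (\<Sum>a\<in>compositions n (2 * k). (\<integral>x. (\<Prod>j<n. x j ^ a j) \<partial>?X)\<^sup>2 / (\<Prod>j<n. fact (a j)))"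
    by (rule overlap_moment[OF P(1) intm])
  also have "\<dots> \<ge> fact (2 * k) * (real (n choose k) * ((1 / real n) ^ (2 * k) / 2 ^ k))"
  proof (intro mult_left_mono sum_compositions_ge_twos)
    fix K assume K: "K \<subseteq> {..<n}" "card K = k"
    have "(\<Prod>j<n. fact (twos n K j)) = (2 ^ k :: real)"
      using prod_twos[OF K(1), of "\<lambda>_. fact"] K by simp
    thus "(\<integral>x. (\<Prod>j<n. x j ^ twos n K j) \<partial>?X)\<^sup>2 / (\<Prod>j<n. fact (twos n K j)) = (1 / real n) ^ (2 * k) / 2 ^ k"
      using iid_prior_twos_moment[OF \<pi> K n] by (simp only: power_mult[symmetric] mult.commute)
  qed (auto intro!: divide_nonneg_nonneg prod_nonneg)
  finally have r: "fact (2 * k) * (real (n choose k) * ((1 / real n) ^ (2 * k) / 2 ^ k)) \<le> ?r" .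
  have r0: "?r \<ge> 0" by (intro Bochner_Integration.integral_nonneg) (simp add: zero_le_even_power)
  let ?T = "\<lambda>d. row_weight \<beta> N d * overlap_mean n ?X (\<Sum>i<N. d i)"
  have "real (N choose k) * (\<beta>\<^sup>2 / 2) ^ k * (fact (2 * k) * (real (n choose k) * ((1 / real n) ^ (2 * k) / 2 ^ k)))
      \<le> real (N choose k) * (\<beta>\<^sup>2 / 2) ^ k * ?r"
    by (intro mult_left_mono r) auto
  also have "\<dots> = real (N choose k) * ((\<beta>\<^sup>2 / 2) ^ k * ?r)" by (simp only: mult.assoc)
  also have "\<dots> \<le> (\<Sum>d\<in>compositions N (2 * k). ?T d)"
  proof (intro sum_compositions_ge_twos overlap_term_nonneg)
    fix K assume K: "K \<subseteq> {..<N}" "card K = k"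
    have "(\<Prod>i<N. wick_weight \<beta> (twos N K i)) = (\<beta>\<^sup>2 / 2) ^ k"
      using prod_twos[OF K(1), of "\<lambda>_. wick_weight \<beta>"] K by (simp add: wick_weight_def numeral_2_eq_2)
    moreover have "(\<Sum>i<N. twos N K i) = 2 * k" using twos_compositions[OF K] by (simp add: compositions_def)
    ultimately show "?T (twos N K) = (\<beta>\<^sup>2 / 2) ^ k * ?r" by (simp only:)
  qed
  also have "\<dots> \<le> (\<Sum>d\<in>row_degrees N D. ?T d)"
    using kD by (intro sum_mono2 finite_row_degrees overlap_term_nonneg) (auto simp: row_degrees_eq_UN)
  also have "\<dots> = (\<Sum>\<alpha>\<in>exponents N n D. (\<integral>x. ?W \<alpha> * ?m \<alpha> x \<partial>?X)\<^sup>2 / multi_fact N n \<alpha>)"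
    by (rule hermite_sum_eq_overlap_sum[OF P(1) int, symmetric])
  finally show ?thesis
    using low_degree_norm_eq_hermite_sum[of "iid_prior \<pi>" n, OF P, of \<gamma> D] True
    by (simp add: N_def ennreal_leI real_sqrt_le_mono)
qed

section \<open>Growth of the number of samples and of binomial coefficients\<close>

lemma num_samples_bounds:
  assumes "\<gamma> > 0"
  shows "real n / \<gamma> \<le> real (num_samples \<gamma> n)" "real (num_samples \<gamma> n) \<le> real n / \<gamma> + 1"
proof -
  have "real n / \<gamma> \<ge> 0" using assms by simp
  hence "real (num_samples \<gamma> n) = real_of_int \<lceil>real n / \<gamma>\<rceil>" by (simp add: num_samples_def)
  thus "real n / \<gamma> \<le> real (num_samples \<gamma> n)" "real (num_samples \<gamma> n) \<le> real n / \<gamma> + 1" by linarith+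
qed

lemma num_samples_ratio_tendsto:
  assumes "\<gamma> > 0" shows "(\<lambda>n. real (num_samples \<gamma> n) / real n) \<longlonglongrightarrow> 1 / \<gamma>"
proof (rule tendsto_sandwich)
  show "\<forall>\<^sub>F n in sequentially. 1 / \<gamma> \<le> real (num_samples \<gamma> n) / real n"
    using eventually_gt_at_top[of 0]
    by eventually_elim (use num_samples_bounds(1)[OF assms] in \<open>simp add: field_simps\<close>)
  show "\<forall>\<^sub>F n in sequentially. real (num_samples \<gamma> n) / real n \<le> 1 / \<gamma> + 1 / real n"
    using eventually_gt_at_top[of 0]
  proof eventually_elim
    case (elim n)
    have "real (num_samples \<gamma> n) / real n \<le> (real n / \<gamma> + 1) / real n"
      using num_samples_bounds(2)[OF assms] by (intro divide_right_mono) auto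
    thus ?case using elim by (simp add: add_divide_distrib)
  qed
  show "(\<lambda>n. 1 / \<gamma> + 1 / real n) \<longlonglongrightarrow> 1 / \<gamma>"
    using tendsto_add[OF tendsto_const lim_const_over_n[of 1]] by simp
qed simp

lemma filterlim_num_samples:
  assumes "\<gamma> > 0" shows "filterlim (num_samples \<gamma>) at_top sequentially"
proof -
  have "filterlim (\<lambda>n. (1 / \<gamma>) * real n) at_top sequentially"
    using assms by (intro filterlim_tendsto_pos_mult_at_top[OF tendsto_const _ filterlim_real_sequentially]) simp
  moreover have "eventually (\<lambda>n. (1 / \<gamma>) * real n \<le> real (num_samples \<gamma> n)) sequentially"
    using num_samples_bounds(1)[OF assms] by (intro always_eventually allI) simp
  ultimately have "filterlim (\<lambda>n. real (num_samples \<gamma> n)) at_top sequentially"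
    by (rule filterlim_at_top_mono)
  thus ?thesis by (simp add: filterlim_sequentially_iff_filterlim_real)
qed

lemma binomial_over_power_tendsto:
  "(\<lambda>n. real (n choose k) / real n ^ k) \<longlonglongrightarrow> 1 / fact k"
proof (rule Lim_transform_eventually)
  have "(\<lambda>n. \<Prod>i<k. 1 - real i / real n) \<longlonglongrightarrow> (\<Prod>i<k. 1 - 0)"
    by (intro tendsto_prod tendsto_diff tendsto_const lim_const_over_n)
  thus "(\<lambda>n. (\<Prod>i<k. 1 - real i / real n) / fact k) \<longlonglongrightarrow> 1 / fact k"
    by (intro tendsto_divide tendsto_const) auto
  show "\<forall>\<^sub>F n in sequentially. (\<Prod>i<k. 1 - real i / real n) / fact k = real (n choose k) / real n ^ k"
    using eventually_gt_at_top[of 0]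
  proof eventually_elim
    case (elim n)
    have "(\<Prod>i<k. 1 - real i / real n) = (\<Prod>i<k. (real n - real i) / real n)"
      using elim by (intro prod.cong) (auto simp: field_simps)
    also have "\<dots> = (\<Prod>i<k. real n - real i) / real n ^ k" by (simp add: prod_dividef)
    also have "(\<Prod>i<k. real n - real i) = fact k * real (n choose k)"
      by (simp add: binomial_gbinomial gbinomial_mult_fact atLeast0LessThan)
    finally show ?case by simp
  qed
qed

lemma low_degree_norm_iid_tendsto_infinity:
  assumes "\<gamma> > 0" "\<beta>\<^sup>2 > \<gamma>" and \<pi>: "standardized \<pi>" and good: "beta_good \<beta> (iid_prior \<pi>)"
    and D: "(\<lambda>n. real (D n)) \<in> \<omega>(\<lambda>_. 1)"
  shows "(\<lambda>n. low_degree_norm \<gamma> \<beta> (iid_prior \<pi>) (D n) n) \<longlonglongrightarrow> \<infinity>"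
  unfolding infinity_ennreal_def tendsto_top_iff_ennreal
proof (intro allI impI)
  fix l :: real assume l: "l \<ge> 0"
  define \<rho> where "\<rho> = \<beta>\<^sup>2 / \<gamma>"
  have \<rho>: "\<rho> > 1" using assms by (simp add: \<rho>_def)
  have \<beta>: "\<beta> \<noteq> 0" using assms by auto
  have "filterlim (\<lambda>k. \<rho> ^ k / real k) at_top sequentially"
  proof -
    have "(\<lambda>k. real k * (1 / \<rho>) ^ k) \<longlonglongrightarrow> 0"
      using \<rho> by (intro powser_times_n_limit_0) simp
    moreover have "eventually (\<lambda>k. real k * (1 / \<rho>) ^ k > 0) sequentially"
      using eventually_gt_at_top[of 0] by eventually_elim (use \<rho> in simp)
    ultimately have "filterlim (\<lambda>k. inverse (real k * (1 / \<rho>) ^ k)) at_top sequentially"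
      by (intro filterlim_inverse_at_top)
    thus ?thesis by (simp add: field_simps inverse_eq_divide power_one_over)
  qed
  \<comment> \<open>The central binomial coefficient is at least 4^k / (2k), so the limit in n is at
    least \<rho>^k / (2k); the margin makes it at least l^2 + 1, hence strictly above l^2.\<close>
  hence "eventually (\<lambda>k. \<rho> ^ k / real k \<ge> 2 * l\<^sup>2 + 2) sequentially" by (simp add: filterlim_at_top)
  then obtain k where k: "k > 0" "\<rho> ^ k / real k \<ge> 2 * l\<^sup>2 + 2"
    using eventually_conj[OF eventually_gt_at_top[of 0]] eventually_happens[of _ sequentially] by (smt (verit) trivial_limit_sequentially eventually_elim2)
  define LB where "LB n = real (num_samples \<gamma> n choose k) * (\<beta>\<^sup>2 / 2) ^ k *
     (fact (2 * k) * (real (n choose k) * ((1 / real n) ^ (2 * k) / 2 ^ k)))" for n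
  \<comment> \<open>The bound is regrouped so that each binomial coefficient is compared with the
    k-th power of its upper index; the remaining powers form (N / n)^k, which tends to
    \<gamma>^(-k).\<close>
  have "(\<lambda>n. (real (num_samples \<gamma> n choose k) / real (num_samples \<gamma> n) ^ k) * (real (num_samples \<gamma> n) / real n) ^ k *
      (real (n choose k) / real n ^ k) * ((\<beta>\<^sup>2 / 2) ^ k * fact (2 * k) / 2 ^ k))
      \<longlonglongrightarrow> (1 / fact k) * (1 / \<gamma>) ^ k * (1 / fact k) * ((\<beta>\<^sup>2 / 2) ^ k * fact (2 * k) / 2 ^ k)"
    by (intro tendsto_mult tendsto_const tendsto_power num_samples_ratio_tendsto assms binomial_over_power_tendsto
          filterlim_compose[OF binomial_over_power_tendsto filterlim_num_samples])
  moreover have "eventually (\<lambda>n. (real (num_samples \<gamma> n choose k) / real (num_samples \<gamma> n) ^ k) * (real (num_samples \<gamma> n) / real n) ^ k *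
      (real (n choose k) / real n ^ k) * ((\<beta>\<^sup>2 / 2) ^ k * fact (2 * k) / 2 ^ k) = LB n) sequentially"
    using eventually_gt_at_top[of 0] eventually_compose_filterlim[OF eventually_gt_at_top[of 0] filterlim_num_samples[OF assms(1)]]
  proof eventually_elim
    case (elim n)
    thus ?case by (simp add: LB_def power_divide power_mult[of _ 2 k] power2_eq_square power_mult_distrib mult_2 power_add field_simps)
      (simp add: power_mult power2_eq_square)
  qed
  ultimately have lim: "LB \<longlonglongrightarrow> (1 / fact k) * (1 / \<gamma>) ^ k * (1 / fact k) * ((\<beta>\<^sup>2 / 2) ^ k * fact (2 * k) / 2 ^ k)"
    using Lim_transform_eventually by blast
  have "(1 / fact k) * (1 / \<gamma>) ^ k * (1 / fact k) * ((\<beta>\<^sup>2 / 2) ^ k * fact (2 * k) / 2 ^ k)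
      = \<rho> ^ k * (real ((2 * k) choose k) / 4 ^ k)"
  proof -
    have "real ((2 * k) choose k) = fact (2 * k) / (fact k * fact k)"
      by (subst binomial_fact) (auto simp: mult_2)
    moreover have "(4::real) ^ k = 2 ^ k * 2 ^ k" by (simp add: power_mult_distrib[symmetric])
    ultimately show ?thesis by (simp add: \<rho>_def power_divide)
  qed
  also have "\<dots> \<ge> \<rho> ^ k * (1 / (2 * real k))"
    using central_binomial_lower_bound[OF k(1)] \<rho> by (intro mult_left_mono) (auto simp: field_simps)
  finally have "(1 / fact k) * (1 / \<gamma>) ^ k * (1 / fact k) * ((\<beta>\<^sup>2 / 2) ^ k * fact (2 * k) / 2 ^ k) > l\<^sup>2"
    using k(2) by (simp add: field_simps)
  from order_tendstoD(1)[OF lim this] have ev: "eventually (\<lambda>n. LB n > l\<^sup>2) sequentially" .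
  have "eventually (\<lambda>n. real (D n) \<ge> real (2 * k)) sequentially"
    using landau_omega.smallD[OF D, of "real (2 * k)"] k(1) by simp
  with ev eventually_gt_at_top[of 0] eventually_compose_filterlim[OF eventually_gt_at_top[of 0] filterlim_num_samples[OF assms(1)]]
  show "\<forall>\<^sub>F n in sequentially. ennreal l < low_degree_norm \<gamma> \<beta> (iid_prior \<pi>) (D n) n"
  proof eventually_elim
    case (elim n)
    have "low_degree_norm \<gamma> \<beta> (iid_prior \<pi>) (D n) n \<ge> ennreal (sqrt (LB n))"
      unfolding LB_def using elim good
      by (intro low_degree_norm_iid_ge[OF \<pi> _ \<beta>]) (auto simp: beta_good_def)
    moreover have "l < sqrt (LB n)" using elim l by (intro real_less_rsqrt)
    hence "ennreal l < ennreal (sqrt (LB n))" using l by (simp add: ennreal_less_iff)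
    ultimately show ?case by (rule less_le_trans[rotated])
  qed
qed

section \<open>Exponential moments\<close>

lemma nn_integral_gauss_exp:
  "(\<integral>\<^sup>+g. ennreal (exp (a * g)) \<partial>gauss) = ennreal (exp (a\<^sup>2 / 2))"
proof -
  have eq: "std_normal_density g * exp (a * g) = exp (a\<^sup>2 / 2) * normal_density a 1 g" for g
  proof -
    have "exp (- g\<^sup>2 / 2) * exp (a * g) = exp (a\<^sup>2 / 2) * exp (- (g - a)\<^sup>2 / 2)"
      unfolding exp_add[symmetric] by (simp add: power2_diff field_simps)
    thus ?thesis by (simp add: normal_density_def field_simps)
  qed
  have "(\<integral>\<^sup>+g. ennreal (exp (a * g)) \<partial>gauss) = (\<integral>\<^sup>+g. ennreal (exp (a\<^sup>2 / 2)) * ennreal (normal_density a 1 g) \<partial>lborel)"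
    by (subst nn_integral_density) (auto simp: ennreal_mult[symmetric] eq)
  also have "\<dots> = ennreal (exp (a\<^sup>2 / 2)) * emeasure (density lborel (normal_density a 1)) UNIV"
    by (subst nn_integral_cmult) (auto simp: emeasure_density)
  also have "emeasure (density lborel (normal_density a 1)) UNIV = 1"
    using prob_space.emeasure_space_1[OF prob_space_normal_density[of 1 a]] by simp
  finally show ?thesis by simp
qed

lemma nn_integral_gauss_exp_square_quarter:
  "(\<integral>\<^sup>+g. ennreal (exp (g\<^sup>2 / 4)) \<partial>gauss) < \<infinity>"
proof -
  have eq: "std_normal_density g * exp (g\<^sup>2 / 4) = sqrt 2 * normal_density 0 (sqrt 2) g" for g
  proof -
    have "exp (- g\<^sup>2 / 2) * exp (g\<^sup>2 / 4) = exp (- g\<^sup>2 / 4)"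
      unfolding exp_add[symmetric] by (simp add: field_simps)
    thus ?thesis by (simp add: normal_density_def real_sqrt_mult field_simps)
  qed
  have "(\<integral>\<^sup>+g. ennreal (exp (g\<^sup>2 / 4)) \<partial>gauss) = (\<integral>\<^sup>+g. ennreal (sqrt 2) * ennreal (normal_density 0 (sqrt 2) g) \<partial>lborel)"
    by (subst nn_integral_density) (auto simp: ennreal_mult[symmetric] eq)
  also have "\<dots> = ennreal (sqrt 2) * emeasure (density lborel (normal_density 0 (sqrt 2))) UNIV"
    by (subst nn_integral_cmult) (auto simp: emeasure_density)
  also have "emeasure (density lborel (normal_density 0 (sqrt 2))) UNIV = 1"
    using prob_space.emeasure_space_1[OF prob_space_normal_density[of "sqrt 2" 0]] by simp
  finally show ?thesis by simp
qed

text \<open>The square is linearised by an independent standard Gaussian.\<close>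

lemma subgaussian_exp_square:
  assumes "subgaussian \<pi>"
  shows "\<exists>s>0. integrable \<pi> (\<lambda>x. exp (s * x\<^sup>2))"
proof -
  interpret \<pi>: real_distribution \<pi> using assms by (simp add: subgaussian_def)
  from assms obtain \<sigma> where \<sigma>: "\<And>t. integrable \<pi> (\<lambda>x. exp (t * x))"
     "\<And>t. (\<integral>x. exp (t * x) \<partial>\<pi>) \<le> exp (\<sigma>\<^sup>2 * t\<^sup>2 / 2)" by (auto simp: subgaussian_def)
  \<comment> \<open>Chosen so that \<sigma>^2 s <= 1/4, which leaves the Gaussian integrable weight
    exp (g^2 / 4). With b^2 = 2s, averaging exp (b x g) over g gives exp (s x^2).\<close>
  define s where "s = 1 / (4 * (\<sigma>\<^sup>2 + 1))"
  define b where "b = sqrt (2 * s)"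
  have "\<sigma>\<^sup>2 + 1 > 0" by (simp add: add_nonneg_pos)
  hence s: "s > 0" "\<sigma>\<^sup>2 * s \<le> 1 / 4" by (auto simp: s_def field_simps)
  have b2: "b\<^sup>2 = 2 * s" using s by (simp add: b_def)
  interpret G: prob_space gauss by (rule prob_space_gauss)
  interpret PG: pair_sigma_finite \<pi> gauss ..
  have meas: "(\<lambda>z. ennreal (exp (b * fst z * snd z))) \<in> borel_measurable (\<pi> \<Otimes>\<^sub>M gauss)" by measurable
  have "(\<integral>\<^sup>+x. ennreal (exp (s * x\<^sup>2)) \<partial>\<pi>) = (\<integral>\<^sup>+x. \<integral>\<^sup>+g. ennreal (exp (b * x * g)) \<partial>gauss \<partial>\<pi>)"
    by (simp add: nn_integral_gauss_exp power_mult_distrib b2)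
  also have "\<dots> = (\<integral>\<^sup>+g. \<integral>\<^sup>+x. ennreal (exp (b * x * g)) \<partial>\<pi> \<partial>gauss)"
    using PG.Fubini[OF meas] by simp
  also have "\<dots> \<le> (\<integral>\<^sup>+g. ennreal (exp (g\<^sup>2 / 4)) \<partial>gauss)"
  proof (rule nn_integral_mono)
    fix g
    have "(\<integral>\<^sup>+x. ennreal (exp (b * x * g)) \<partial>\<pi>) = (\<integral>\<^sup>+x. ennreal (exp ((b * g) * x)) \<partial>\<pi>)" by (simp add: mult_ac)
    also have "\<dots> = ennreal (\<integral>x. exp ((b * g) * x) \<partial>\<pi>)" by (intro nn_integral_eq_integral \<sigma>) auto
    also have "\<dots> \<le> ennreal (exp (\<sigma>\<^sup>2 * (b * g)\<^sup>2 / 2))" by (intro ennreal_leI \<sigma>)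
    also have "\<sigma>\<^sup>2 * (b * g)\<^sup>2 / 2 = (\<sigma>\<^sup>2 * s) * g\<^sup>2" by (simp add: power_mult_distrib b2)
    also have "ennreal (exp ((\<sigma>\<^sup>2 * s) * g\<^sup>2)) \<le> ennreal (exp (g\<^sup>2 / 4))"
      using mult_right_mono[OF s(2), of "g\<^sup>2"] by (intro ennreal_leI) simp
    finally show "(\<integral>\<^sup>+x. ennreal (exp (b * x * g)) \<partial>\<pi>) \<le> ennreal (exp (g\<^sup>2 / 4))" .
  qed
  also have "\<dots> < \<infinity>" by (rule nn_integral_gauss_exp_square_quarter)
  finally have "integrable \<pi> (\<lambda>x. exp (s * x\<^sup>2))" by (intro integrableI_nonneg) auto
  thus ?thesis using s by blast
qed

text \<open>The exact coefficient 1/2 of the square is essential, since it fixes the constant in the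
  threshold; only the cubic remainder is estimated generously.\<close>

lemma exp_le_quadratic_plus:
  fixes u :: real shows "exp u \<le> 1 + u + u\<^sup>2 / 2 + \<bar>u\<bar> ^ 3 * exp \<bar>u\<bar>"
proof -
  obtain t where t: "\<bar>t\<bar> \<le> \<bar>u\<bar>" "exp u = (\<Sum>m<3. u ^ m / fact m) + (exp t / fact 3) * u ^ 3"
    using Maclaurin_exp_le[of u 3] by blast
  have "(exp t / fact 3) * u ^ 3 \<le> exp t / fact 3 * \<bar>u\<bar> ^ 3"
    by (intro mult_left_mono) (auto simp: power_abs[symmetric])
  also have "\<dots> \<le> exp \<bar>u\<bar> * \<bar>u\<bar> ^ 3"
  proof (intro mult_right_mono)
    have "exp t / fact 3 \<le> exp t" by (simp add: fact_numeral)
    also have "\<dots> \<le> exp \<bar>u\<bar>" using t by simp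
    finally show "exp t / fact 3 \<le> exp \<bar>u\<bar>" .
  qed auto
  finally show ?thesis using t(2) by (simp add: numeral_3_eq_3 power2_eq_square mult.commute)
qed

lemma power_div_fact_le_exp:
  fixes x :: real assumes "x \<ge> 0" shows "x ^ m / fact m \<le> exp x"
proof -
  obtain t where "\<bar>t\<bar> \<le> \<bar>x\<bar>" and e: "exp x = (\<Sum>i<Suc m. x ^ i / fact i) + (exp t / fact (Suc m)) * x ^ Suc m"
    using Maclaurin_exp_le[of x "Suc m"] by blast
  have "x ^ m / fact m \<le> (\<Sum>i<Suc m. x ^ i / fact i)" using assms by (simp add: sum_nonneg)
  also have "\<dots> \<le> exp x" unfolding e using assms by simp
  finally show ?thesis .
qed

abbreviation product_mgf :: "real measure \<Rightarrow> real \<Rightarrow> ennreal" where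
  "product_mgf \<pi> t \<equiv> (\<integral>\<^sup>+x. \<integral>\<^sup>+x'. ennreal (exp (t * (x * x'))) \<partial>\<pi> \<partial>\<pi>)"

text \<open>The product of two independent copies has mean 0 and variance 1, but in general only
  exponential tails, controlled by 2 s |x x'| <= s x^2 + s x'^2; hence the restriction to small t.
  There a Taylor expansion yields the true variance up to \<delta>, whereas the variance proxy of
  \<pi> may be larger than 1.\<close>

lemma subgaussian_product_mgf:
  assumes sg: "subgaussian \<pi>" and std: "standardized \<pi>" and \<delta>: "\<delta> > 0"
  shows "\<exists>t0>0. \<forall>t. \<bar>t\<bar> \<le> t0 \<longrightarrow>
     product_mgf \<pi> t \<le> ennreal (exp ((1 + \<delta>) * t\<^sup>2 / 2))"
proof -
  interpret \<pi>: real_distribution \<pi> using sg by (simp add: subgaussian_def)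
  have P: "prob_space \<pi>" by (rule \<pi>.prob_space_axioms)
  interpret PP: pair_prob_space \<pi> \<pi> ..
  let ?M = "\<pi> \<Otimes>\<^sub>M \<pi>"
  let ?Z = "\<lambda>z. fst z * snd z :: real"
  have Zm[measurable]: "?Z \<in> borel_measurable ?M" by measurable
  obtain s where s: "s > 0" "integrable \<pi> (\<lambda>x. exp (s * x\<^sup>2))" using subgaussian_exp_square[OF sg] by blast
  have intE: "integrable ?M (\<lambda>z. exp (2 * s * \<bar>?Z z\<bar>))"
  proof (rule Bochner_Integration.integrable_bound[OF integrable_replica_mult[OF P s(2) s(2)]])
    show "AE z in ?M. norm (exp (2 * s * \<bar>?Z z\<bar>)) \<le> norm (exp (s * (fst z)\<^sup>2) * exp (s * (snd z)\<^sup>2))"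
    proof (rule AE_I2)
      fix z
      have "2 * \<bar>?Z z\<bar> \<le> (fst z)\<^sup>2 + (snd z)\<^sup>2"
        using sum_squares_bound[of "\<bar>fst z\<bar>" "\<bar>snd z\<bar>"] by (simp add: abs_mult)
      from mult_left_mono[OF this, of s] s show "norm (exp (2 * s * \<bar>?Z z\<bar>)) \<le> norm (exp (s * (fst z)\<^sup>2) * exp (s * (snd z)\<^sup>2))"
        by (simp add: exp_add[symmetric] algebra_simps)
    qed
  qed measurable
  have m1: "integrable \<pi> (\<lambda>x. x)" "(\<integral>x. x \<partial>\<pi>) = 0" and m2: "integrable \<pi> (\<lambda>x. x\<^sup>2)" "(\<integral>x. x\<^sup>2 \<partial>\<pi>) = 1"
    using std by (auto simp: standardized_def has_bochner_integral_iff)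
  have Z1: "integrable ?M ?Z" "(\<integral>z. ?Z z \<partial>?M) = 0"
    using integrable_replica_mult[OF P m1(1) m1(1)] integral_replica_mult[OF P m1(1) m1(1)] m1 by auto
  have Z2: "integrable ?M (\<lambda>z. (?Z z)\<^sup>2)" "(\<integral>z. (?Z z)\<^sup>2 \<partial>?M) = 1"
    using integrable_replica_mult[OF P m2(1) m2(1)] integral_replica_mult[OF P m2(1) m2(1)] m2
    by (auto simp: power_mult_distrib)
  define E where "E = (\<integral>z. exp (2 * s * \<bar>?Z z\<bar>) \<partial>?M)"
  \<comment> \<open>The constant 6 is 3!, from |s Z|^3 / 3! <= exp (s |Z|). In \<open>E\<close> one
    s in the exponent pays for this cube, the other for exp |t Z|.\<close>
  define K where "K = 6 / s ^ 3 * E"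
  have E: "E \<ge> 0" unfolding E_def by (intro Bochner_Integration.integral_nonneg) auto
  have K: "K \<ge> 0" using E s by (simp add: K_def)
  \<comment> \<open>The first bound gives exp |t Z| <= exp (s |Z|), the second |t|^3 K <= \<delta>
    t^2 / 2; K + 1 in the denominator covers K = 0.\<close>
  define t0 where "t0 = min s (\<delta> / (2 * (K + 1)))"
  have t0: "t0 > 0" using s \<delta> K by (simp add: t0_def)
  have "product_mgf \<pi> t \<le> ennreal (exp ((1 + \<delta>) * t\<^sup>2 / 2))" if t: "\<bar>t\<bar> \<le> t0" for t
  proof -
    have ts: "\<bar>t\<bar> \<le> s" using t by (simp add: t0_def)
    have pt: "exp (t * ?Z z) \<le> 1 + t * ?Z z + t\<^sup>2 / 2 * (?Z z)\<^sup>2 + \<bar>t\<bar> ^ 3 * (6 / s ^ 3) * exp (2 * s * \<bar>?Z z\<bar>)" for z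
    proof -
      have "\<bar>t * ?Z z\<bar> ^ 3 * exp \<bar>t * ?Z z\<bar> = \<bar>t\<bar> ^ 3 * (\<bar>?Z z\<bar> ^ 3 * exp (\<bar>t\<bar> * \<bar>?Z z\<bar>))"
        by (simp add: abs_mult power_mult_distrib)
      also have "\<dots> \<le> \<bar>t\<bar> ^ 3 * ((6 / s ^ 3 * exp (s * \<bar>?Z z\<bar>)) * exp (s * \<bar>?Z z\<bar>))"
      proof (intro mult_left_mono mult_mono)
        have "(s * \<bar>?Z z\<bar>) ^ 3 / fact 3 \<le> exp (s * \<bar>?Z z\<bar>)"
          using s by (intro power_div_fact_le_exp) simp
        thus "\<bar>?Z z\<bar> ^ 3 \<le> 6 / s ^ 3 * exp (s * \<bar>?Z z\<bar>)"
          using s by (simp add: power_mult_distrib fact_numeral field_simps)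
        show "exp (\<bar>t\<bar> * \<bar>?Z z\<bar>) \<le> exp (s * \<bar>?Z z\<bar>)" using ts by (simp add: mult_right_mono)
      qed (use s in auto)
      also have "\<dots> = \<bar>t\<bar> ^ 3 * (6 / s ^ 3) * exp (2 * s * \<bar>?Z z\<bar>)"
      proof -
        have "exp (2 * s * \<bar>?Z z\<bar>) = exp (s * \<bar>?Z z\<bar>) * exp (s * \<bar>?Z z\<bar>)"
          unfolding exp_add[symmetric] by simp
        thus ?thesis by (simp only: mult.assoc)
      qed
      finally show ?thesis using exp_le_quadratic_plus[of "t * ?Z z"] by (simp add: power_mult_distrib)
    qed
    have intT: "integrable ?M (\<lambda>z. exp (t * ?Z z))"
    proof (rule Bochner_Integration.integrable_bound[OF intE])
      show "AE z in ?M. norm (exp (t * ?Z z)) \<le> norm (exp (2 * s * \<bar>?Z z\<bar>))"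
      proof (rule AE_I2)
        fix z
        have "t * ?Z z \<le> \<bar>t\<bar> * \<bar>?Z z\<bar>" by (metis abs_ge_self abs_mult)
        also have "\<dots> \<le> (2 * s) * \<bar>?Z z\<bar>" using ts s by (intro mult_right_mono) auto
        finally show "norm (exp (t * ?Z z)) \<le> norm (exp (2 * s * \<bar>?Z z\<bar>))" by simp
      qed
    qed measurable
    have "(\<integral>z. exp (t * ?Z z) \<partial>?M) \<le> (\<integral>z. 1 + t * ?Z z + t\<^sup>2 / 2 * (?Z z)\<^sup>2 + \<bar>t\<bar> ^ 3 * (6 / s ^ 3) * exp (2 * s * \<bar>?Z z\<bar>) \<partial>?M)"
      using pt by (intro integral_mono intT Bochner_Integration.integrable_add integrable_mult_right Z1 Z2 intE) auto
    also have "\<dots> = 1 + t\<^sup>2 / 2 + \<bar>t\<bar> ^ 3 * K"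
    proof -
      have A: "has_bochner_integral ?M (\<lambda>z. 1) (1::real)"
        unfolding has_bochner_integral_iff lebesgue_integral_const PP.prob_space by simp
      have B: "has_bochner_integral ?M (\<lambda>z. t * ?Z z) (t * 0)"
        using Z1 by (intro has_bochner_integral_mult_right) (simp add: has_bochner_integral_iff)
      have C: "has_bochner_integral ?M (\<lambda>z. t\<^sup>2 / 2 * (?Z z)\<^sup>2) (t\<^sup>2 / 2 * 1)"
        using Z2 by (intro has_bochner_integral_mult_right) (simp add: has_bochner_integral_iff)
      have D: "has_bochner_integral ?M (\<lambda>z. \<bar>t\<bar> ^ 3 * (6 / s ^ 3) * exp (2 * s * \<bar>?Z z\<bar>)) (\<bar>t\<bar> ^ 3 * (6 / s ^ 3) * E)"
        using intE by (intro has_bochner_integral_mult_right) (simp add: has_bochner_integral_iff E_def)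
      show ?thesis
        using has_bochner_integral_integral_eq[OF has_bochner_integral_add[OF has_bochner_integral_add[OF has_bochner_integral_add[OF A B] C] D]]
        by (simp add: K_def)
    qed
    also have "\<dots> \<le> exp (t\<^sup>2 / 2 + \<bar>t\<bar> ^ 3 * K)"
      by (simp only: add.assoc exp_ge_add_one_self)
    also have "\<dots> \<le> exp ((1 + \<delta>) * t\<^sup>2 / 2)"
    proof -
      have "\<bar>t\<bar> * K \<le> \<delta> / (2 * (K + 1)) * K" using t K by (intro mult_right_mono) (auto simp: t0_def)
      also have "\<dots> \<le> \<delta> / 2" using K \<delta> by (simp add: field_simps)
      finally have "t\<^sup>2 * (\<bar>t\<bar> * K) \<le> t\<^sup>2 * (\<delta> / 2)" by (intro mult_left_mono) auto
      moreover have "\<bar>t\<bar> ^ 3 * K = t\<^sup>2 * (\<bar>t\<bar> * K)"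
      proof -
        have "\<bar>t\<bar> ^ 3 = \<bar>t\<bar>\<^sup>2 * \<bar>t\<bar>" by (simp only: power3_eq_cube power2_eq_square)
        thus ?thesis by simp
      qed
      ultimately have "\<bar>t\<bar> ^ 3 * K \<le> t\<^sup>2 * (\<delta> / 2)" by (simp only:)
      hence "t\<^sup>2 / 2 + \<bar>t\<bar> ^ 3 * K \<le> (1 + \<delta>) * t\<^sup>2 / 2" by (simp add: field_simps)
      thus ?thesis by (simp only: exp_le_cancel_iff)
    qed
    finally have le: "(\<integral>z. exp (t * ?Z z) \<partial>?M) \<le> exp ((1 + \<delta>) * t\<^sup>2 / 2)" .
    have "product_mgf \<pi> t = (\<integral>\<^sup>+z. ennreal (exp (t * ?Z z)) \<partial>?M)"
      by (subst \<pi>.nn_integral_fst[symmetric]) auto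
    also have "\<dots> = ennreal (\<integral>z. exp (t * ?Z z) \<partial>?M)" by (intro nn_integral_eq_integral intT) auto
    finally show ?thesis using le by (simp add: ennreal_leI)
  qed
  thus ?thesis using t0 by blast
qed

section \<open>Moments of the overlap\<close>

lemma measurable_overlap:
  assumes "sets X = sets (Rn n)" "sets Y = sets (Rn n)"
  shows "overlap n \<in> borel_measurable (X \<Otimes>\<^sub>M Y)"
proof -
  have "(\<lambda>x. x j) \<in> borel_measurable X" "(\<lambda>x. x j) \<in> borel_measurable Y" if "j < n" for j
    using measurable_Rn_component[OF that] by (simp_all add: measurable_cong_sets[OF assms(1) refl] measurable_cong_sets[OF assms(2) refl])
  hence "(\<lambda>z. \<Sum>j<n. fst z j * snd z j) \<in> borel_measurable (X \<Otimes>\<^sub>M Y)"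
    by (intro borel_measurable_sum borel_measurable_times measurable_compose[OF measurable_fst] measurable_compose[OF measurable_snd]) auto
  thus ?thesis by (simp add: overlap_def[abs_def])
qed

text \<open>Both replicas carry a factor 1 / sqrt n, so n times the overlap is a sum of n
  independent copies of the product variable.\<close>

lemma iid_overlap_mgf:
  assumes std: "standardized \<pi>" and n: "n > 0"
  shows "(\<integral>\<^sup>+z. ennreal (exp (t * real n * overlap n z)) \<partial>(iid_prior \<pi> n \<Otimes>\<^sub>M iid_prior \<pi> n))
       = product_mgf \<pi> t ^ n"
proof -
  let ?\<mu> = "distr \<pi> borel (\<lambda>t. t / sqrt (real n))"
  let ?X = "iid_prior \<pi> n"
  have meas: "(\<lambda>t. t / sqrt (real n)) \<in> borel_measurable \<pi>"
    by (rule measurable_standardized[OF std]) simp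
  interpret \<pi>: prob_space \<pi> by (rule prob_space_standardized[OF std])
  interpret \<mu>: prob_space ?\<mu> by (rule \<pi>.prob_space_distr[OF meas])
  interpret PM: product_prob_space "\<lambda>_::nat. ?\<mu>" "{..<n}" ..
  interpret X: prob_space ?X by (rule prob_space_iid_prior[OF std])
  have om: "overlap n \<in> borel_measurable (?X \<Otimes>\<^sub>M ?X)"
    by (intro measurable_overlap sets_iid_prior)
  let ?e = "\<lambda>u v. ennreal (exp (t * real n * (u * v)))"
  have me: "(\<lambda>u. \<integral>\<^sup>+v. ?e u v \<partial>?\<mu>) \<in> borel_measurable ?\<mu>"
    by (rule \<mu>.borel_measurable_nn_integral) measurable
  have "(\<integral>\<^sup>+z. ennreal (exp (t * real n * overlap n z)) \<partial>(?X \<Otimes>\<^sub>M ?X))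
      = (\<integral>\<^sup>+x. \<integral>\<^sup>+x'. ennreal (exp (t * real n * overlap n (x, x'))) \<partial>?X \<partial>?X)"
    using om by (subst X.nn_integral_fst[symmetric]) auto
  also have "\<dots> = (\<integral>\<^sup>+x. \<integral>\<^sup>+x'. (\<Prod>j<n. ?e (x j) (x' j)) \<partial>?X \<partial>?X)"
    by (simp add: overlap_def sum_distrib_left exp_sum prod_ennreal)
  also have "\<dots> = (\<integral>\<^sup>+x. (\<Prod>j<n. \<integral>\<^sup>+v. ?e (x j) v \<partial>?\<mu>) \<partial>?X)"
    unfolding iid_prior_def
    by (intro nn_integral_cong PM.product_nn_integral_prod) measurable
  also have "\<dots> = (\<Prod>j<n. \<integral>\<^sup>+u. \<integral>\<^sup>+v. ?e u v \<partial>?\<mu> \<partial>?\<mu>)"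
    unfolding iid_prior_def using me
    by (intro PM.product_nn_integral_prod) auto
  also have "\<dots> = (\<integral>\<^sup>+u. \<integral>\<^sup>+v. ?e u v \<partial>?\<mu> \<partial>?\<mu>) ^ n" by simp
  also have "(\<integral>\<^sup>+u. \<integral>\<^sup>+v. ?e u v \<partial>?\<mu> \<partial>?\<mu>) = (\<integral>\<^sup>+x. \<integral>\<^sup>+v. ?e (x / sqrt (real n)) v \<partial>?\<mu> \<partial>\<pi>)"
    using me by (subst nn_integral_distr[OF meas]) auto
  also have "\<dots> = (\<integral>\<^sup>+x. \<integral>\<^sup>+x'. ?e (x / sqrt (real n)) (x' / sqrt (real n)) \<partial>\<pi> \<partial>\<pi>)"
    by (subst nn_integral_distr[OF meas]) auto
  also have "\<dots> = product_mgf \<pi> t"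
  proof -
    have "t * real n * (x / sqrt (real n) * (x' / sqrt (real n))) = t * (x * x')" for x x'
    proof -
      have "x / sqrt (real n) * (x' / sqrt (real n)) = x * x' / real n"
        by (simp add: times_divide_times_eq)
      thus ?thesis using n by simp
    qed
    thus ?thesis by (simp only:)
  qed
  finally show ?thesis .
qed

text \<open>Chernoff: a^(2k) / (2k)! <= exp a for a = t n |R|, and exp |u| <= exp u + exp (-u)
  accounts for the factor 2. The nonnegative integral is used because finiteness of the moment is
  part of the conclusion.\<close>

lemma iid_overlap_moment_le:
  assumes std: "standardized \<pi>" and n: "n > 0" and t: "t > 0"
    and mgf: "\<And>u. \<bar>u\<bar> \<le> t \<Longrightarrow> product_mgf \<pi> u \<le> ennreal (exp ((1 + \<delta>) * u\<^sup>2 / 2))"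
  shows "(\<integral>\<^sup>+z. ennreal (overlap n z ^ (2 * k)) \<partial>(iid_prior \<pi> n \<Otimes>\<^sub>M iid_prior \<pi> n))
     \<le> ennreal (2 * fact (2 * k) / (t * real n) ^ (2 * k) * exp (real n * ((1 + \<delta>) * t\<^sup>2 / 2)))"
proof -
  let ?M = "iid_prior \<pi> n \<Otimes>\<^sub>M iid_prior \<pi> n"
  have [measurable]: "overlap n \<in> borel_measurable ?M" by (intro measurable_overlap sets_iid_prior)
  let ?c = "fact (2 * k) / (t * real n) ^ (2 * k)"
  have c: "?c \<ge> 0" using t by simp
  have mgf': "(\<integral>\<^sup>+z. ennreal (exp (u * real n * overlap n z)) \<partial>?M) \<le> ennreal (exp (real n * ((1 + \<delta>) * t\<^sup>2 / 2)))"
    if "u = t \<or> u = - t" for u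
  proof -
    have "(\<integral>\<^sup>+z. ennreal (exp (u * real n * overlap n z)) \<partial>?M) \<le> ennreal (exp ((1 + \<delta>) * u\<^sup>2 / 2)) ^ n"
      unfolding iid_overlap_mgf[OF std n] using that t by (intro power_mono mgf) auto
    also have "\<dots> = ennreal (exp (real n * ((1 + \<delta>) * t\<^sup>2 / 2)))"
      using that by (auto simp: ennreal_power exp_of_nat_mult[symmetric])
    finally show ?thesis .
  qed
  have pt: "overlap n z ^ (2 * k) \<le> ?c * exp (t * real n * overlap n z) + ?c * exp ((- t) * real n * overlap n z)" for z
  proof -
    let ?r = "overlap n z" and ?a = "t * real n * \<bar>overlap n z\<bar>"
    have a: "t * real n > 0" using t n by simp
    have "?a ^ (2 * k) / fact (2 * k) \<le> exp ?a" using t by (intro power_div_fact_le_exp) simp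
    also have "exp ?a \<le> exp (t * real n * ?r) + exp ((- t) * real n * ?r)"
      by (cases "?r \<ge> 0") (auto simp: abs_if)
    finally have "?a ^ (2 * k) \<le> fact (2 * k) * (exp (t * real n * ?r) + exp ((- t) * real n * ?r))"
      by (simp add: divide_le_eq mult.commute)
    moreover have "?a ^ (2 * k) = (t * real n) ^ (2 * k) * ?r ^ (2 * k)"
      by (simp only: power_mult_distrib power_even_abs[OF even_mult_iff[THEN iffD2, OF disjI1, OF even_numeral]])
    ultimately have "(t * real n) ^ (2 * k) * ?r ^ (2 * k) \<le> fact (2 * k) * (exp (t * real n * ?r) + exp ((- t) * real n * ?r))" by simp
    hence "?r ^ (2 * k) \<le> fact (2 * k) * (exp (t * real n * ?r) + exp ((- t) * real n * ?r)) / (t * real n) ^ (2 * k)"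
      using a by (simp add: pos_le_divide_eq mult.commute)
    thus ?thesis by (simp add: field_simps add_divide_distrib)
  qed
  have "(\<integral>\<^sup>+z. ennreal (overlap n z ^ (2 * k)) \<partial>?M)
      \<le> (\<integral>\<^sup>+z. ennreal ?c * ennreal (exp (t * real n * overlap n z)) + ennreal ?c * ennreal (exp ((- t) * real n * overlap n z)) \<partial>?M)"
  proof (rule nn_integral_mono)
    fix z
    show "ennreal (overlap n z ^ (2 * k)) \<le> ennreal ?c * ennreal (exp (t * real n * overlap n z)) + ennreal ?c * ennreal (exp ((- t) * real n * overlap n z))"
      using pt[of z] c by (simp only: ennreal_mult[symmetric] ennreal_plus[symmetric] mult_nonneg_nonneg exp_ge_zero ennreal_leI)
  qed
  also have "\<dots> = ennreal ?c * (\<integral>\<^sup>+z. ennreal (exp (t * real n * overlap n z)) \<partial>?M) + ennreal ?c * (\<integral>\<^sup>+z. ennreal (exp ((- t) * real n * overlap n z)) \<partial>?M)"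
    by (simp add: nn_integral_add nn_integral_cmult)
  also have "\<dots> \<le> ennreal ?c * ennreal (exp (real n * ((1 + \<delta>) * t\<^sup>2 / 2))) + ennreal ?c * ennreal (exp (real n * ((1 + \<delta>) * t\<^sup>2 / 2)))"
    by (intro add_mono mult_left_mono mgf') auto
  also have "\<dots> = ennreal (2 * fact (2 * k) / (t * real n) ^ (2 * k) * exp (real n * ((1 + \<delta>) * t\<^sup>2 / 2)))"
    using c by (simp only: ennreal_mult[symmetric] ennreal_plus[symmetric] mult_nonneg_nonneg exp_ge_zero) (simp add: field_simps)
  finally show ?thesis .
qed

section \<open>The truncated prior\<close>

definition trunc_map :: "real \<Rightarrow> nat \<Rightarrow> (nat \<Rightarrow> real) \<Rightarrow> nat \<Rightarrow> real" where
  "trunc_map \<beta> n x = (if \<beta> * sqnorm n x > -1 \<and> sqnorm n x \<le> 2 then x else (\<lambda>i\<in>{..<n}. 0))"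

lemma trunc_prior_eq: "trunc_prior \<beta> X n = distr (X n) (Rn n) (trunc_map \<beta> n)"
  by (simp add: trunc_prior_def trunc_map_def[abs_def])

lemma sets_trunc_prior: "sets (trunc_prior \<beta> X n) = sets (Rn n)"
  by (simp add: trunc_prior_eq)

lemma measurable_trunc_map [measurable]: "trunc_map \<beta> n \<in> Rn n \<rightarrow>\<^sub>M Rn n"
proof -
  have "(\<lambda>i\<in>{..<n}. 0 :: real) \<in> space (Rn n)" by (auto simp: space_PiM)
  thus ?thesis unfolding trunc_map_def[abs_def] by (intro measurable_If measurable_const) measurable
qed

lemma prob_space_trunc_prior:
  assumes "prob_space (X n)" "sets (X n) = sets (Rn n)"
  shows "prob_space (trunc_prior \<beta> X n)"
  unfolding trunc_prior_eq using measurable_trunc_map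
  by (intro prob_space.prob_space_distr assms(1)) (simp add: measurable_cong_sets[OF assms(2) refl])

lemma sqnorm_trunc_map: "\<beta> * sqnorm n (trunc_map \<beta> n x) > -1" "sqnorm n (trunc_map \<beta> n x) \<le> 2"
proof -
  have "sqnorm n (\<lambda>i\<in>{..<n}. 0) = 0" by (simp add: sqnorm_def)
  thus "\<beta> * sqnorm n (trunc_map \<beta> n x) > -1" "sqnorm n (trunc_map \<beta> n x) \<le> 2"
    by (auto simp: trunc_map_def)
qed

lemma AE_trunc_prior:
  assumes "sets (X n) = sets (Rn n)"
  shows "AE x in trunc_prior \<beta> X n. \<beta> * sqnorm n x > -1 \<and> sqnorm n x \<le> 2"
proof -
  have m: "trunc_map \<beta> n \<in> X n \<rightarrow>\<^sub>M Rn n"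
    using measurable_trunc_map by (simp add: measurable_cong_sets[OF assms refl])
  show ?thesis unfolding trunc_prior_eq
    by (subst AE_distr_iff[OF m]) (measurable, simp add: sqnorm_trunc_map)
qed

text \<open>Truncation keeps each replica or replaces it by 0, so the overlap is unchanged or
  becomes 0. Moment bounds for the iid prior thus carry over by domination, with no conditioning on
  the truncation event.\<close>

lemma overlap_trunc_map:
  "overlap n (trunc_map \<beta> n x, trunc_map \<beta> n x') ^ (2 * k) \<le> overlap n (x, x') ^ (2 * k) \<or> k = 0"
proof -
  have "overlap n (trunc_map \<beta> n x, trunc_map \<beta> n x') = overlap n (x, x') \<or>
        overlap n (trunc_map \<beta> n x, trunc_map \<beta> n x') = 0"
    by (auto simp: overlap_def trunc_map_def intro!: sum.neutral)
  thus ?thesis by (auto simp: zero_le_even_power power_0_left)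
qed

lemma trunc_prior_overlap_moment_le:
  assumes X: "prob_space (X n)" and sets_X: "sets (X n) = sets (Rn n)" and k: "k > 0" and c: "c \<ge> 0"
    and le: "(\<integral>\<^sup>+z. ennreal (overlap n z ^ (2 * k)) \<partial>(X n \<Otimes>\<^sub>M X n)) \<le> ennreal c"
  shows "(\<integral>z. overlap n z ^ (2 * k) \<partial>(trunc_prior \<beta> X n \<Otimes>\<^sub>M trunc_prior \<beta> X n)) \<le> c"
proof -
  let ?Y = "trunc_prior \<beta> X n" and ?T = "trunc_map \<beta> n"
  have m[measurable]: "?T \<in> X n \<rightarrow>\<^sub>M Rn n"
    using measurable_trunc_map by (simp add: measurable_cong_sets[OF sets_X refl])
  have Y: "prob_space ?Y" by (rule prob_space_trunc_prior[of X n, OF X sets_X])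
  have om[measurable]: "overlap n \<in> borel_measurable (Rn n \<Otimes>\<^sub>M Rn n)" by (intro measurable_overlap refl)
  have YY: "?Y \<Otimes>\<^sub>M ?Y = distr (X n \<Otimes>\<^sub>M X n) (Rn n \<Otimes>\<^sub>M Rn n) (\<lambda>(x, x'). (?T x, ?T x'))"
    unfolding trunc_prior_eq
    by (rule pair_measure_distr[OF m m]) (use Y in \<open>simp add: trunc_prior_eq prob_space_imp_sigma_finite\<close>)
  have "(\<integral>\<^sup>+z. ennreal (overlap n z ^ (2 * k)) \<partial>(?Y \<Otimes>\<^sub>M ?Y))
      = (\<integral>\<^sup>+z. ennreal (overlap n (?T (fst z), ?T (snd z)) ^ (2 * k)) \<partial>(X n \<Otimes>\<^sub>M X n))"
    unfolding YY by (subst nn_integral_distr) (auto simp: case_prod_unfold)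
  also have "\<dots> \<le> (\<integral>\<^sup>+z. ennreal (overlap n z ^ (2 * k)) \<partial>(X n \<Otimes>\<^sub>M X n))"
    using overlap_trunc_map[of n \<beta> _ _ k] k by (intro nn_integral_mono ennreal_leI) (metis less_irrefl prod.collapse)
  also note le
  finally have "(\<integral>\<^sup>+z. ennreal (overlap n z ^ (2 * k)) \<partial>(?Y \<Otimes>\<^sub>M ?Y)) \<le> ennreal c" .
  moreover have "(\<integral>z. overlap n z ^ (2 * k) \<partial>(?Y \<Otimes>\<^sub>M ?Y)) = enn2real (\<integral>\<^sup>+z. ennreal (overlap n z ^ (2 * k)) \<partial>(?Y \<Otimes>\<^sub>M ?Y))"
    by (intro integral_eq_nn_integral borel_measurable_power measurable_overlap sets_trunc_prior)
       (auto simp: zero_le_even_power)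
  ultimately show ?thesis using c by (simp add: enn2real_leI)
qed

text \<open>After truncation the coordinates of the spike and the coefficient of the root are
  bounded. A planted entry is then a polynomial in bounded variables and Gaussians, so it has
  moments of all orders.\<close>

lemma trunc_prior_hermite_integrable:
  fixes \<gamma> n defines "N \<equiv> num_samples \<gamma> n"
  assumes X: "prob_space (X n)" and sets_X: "sets (X n) = sets (Rn n)"
  shows "integrable (trunc_prior \<beta> X n \<Otimes>\<^sub>M wishart_null \<gamma> n)
           (planted_hermite \<beta> N n \<alpha>)"
proof -
  let ?Y = "trunc_prior \<beta> X n" and ?Q = "wishart_null \<gamma> n"
  let ?M = "?Y \<Otimes>\<^sub>M ?Q"
  interpret Y: prob_space ?Y by (rule prob_space_trunc_prior[of X n, OF X sets_X])
  interpret Q: prob_space ?Q by (rule prob_space_wishart_null)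
  interpret YQ: pair_prob_space ?Y ?Q ..
  have fM: "finite_measure ?M" by (rule YQ.finite_measure_axioms)
  have fst: "all_moments ?M (\<lambda>z. f (fst z))" if "all_moments ?Y f" for f
    by (rule all_moments_distr[OF measurable_fst]) (use that in \<open>simp add: Q.distr_pair_fst\<close>)
  have snd: "all_moments ?M (\<lambda>z. f (snd z))" if "all_moments ?Q f" for f
  proof (rule all_moments_distr[OF measurable_snd])
    have "distr ?M ?Q snd = ?Q"
    proof (rule measure_eqI)
      fix A assume "A \<in> sets (distr ?M ?Q snd)"
      hence A: "A \<in> sets ?Q" by simp
      have "emeasure (distr ?M ?Q snd) A = emeasure ?M (space ?Y \<times> A)"
        using A sets.sets_into_space[OF A]
        by (subst emeasure_distr) (auto simp: space_pair_measure intro!: arg_cong[where f="emeasure ?M"])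
      also have "\<dots> = emeasure ?Q A"
        using A by (subst Q.emeasure_pair_measure_Times) (auto simp: Y.emeasure_space_1)
      finally show "emeasure (distr ?M ?Q snd) A = emeasure ?Q A" .
    qed simp
    thus "all_moments (distr ?M ?Q snd) f" using that by simp
  qed
  have comp: "all_moments ?Y (\<lambda>x. x j)" if j: "j < n" for j
  proof (rule all_moments_bounded)
    show "finite_measure ?Y" by (rule Y.finite_measure_axioms)
    show "(\<lambda>x. x j) \<in> borel_measurable ?Y"
      using measurable_Rn_component[OF j] by (simp add: measurable_cong_sets[OF sets_trunc_prior refl])
    show "AE x in ?Y. \<bar>x j\<bar> \<le> 2"
      using AE_trunc_prior[of X n, OF sets_X]
    proof eventually_elim
      case (elim x)
      have "(x j)\<^sup>2 \<le> sqnorm n x" unfolding sqnorm_def using j by (intro member_le_sum) auto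
      hence "(x j)\<^sup>2 \<le> 2\<^sup>2" using elim by simp
      thus ?case by (simp only: abs_le_square_iff[symmetric])
    qed
  qed
  have coef: "all_moments ?Y (spike_coef \<beta> n)"
  proof (rule all_moments_bounded)
    show "finite_measure ?Y" by (rule Y.finite_measure_axioms)
    show "spike_coef \<beta> n \<in> borel_measurable ?Y"
      using measurable_spike_coef by (simp add: measurable_cong_sets[OF sets_trunc_prior refl])
    have "\<bar>spike_coef \<beta> n x\<bar> \<le> \<bar>\<beta>\<bar>" for x
    proof (cases "\<beta> * sqnorm n x \<ge> -1")
      case True
      have "\<bar>\<beta>\<bar> / (1 + sqrt (1 + \<beta> * sqnorm n x)) \<le> \<bar>\<beta>\<bar> / 1"
        using True by (intro divide_left_mono) (auto intro: add_pos_nonneg)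
      thus ?thesis using True by (simp add: spike_coef_def abs_divide)
    qed (simp add: spike_coef_def)
    thus "AE x in ?Y. \<bar>spike_coef \<beta> n x\<bar> \<le> \<bar>\<beta>\<bar>" by simp
  qed
  have null: "all_moments ?M (\<lambda>z. snd z i j)" if "i < N" "j < n" for i j
    using snd[OF all_moments_wishart_null_component[of i \<gamma> n j]] that by (simp add: N_def)
  have "all_moments ?M (\<lambda>z. planted_map \<beta> N n (fst z) (snd z) i j)" if ij: "i < N" "j < n" for i j
  proof -
    have "all_moments ?M (\<lambda>z. snd z i j + spike_coef \<beta> n (fst z) * fst z j * (\<Sum>l<n. fst z l * snd z i l))"
      by (intro all_moments_add all_moments_mult all_moments_sum fM null ij fst[OF coef] fst[OF comp]) auto
    thus ?thesis using ij by (simp add: planted_map_def compose_def spike_map_def)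
  qed
  thus ?thesis by (intro all_moments_integrable all_moments_hermite_prod fM)
qed

section \<open>The upper bound\<close>

text \<open>Passing from degree d to d + 2 multiplies the weight by \<beta>^2 (d + 1) / (d + 2), at
  most B. The factor 1/2 comes from degree 2 and must not be lost: it becomes the 1/2 in exp (N w /
  2).\<close>

lemma wick_weight_even_le:
  assumes "\<beta>\<^sup>2 \<le> B" shows "wick_weight \<beta> (2 * Suc j) \<le> B ^ Suc j / 2"
proof (induction j)
  case 0
  thus ?case using assms by (simp add: wick_weight_def numeral_2_eq_2)
next
  case (Suc j)
  let ?d = "2 * Suc j"
  have B: "B \<ge> 0" using assms order_trans[OF zero_le_power2] by blast
  have "wick_weight \<beta> (2 * Suc (Suc j)) = \<beta>\<^sup>2 * (real (Suc ?d) / real (Suc (Suc ?d))) * wick_weight \<beta> ?d"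
  proof -
    have "2 * Suc (Suc j) = Suc (Suc ?d)" by simp
    moreover have "wick_weight \<beta> (Suc (Suc d)) = \<beta>\<^sup>2 * (real (Suc d) / real (Suc (Suc d))) * wick_weight \<beta> d" for d
      by (simp add: wick_weight_def power_mult_distrib divide_simps del: of_nat_Suc) (simp add: power2_eq_square)
    ultimately show ?thesis by (simp only:)
  qed
  also have "\<dots> \<le> (B * 1) * (B ^ Suc j / 2)"
    using assms B Suc by (intro mult_mono) (auto simp: wick_weight_nonneg)
  finally show ?case by simp
qed

lemma sum_atMost_even:
  fixes f :: "nat \<Rightarrow> real"
  assumes "\<And>e. odd e \<Longrightarrow> f e = 0"
  shows "(\<Sum>e\<le>2 * k. f e) = (\<Sum>j\<le>k. f (2 * j))" "(\<Sum>e\<le>Suc (2 * k). f e) = (\<Sum>j\<le>k. f (2 * j))"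
proof -
  show "(\<Sum>e\<le>2 * k. f e) = (\<Sum>j\<le>k. f (2 * j))"
    by (induction k) (use assms in auto)
  thus "(\<Sum>e\<le>Suc (2 * k). f e) = (\<Sum>j\<le>k. f (2 * j))" using assms by simp
qed

text \<open>For B = \<beta>^2 the complete series is (1 - w)^(-1/2). The bound used here is larger
  but has the same linear term w / 2, and that term decides the threshold for small w.\<close>

lemma wick_weight_generating_le:
  assumes B: "\<beta>\<^sup>2 \<le> B" "B > 0" and w: "0 < w" "w < 1"
  shows "(\<Sum>e\<le>2 * k. wick_weight \<beta> e * sqrt (w / B) ^ e) \<le> 1 + w / (2 * (1 - w))"
proof -
  have "(\<Sum>e\<le>2 * k. wick_weight \<beta> e * sqrt (w / B) ^ e) = (\<Sum>j\<le>k. wick_weight \<beta> (2 * j) * sqrt (w / B) ^ (2 * j))"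
    by (rule sum_atMost_even) (simp add: wick_weight_def wick_odd)
  also have "\<dots> = (\<Sum>j\<le>k. wick_weight \<beta> (2 * j) * (w / B) ^ j)"
    using w B by (simp add: power_mult)
  also have "\<dots> = 1 + (\<Sum>j<k. wick_weight \<beta> (2 * Suc j) * (w / B) ^ Suc j)"
    by (simp only: sum.atMost_shift) (simp add: wick_weight_def)
  also have "(\<Sum>j<k. wick_weight \<beta> (2 * Suc j) * (w / B) ^ Suc j) \<le> (\<Sum>j<k. (w / 2) * w ^ j)"
  proof (rule sum_mono)
    fix j
    have "wick_weight \<beta> (2 * Suc j) * (w / B) ^ Suc j \<le> (B ^ Suc j / 2) * (w / B) ^ Suc j"
      using w B by (intro mult_right_mono wick_weight_even_le) auto
    also have "\<dots> = (w / 2) * w ^ j" using B by (simp add: power_divide)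
    finally show "wick_weight \<beta> (2 * Suc j) * (w / B) ^ Suc j \<le> (w / 2) * w ^ j" .
  qed
  also have "\<dots> = (w / 2) * (\<Sum>j<k. w ^ j)" by (simp only: sum_distrib_left)
  also have "\<dots> \<le> (w / 2) * (1 / (1 - w))"
  proof (intro mult_left_mono)
    have "(\<Sum>j<k. w ^ j) = (1 - w ^ k) / (1 - w)" using w by (simp add: sum_gp_strict)
    also have "\<dots> \<le> 1 / (1 - w)" using w by (intro divide_right_mono) auto
    finally show "(\<Sum>j<k. w ^ j) \<le> 1 / (1 - w)" .
  qed (use w in auto)
  finally show ?thesis by simp
qed

text \<open>A coefficient of a power series is bounded by the value at any radius, here \<open>sqrt (w / B)\<close>.\<close>

lemma wick_weight_coefficient_le:
  assumes B: "\<beta>\<^sup>2 \<le> B" "B > 0" and w: "0 < w" "w < 1"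
  shows "(\<Sum>d\<in>compositions N (2 * k). \<Prod>i<N. wick_weight \<beta> (d i)) \<le> (B / w) ^ k * exp (real N * (w / (2 * (1 - w))))"
proof -
  define z where "z = sqrt (w / B)"
  have z: "z > 0" "z\<^sup>2 = w / B" using w B by (auto simp: z_def)
  have "(\<Sum>d\<in>compositions N (2 * k). \<Prod>i<N. wick_weight \<beta> (d i))
      = (\<Sum>d\<in>compositions N (2 * k). (B / w) ^ k * (\<Prod>i<N. wick_weight \<beta> (d i) * z ^ d i))"
  proof (intro sum.cong refl)
    fix d assume "d \<in> compositions N (2 * k)"
    hence "(\<Prod>i<N. z ^ d i) = z ^ (2 * k)" by (simp add: compositions_def power_sum[symmetric])
    also have "\<dots> = (w / B) ^ k" by (simp add: power_mult z)
    finally have "(\<Prod>i<N. wick_weight \<beta> (d i) * z ^ d i) = row_weight \<beta> N d * (w / B) ^ k"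
      by (simp add: prod.distrib)
    moreover have "(B / w) ^ k * (w / B) ^ k = 1" using w B by (simp add: power_mult_distrib[symmetric])
    ultimately show "row_weight \<beta> N d = (B / w) ^ k * (\<Prod>i<N. wick_weight \<beta> (d i) * z ^ d i)"
      by (simp add: mult_ac)
  qed
  also have "\<dots> = (B / w) ^ k * (\<Sum>d\<in>compositions N (2 * k). \<Prod>i<N. wick_weight \<beta> (d i) * z ^ d i)"
    by (simp add: sum_distrib_left)
  also have "\<dots> \<le> (B / w) ^ k * exp (real N * (w / (2 * (1 - w))))"
  proof (intro mult_left_mono)
    \<comment> \<open>Since all terms are nonnegative, the constraint on the total degree may be
      relaxed to a box, over which the sum factors into N equal generating functions.\<close>
    have sub: "compositions N (2 * k) \<subseteq> {..<N} \<rightarrow>\<^sub>E {..2 * k}"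
    proof
      fix a assume a: "a \<in> compositions N (2 * k)"
      have "a j \<le> 2 * k" if "j < N" for j
        using a that member_le_sum[of j "{..<N}" a] by (auto simp: compositions_def)
      thus "a \<in> {..<N} \<rightarrow>\<^sub>E {..2 * k}" using a by (auto simp: compositions_def PiE_iff)
    qed
    have "(\<Sum>d\<in>compositions N (2 * k). \<Prod>i<N. wick_weight \<beta> (d i) * z ^ d i)
        \<le> (\<Sum>d\<in>{..<N} \<rightarrow>\<^sub>E {..2 * k}. \<Prod>i<N. wick_weight \<beta> (d i) * z ^ d i)"
    proof (rule sum_mono2[OF _ sub])
      show "finite ({..<N} \<rightarrow>\<^sub>E {..2 * k})" by (intro finite_PiE) auto
      show "0 \<le> (\<Prod>i<N. wick_weight \<beta> (d i) * z ^ d i)" for d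
        using z(1) by (intro prod_nonneg mult_nonneg_nonneg wick_weight_nonneg) simp
    qed
    also have "\<dots> = (\<Prod>i<N. \<Sum>e\<le>2 * k. wick_weight \<beta> e * z ^ e)"
      by (rule prod_sum_PiE[symmetric]) auto
    also have "\<dots> = (\<Sum>e\<le>2 * k. wick_weight \<beta> e * z ^ e) ^ N" by simp
    also have "\<dots> \<le> (1 + w / (2 * (1 - w))) ^ N"
    proof (rule power_mono)
      show "(\<Sum>e\<le>2 * k. wick_weight \<beta> e * z ^ e) \<le> 1 + w / (2 * (1 - w))"
        unfolding z_def by (rule wick_weight_generating_le[OF B w])
      show "0 \<le> (\<Sum>e\<le>2 * k. wick_weight \<beta> e * z ^ e)"
        using z(1) by (intro sum_nonneg mult_nonneg_nonneg wick_weight_nonneg) simp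
    qed
    also have "\<dots> \<le> exp (w / (2 * (1 - w))) ^ N"
      using w by (intro power_mono exp_ge_add_one_self) (auto intro!: add_nonneg_nonneg divide_nonneg_nonneg)
    also have "\<dots> = exp (real N * (w / (2 * (1 - w))))" by (simp only: exp_of_nat_mult)
    finally show "(\<Sum>d\<in>compositions N (2 * k). \<Prod>i<N. wick_weight \<beta> (d i) * z ^ d i) \<le> exp (real N * (w / (2 * (1 - w))))" .
  qed (use w B in auto)
  finally show ?thesis .
qed

text \<open>The induction step is e <= (1 + 1/m)^(m+1), obtained from 1 + u <= exp u at u =
  -1/(m+1). The prefactor m in place of sqrt m costs only a polynomial factor, which the geometric
  decay in k absorbs.\<close>

lemma fact_le_stirling: "m \<ge> 1 \<Longrightarrow> fact m \<le> exp 1 * real m * (real m / exp 1) ^ m"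
proof (induction m rule: nat_induct_at_least)
  case base
  show ?case by simp
next
  case (Suc m)
  let ?m = "real m" and ?e = "exp 1 :: real"
  have m: "?m > 0" using Suc by simp
  have "exp (- (1 / (?m + 1))) \<ge> 1 - 1 / (?m + 1)"
    using exp_ge_add_one_self[of "- (1 / (?m + 1))"] by simp
  hence "?m / (?m + 1) * exp (1 / (?m + 1)) \<le> 1"
    using m by (simp add: exp_minus field_simps)
  hence "(?m / (?m + 1) * exp (1 / (?m + 1))) ^ Suc m \<le> 1 ^ Suc m" using m by (intro power_mono) auto
  moreover have "(?m / (?m + 1) * exp (1 / (?m + 1))) ^ Suc m = ?m ^ Suc m / (?m + 1) ^ Suc m * ?e"
  proof -
    have "exp (1 / (?m + 1)) ^ Suc m = exp (real (Suc m) * (1 / (?m + 1)))" by (simp only: exp_of_nat_mult)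
    also have "real (Suc m) * (1 / (?m + 1)) = 1" using m by (simp add: field_simps)
    finally show ?thesis by (simp only: power_mult_distrib power_divide)
  qed
  ultimately have *: "?m ^ Suc m * ?e \<le> (?m + 1) ^ Suc m"
    using m by (simp add: field_simps del: power_Suc)
  have "fact (Suc m) = (?m + 1) * fact m" by simp
  also have "\<dots> \<le> (?m + 1) * (?e * ?m * (?m / ?e) ^ m)" using Suc.IH m by (intro mult_left_mono) auto
  also have "\<dots> = (?m + 1) * (?m ^ Suc m * ?e / ?e ^ m)" by (simp add: power_divide field_simps)
  also have "\<dots> \<le> (?m + 1) * ((?m + 1) ^ Suc m / ?e ^ m)"
    using * m by (intro mult_left_mono divide_right_mono) auto
  also have "\<dots> = ?e * real (Suc m) * (real (Suc m) / ?e) ^ Suc m"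
    by (simp add: power_divide field_simps)
  finally show ?case .
qed

text \<open>At the optimal w and t both exponentials are at most exp (k (1 + \<delta>)). Their joint
  e^(2k) cancels against (2k)! / (2k)^(2k), leaving B N / n and the loss exp (2 \<delta>), both to
  the power k. In 4e the factors are 2 from the two tails, 2 from the degree 2k, and e from the
  factorial bound.\<close>

lemma degree_term_le:
  fixes n N k :: nat
  assumes pos: "n > 0" "N > 0" "k > 0" and B: "B > 0" and \<delta>: "\<delta> > 0"
    and w: "2 * real k / real N \<le> \<delta> / (1 + \<delta>)"
    and \<rho>: "B * real N / real n * exp (2 * \<delta>) \<le> \<rho>"
  defines "w \<equiv> 2 * real k / real N" and "t \<equiv> sqrt (2 * real k / real n)"
  shows "(B / w) ^ k * exp (real N * (w / (2 * (1 - w))))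
       * (2 * fact (2 * k) / (t * real n) ^ (2 * k) * exp (real n * ((1 + \<delta>) * t\<^sup>2 / 2)))
       \<le> 4 * exp 1 * (\<rho> ^ k * real k)"
proof -
  let ?k = "real k" and ?n = "real n" and ?N = "real N"
  \<comment> \<open>The threshold \<delta> / (1 + \<delta>) is exactly where 1 / (1 - w) reaches 1 +
    \<delta>.\<close>
  have w1: "w < 1" "1 / (1 - w) \<le> 1 + \<delta>"
  proof -
    have "w \<le> \<delta> / (1 + \<delta>)" using w by (simp add: w_def)
    hence "1 - w \<ge> 1 / (1 + \<delta>)" using \<delta> by (simp add: field_simps)
    moreover have "1 / (1 + \<delta>) > 0" using \<delta> by simp
    ultimately show "w < 1" "1 / (1 - w) \<le> 1 + \<delta>"
      using le_imp_inverse_le[of "1 / (1 + \<delta>)" "1 - w"] by (linarith, simp add: inverse_eq_divide)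
  qed
  have t2: "t\<^sup>2 = 2 * ?k / ?n" by (simp add: t_def)
  have e1: "exp (?N * (w / (2 * (1 - w)))) \<le> exp (?k * (1 + \<delta>))"
  proof -
    have Nw: "?N * w = 2 * ?k" using pos by (simp add: w_def)
    have "?N * (w / (2 * (1 - w))) = ?N * w / (2 * (1 - w))" by simp
    also have "\<dots> = ?k * (1 / (1 - w))" unfolding Nw using w1 by (simp add: field_simps)
    also have "\<dots> \<le> ?k * (1 + \<delta>)" using w1 by (intro mult_left_mono) auto
    finally show ?thesis by simp
  qed
  have e2: "exp (?n * ((1 + \<delta>) * t\<^sup>2 / 2)) = exp (?k * (1 + \<delta>))" using pos by (simp add: t2)
  have tn: "(t * ?n) ^ (2 * k) = (2 * ?k) ^ k * ?n ^ k"
  proof -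
    have "(t * ?n)\<^sup>2 = 2 * ?k * ?n" 
      using pos by (simp only: power_mult_distrib t2) (simp add: power2_eq_square)
    thus ?thesis by (simp only: power_mult power_mult_distrib)
  qed
  have Bw: "(B / w) ^ k = (B * ?N) ^ k / (2 * ?k) ^ k" by (simp add: w_def power_divide)
  have "(B / w) ^ k * exp (?N * (w / (2 * (1 - w)))) * (2 * fact (2 * k) / (t * ?n) ^ (2 * k) * exp (?n * ((1 + \<delta>) * t\<^sup>2 / 2)))
      \<le> (B / w) ^ k * exp (?k * (1 + \<delta>)) * (2 * fact (2 * k) / (t * ?n) ^ (2 * k) * exp (?k * (1 + \<delta>)))"
    unfolding e2 using B pos by (intro mult_right_mono mult_left_mono e1) (auto simp: w_def t_def)
  also have "\<dots> = 2 * (B * ?N / ?n) ^ k * (fact (2 * k) / ((2 * ?k) ^ k * (2 * ?k) ^ k)) * (exp (?k * (1 + \<delta>)) * exp (?k * (1 + \<delta>)))"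
    unfolding tn Bw using pos by (simp add: power_divide mult_ac)
  also have "exp (?k * (1 + \<delta>)) * exp (?k * (1 + \<delta>)) = exp 1 ^ (2 * k) * exp (2 * \<delta>) ^ k"
    unfolding exp_of_nat_mult[symmetric] exp_add[symmetric] by (simp add: algebra_simps)
  also have "2 * (B * ?N / ?n) ^ k * (fact (2 * k) / ((2 * ?k) ^ k * (2 * ?k) ^ k)) * (exp 1 ^ (2 * k) * exp (2 * \<delta>) ^ k)
     = 2 * (B * ?N / ?n * exp (2 * \<delta>)) ^ k * (fact (2 * k) * (exp 1 ^ (2 * k) / (2 * ?k) ^ (2 * k)))"
  proof -
    have "(2 * ?k) ^ k * (2 * ?k) ^ k = (2 * ?k) ^ (2 * k)" by (simp only: mult_2 power_add)
    thus ?thesis by (simp only: power_mult_distrib) (simp only: times_divide_eq_right times_divide_eq_left mult_ac)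
  qed
  also have "\<dots> \<le> 2 * \<rho> ^ k * (exp 1 * (2 * ?k))"
  proof (rule mult_mono)
    have nonneg: "0 \<le> B * ?N / ?n * exp (2 * \<delta>)" using B by simp
    from power_mono[OF \<rho> this, of k] show "2 * (B * ?N / ?n * exp (2 * \<delta>)) ^ k \<le> 2 * \<rho> ^ k"
      by (intro mult_left_mono) auto
    show "0 \<le> 2 * \<rho> ^ k" using order_trans[OF nonneg \<rho>] by simp
    have "fact (2 * k) \<le> exp 1 * real (2 * k) * (real (2 * k) / exp 1) ^ (2 * k)"
      using pos by (intro fact_le_stirling) simp
    hence "fact (2 * k) * (exp 1 ^ (2 * k) / (2 * ?k) ^ (2 * k))
        \<le> exp 1 * real (2 * k) * (real (2 * k) / exp 1) ^ (2 * k) * (exp 1 ^ (2 * k) / (2 * ?k) ^ (2 * k))"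
      by (rule mult_right_mono) simp
    also have "\<dots> = exp 1 * (2 * ?k)" using pos by (simp add: power_divide)
    finally show "fact (2 * k) * (exp 1 ^ (2 * k) / (2 * ?k) ^ (2 * k)) \<le> exp 1 * (2 * ?k)" .
  qed simp
  finally show ?thesis by (simp add: mult_ac)
qed

lemma sum_row_degrees:
  fixes F :: "(nat \<Rightarrow> nat) \<Rightarrow> real"
  shows "(\<Sum>d\<in>row_degrees N D. F d) = (\<Sum>m\<le>D. \<Sum>d\<in>compositions N m. F d)"
  unfolding row_degrees_eq_UN
  by (rule sum.UNION_disjoint) (auto simp: finite_compositions, auto simp: compositions_def)

text \<open>Degree 0 contributes 1, odd degrees nothing, and degree 2k at most a constant times k
  \<rho>^k, so the sum is bounded by a convergent series free of n and D. The two conditions on D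
  keep t = sqrt (2k/n) where the moment generating function is controlled and w = 2k/N where 1 / (1
  - w) is close to 1.\<close>

lemma low_degree_norm_trunc_le:
  fixes \<gamma> n defines "N \<equiv> num_samples \<gamma> n"
  assumes std: "standardized \<pi>" and n: "n > 0" and N: "N > 0" and \<delta>: "\<delta> > 0"
    and B: "\<beta>\<^sup>2 \<le> B" "B > 0" and \<rho>: "B * real N / real n * exp (2 * \<delta>) \<le> \<rho>" "\<rho> < 1"
    and mgf: "\<And>t. \<bar>t\<bar> \<le> t0 \<Longrightarrow> product_mgf \<pi> t \<le> ennreal (exp ((1 + \<delta>) * t\<^sup>2 / 2))"
    and t0: "t0 > 0" and D: "real D \<le> t0\<^sup>2 * real n" "real D / real N \<le> \<delta> / (1 + \<delta>)"
  shows "low_degree_norm \<gamma> \<beta> (trunc_prior \<beta> (iid_prior \<pi>)) D n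
     \<le> ennreal (sqrt (1 + 4 * exp 1 * (\<Sum>k. \<rho> ^ k * real k)))"
proof -
  let ?X = "trunc_prior \<beta> (iid_prior \<pi>)"
  have pX: "prob_space (?X n)"
    by (rule prob_space_trunc_prior[of "iid_prior \<pi>" n, OF prob_space_iid_prior[OF std] sets_iid_prior])
  have sX: "sets (?X n) = sets (Rn n)" by (rule sets_trunc_prior)
  have good: "AE x in ?X n. \<beta> * sqnorm n x > -1"
    using AE_trunc_prior[of "iid_prior \<pi>" n \<beta>, OF sets_iid_prior] by eventually_elim simp
  have int: "\<forall>\<alpha>\<in>exponents N n D. integrable (?X n \<Otimes>\<^sub>M wishart_null \<gamma> n)
           (planted_hermite \<beta> N n \<alpha>)"
    unfolding N_def
    by (intro ballI trunc_prior_hermite_integrable[of "iid_prior \<pi>" n] prob_space_iid_prior[OF std] sets_iid_prior)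
  have \<rho>0: "\<rho> \<ge> 0" using order_trans[OF _ \<rho>(1)] B by simp
  define r where "r m = (\<integral>z. overlap n z ^ m \<partial>(?X n \<Otimes>\<^sub>M ?X n))" for m
  define c where "c m = (\<Sum>d\<in>compositions N m. \<Prod>i<N. wick_weight \<beta> (d i))" for m
  interpret Xn: prob_space "?X n" by fact
  interpret XX: pair_prob_space "?X n" "?X n" ..
  have "compositions N 0 = {\<lambda>i\<in>{..<N}. 0}" by (auto simp: compositions_def PiE_iff extensional_def fun_eq_iff)
  hence c0: "c 0 = 1" by (simp add: c_def wick_weight_def)
  have r0: "r 0 = 1" unfolding r_def by (simp only: power_0 lebesgue_integral_const XX.prob_space) simp
  have c_nonneg: "c m \<ge> 0" for m unfolding c_def by (intro sum_nonneg prod_nonneg wick_weight_nonneg)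
  have c_odd: "c m = 0" if "odd m" for m
    unfolding c_def
  proof (intro sum.neutral ballI)
    fix d assume "d \<in> compositions N m"
    hence "odd (\<Sum>i<N. d i)" using that by (simp add: compositions_def)
    then obtain i where "i < N" "odd (d i)" by (metis dvd_sum lessThan_iff)
    thus "row_weight \<beta> N d = 0"
      by (intro prod_zero) (auto intro!: bexI[of _ i] simp: wick_weight_def wick_odd)
  qed
  have term_le: "c (2 * k) * r (2 * k) \<le> 4 * exp 1 * (\<rho> ^ k * real k)" if k: "0 < k" "2 * k \<le> D" for k
  proof -
    let ?w = "2 * real k / real N" and ?t = "sqrt (2 * real k / real n)"
    have kD: "2 * real k \<le> real D" using k by simp
    have "?w \<le> real D / real N" using kD by (intro divide_right_mono) auto
    hence w: "?w \<le> \<delta> / (1 + \<delta>)" using D(2) by linarith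
    also have "\<dots> < 1" using \<delta> by simp
    finally have w1: "?w < 1" .
    have "2 * real k \<le> t0\<^sup>2 * real n" using kD D(1) by linarith
    hence "?t \<le> t0" using n t0 by (intro real_le_lsqrt) (auto simp: divide_le_eq)
    hence mgf': "product_mgf \<pi> u \<le> ennreal (exp ((1 + \<delta>) * u\<^sup>2 / 2))" if "\<bar>u\<bar> \<le> ?t" for u
      using that by (intro mgf) linarith
    let ?R = "2 * fact (2 * k) / (?t * real n) ^ (2 * k) * exp (real n * ((1 + \<delta>) * ?t\<^sup>2 / 2))"
    have "r (2 * k) \<le> ?R" unfolding r_def
    proof (rule trunc_prior_overlap_moment_le[of "iid_prior \<pi>" n, OF prob_space_iid_prior[OF std] sets_iid_prior k(1)])
      show "(\<integral>\<^sup>+z. ennreal (overlap n z ^ (2 * k)) \<partial>(iid_prior \<pi> n \<Otimes>\<^sub>M iid_prior \<pi> n)) \<le> ennreal ?R"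
        by (rule iid_overlap_moment_le[OF std n _ mgf']) (use k n in auto)
    qed auto
    hence "c (2 * k) * r (2 * k) \<le> c (2 * k) * ?R" by (intro mult_left_mono c_nonneg)
    also have "\<dots> \<le> (B / ?w) ^ k * exp (real N * (?w / (2 * (1 - ?w)))) * ?R"
    proof (rule mult_right_mono)
      show "c (2 * k) \<le> (B / ?w) ^ k * exp (real N * (?w / (2 * (1 - ?w))))"
        unfolding c_def using k N by (intro wick_weight_coefficient_le[OF B _ w1]) simp
    qed simp
    also have "\<dots> \<le> 4 * exp 1 * (\<rho> ^ k * real k)"
      by (rule degree_term_le[OF n N k(1) B(2) \<delta> w \<rho>(1)])
    finally show ?thesis .
  qed
  have "(\<Sum>d\<in>row_degrees N D. row_weight \<beta> N d * overlap_mean n (?X n) (\<Sum>i<N. d i))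
      = (\<Sum>m\<le>D. c m * r m)"
    unfolding sum_row_degrees c_def r_def sum_distrib_right
    by (intro sum.cong refl) (simp add: compositions_def)
  also have "\<dots> = (\<Sum>j\<le>D div 2. c (2 * j) * r (2 * j))"
  proof (cases "even D")
    case True
    then obtain h where "D = 2 * h" by blast
    thus ?thesis using sum_atMost_even(1)[of "\<lambda>m. c m * r m" h] c_odd by simp
  next
    case False
    then obtain h where "D = 2 * h + 1" by (rule oddE)
    thus ?thesis using sum_atMost_even(2)[of "\<lambda>m. c m * r m" h] c_odd by simp
  qed
  also have "\<dots> = 1 + (\<Sum>j<D div 2. c (2 * Suc j) * r (2 * Suc j))"
    unfolding sum.atMost_shift using c0 r0 by simp
  also have "(\<Sum>j<D div 2. c (2 * Suc j) * r (2 * Suc j)) \<le> (\<Sum>j<D div 2. 4 * exp 1 * (\<rho> ^ Suc j * real (Suc j)))"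
    by (intro sum_mono term_le) auto
  also have "\<dots> = 4 * exp 1 * (\<Sum>j<D div 2. \<rho> ^ Suc j * real (Suc j))" by (simp only: sum_distrib_left)
  also have "(\<Sum>j<D div 2. \<rho> ^ Suc j * real (Suc j)) = (\<Sum>j<Suc (D div 2). \<rho> ^ j * real j)"
    by (subst sum.lessThan_Suc_shift) simp
  also have "\<dots> \<le> (\<Sum>k. \<rho> ^ k * real k)"
    using geometric_sums_times_n[of \<rho>] \<rho>0 \<rho>(2)
    by (intro sum_le_suminf) (auto simp: sums_iff)
  finally have S: "(\<Sum>d\<in>row_degrees N D. row_weight \<beta> N d * overlap_mean n (?X n) (\<Sum>i<N. d i))
     \<le> 1 + 4 * exp 1 * (\<Sum>k. \<rho> ^ k * real k)" by simp
  have "low_degree_norm \<gamma> \<beta> ?X D n = ennreal (sqrt (\<Sum>\<alpha>\<in>exponents N n D.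
         (\<integral>x. wick_prod \<beta> N n \<alpha> * spike_monomial N n \<alpha> x \<partial>?X n)\<^sup>2
           / multi_fact N n \<alpha>))"
    using int unfolding N_def by (intro low_degree_norm_eq_hermite_sum[of ?X n] pX sX good)
  also have "(\<Sum>\<alpha>\<in>exponents N n D.
         (\<integral>x. wick_prod \<beta> N n \<alpha> * spike_monomial N n \<alpha> x \<partial>?X n)\<^sup>2
           / multi_fact N n \<alpha>)
      = (\<Sum>d\<in>row_degrees N D. row_weight \<beta> N d * overlap_mean n (?X n) (\<Sum>i<N. d i))"
  proof (rule hermite_sum_eq_overlap_sum[OF pX])
    fix \<alpha> assume "\<alpha> \<in> exponents N n D"
    thus "integrable (?X n) (\<lambda>x. wick_prod \<beta> N n \<alpha> * spike_monomial N n \<alpha> x)"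
      using likelihood_ratio_hermite_integral[of ?X n, OF pX sX good, of \<gamma> \<alpha>] int
      by (simp add: N_def has_bochner_integral_iff)
  qed
  finally show ?thesis using S by (simp add: ennreal_leI)
qed

lemma low_degree_norm_trunc_bounded:
  assumes \<gamma>: "\<gamma> > 0" and \<beta>: "\<beta>\<^sup>2 < \<gamma>" and sg: "subgaussian \<pi>" and std: "standardized \<pi>"
    and D: "(\<lambda>n. real (D n)) \<in> o(\<lambda>n. real n / ln (real n))"
  shows "\<exists>C::real. \<forall>\<^sub>F n in sequentially.
           low_degree_norm \<gamma> \<beta> (trunc_prior \<beta> (iid_prior \<pi>)) (D n) n \<le> ennreal C"
proof -
  \<comment> \<open>Strictly below \<gamma>, and positive even for \<beta> = 0, so that division by
    B is safe.\<close>
  define B where "B = (\<beta>\<^sup>2 + \<gamma>) / 2"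
  have B: "\<beta>\<^sup>2 \<le> B" "B > 0" "B < \<gamma>"
    using \<beta> \<gamma> by (auto simp: B_def intro: add_nonneg_pos)
  \<comment> \<open>Then exp (2 \<delta>) = sqrt (\<gamma> / B), so the limiting ratio B / \<gamma>
    * exp (2 \<delta>) equals sqrt (B / \<gamma>), below 1 with room for a \<rho> in
    between.\<close>
  define \<delta> where "\<delta> = ln (\<gamma> / B) / 4"
  have \<delta>: "\<delta> > 0" using B \<gamma> by (simp add: \<delta>_def)
  have lt1: "B / \<gamma> * exp (2 * \<delta>) < 1"
  proof -
    have "exp (2 * \<delta>) < exp (ln (\<gamma> / B))" using \<delta> by (simp add: \<delta>_def)
    also have "\<dots> = \<gamma> / B" using B \<gamma> by simp
    finally have "B / \<gamma> * exp (2 * \<delta>) < B / \<gamma> * (\<gamma> / B)" using B \<gamma> by (intro mult_strict_left_mono) auto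
    thus ?thesis using B \<gamma> by simp
  qed
  from dense[OF lt1] obtain \<rho> where \<rho>: "B / \<gamma> * exp (2 * \<delta>) < \<rho>" "\<rho> < 1" by blast
  obtain t0 where t0: "t0 > 0" and mgf: "\<And>t. \<bar>t\<bar> \<le> t0 \<Longrightarrow>
     product_mgf \<pi> t \<le> ennreal (exp ((1 + \<delta>) * t\<^sup>2 / 2))"
    using subgaussian_product_mgf[OF sg std \<delta>] by blast
  \<comment> \<open>D <= \<eta> n gives the bound by t0^2 n directly, and D / N <= \<eta> \<gamma>
    <= \<delta> / (1 + \<delta>) because N >= n / \<gamma>.\<close>
  define \<eta> where "\<eta> = min (t0\<^sup>2) (\<delta> / (1 + \<delta>) / \<gamma>)"
  have \<eta>: "\<eta> > 0" using t0 \<delta> \<gamma> by (simp add: \<eta>_def)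
  have "(\<lambda>n. B * (real (num_samples \<gamma> n) / real n) * exp (2 * \<delta>)) \<longlonglongrightarrow> B * (1 / \<gamma>) * exp (2 * \<delta>)"
    by (intro tendsto_mult tendsto_const num_samples_ratio_tendsto[OF \<gamma>])
  hence ev\<rho>: "\<forall>\<^sub>F n in sequentially. B * (real (num_samples \<gamma> n) / real n) * exp (2 * \<delta>) < \<rho>"
    using \<rho> by (intro order_tendstoD) auto
  \<comment> \<open>From n = 3 on, n exceeds e, so ln n >= 1 and n / ln n <= n.\<close>
  have evD: "\<forall>\<^sub>F n in sequentially. real (D n) \<le> \<eta> * real n"
    using landau_o.smallD[OF D \<eta>] eventually_ge_at_top[of 3]
  proof eventually_elim
    case (elim n)
    have "exp 1 \<le> real n" using elim(2) exp_le by linarith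
    hence "ln (real n) \<ge> 1" using elim(2) by (simp add: ln_ge_iff)
    hence "real n / ln (real n) \<le> real n / 1" by (intro divide_left_mono) auto
    hence "\<eta> * (real n / ln (real n)) \<le> \<eta> * (real n / 1)" using \<eta> by (intro mult_left_mono) auto
    thus ?case using elim(1) \<open>ln (real n) \<ge> 1\<close> by simp
  qed
  have "\<forall>\<^sub>F n in sequentially. low_degree_norm \<gamma> \<beta> (trunc_prior \<beta> (iid_prior \<pi>)) (D n) n
         \<le> ennreal (sqrt (1 + 4 * exp 1 * (\<Sum>k. \<rho> ^ k * real k)))"
    using ev\<rho> evD eventually_gt_at_top[of 0] eventually_compose_filterlim[OF eventually_gt_at_top[of 0] filterlim_num_samples[OF \<gamma>]]
  proof eventually_elim
    case (elim n)
    show ?case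
    proof (rule low_degree_norm_trunc_le[OF std elim(3,4) \<delta> B(1,2) _ \<rho>(2) mgf t0])
      show "B * real (num_samples \<gamma> n) / real n * exp (2 * \<delta>) \<le> \<rho>" using elim(1) by simp
      show "real (D n) \<le> t0\<^sup>2 * real n"
        using elim(2) mult_right_mono[of \<eta> "t0\<^sup>2" "real n"] by (simp add: \<eta>_def)
      have "real (D n) / real (num_samples \<gamma> n) \<le> \<eta> * real n / (real n / \<gamma>)"
        using elim num_samples_bounds(1)[OF \<gamma>, of n] \<gamma> \<eta> by (intro frac_le) auto
      also have "\<dots> = \<eta> * \<gamma>" using elim(3) by simp
      also have "\<dots> \<le> \<delta> / (1 + \<delta>) / \<gamma> * \<gamma>" using \<gamma> by (intro mult_right_mono) (auto simp: \<eta>_def)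
      finally show "real (D n) / real (num_samples \<gamma> n) \<le> \<delta> / (1 + \<delta>)" using \<gamma> by simp
    qed
  qed
  thus ?thesis by blast
qed

theorem theorem3p2:
  fixes \<gamma> \<beta> :: real
  assumes "\<gamma> > 0" and "\<beta> > -1"
  shows "(\<beta>\<^sup>2 < \<gamma> \<longrightarrow>
           (\<forall>\<pi> :: real measure. subgaussian \<pi> \<and> standardized \<pi> \<longrightarrow>
             (\<forall>D :: nat \<Rightarrow> nat. (\<lambda>n. real (D n)) \<in> o(\<lambda>n. real n / ln (real n)) \<longrightarrow>
               (\<exists>C :: real. \<forall>\<^sub>F n in sequentially.
                  low_degree_norm \<gamma> \<beta> (trunc_prior \<beta> (iid_prior \<pi>)) (D n) n \<le> ennreal C)))) \<and>
         (\<beta>\<^sup>2 > \<gamma> \<longrightarrow>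
           (\<forall>\<pi> :: real measure. standardized \<pi> \<and> symmetric_about_zero \<pi> \<and>
               beta_good \<beta> (iid_prior \<pi>) \<longrightarrow>
             (\<forall>D :: nat \<Rightarrow> nat. (\<lambda>n. real (D n)) \<in> \<omega>(\<lambda>_. 1) \<longrightarrow>
               (\<lambda>n. low_degree_norm \<gamma> \<beta> (iid_prior \<pi>) (D n) n) \<longlonglongrightarrow> \<infinity>)))"
  using low_degree_norm_trunc_bounded[OF assms(1)] low_degree_norm_iid_tendsto_infinity[OF assms(1)]
  by blast

end
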